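(* Let $1\le k\le n$ be integers, let $A,B$ be $L_2$-zonoids in $\mathbb{R}^n$ and let $Z_1,\dots,Z_k$ be zonoids in $\mathbb{R}^n$. (a) If $V(A[n-k],Z_1,\dots,Z_k)>0$ and $V(B[n-k],Z_1,\dots,Z_k)>0$, then $$\left(\frac{|A\oplus_2B|}{V((A\oplus_2B)[n-k],Z_1,\dots,Z_k)}\right)^{2/k}\ge\left(\frac{|A|}{V(A[n-k],Z_1,\dots,Z_k)}\right)^{2/k}+\left(\frac{|B|}{V(B[n-k],Z_1,\dots,Z_k)}\right)^{2/k}.$$ (b) If $V(A[n-k],Z_1,\dots,Z_k)>0$, then the function $$f(t)=\left(\frac{|A\oplus_2\sqrt{t}B|}{V((A\oplus_2\sqrt{t}B)[n-k],Z_1,\dots,Z_k)}\right)^{2/k},\qquad t\ge0,$$ is concave on $\mathbb{R}_+=[0,\infty)$. (c) If $|\partial A|>0$ and $|\partial B|>0$, then $$\frac{|A\oplus_2B|^2}{|\partial(A\oplus_2B)|^2}\ge\frac{|A|^2}{|\partial A|^2}+\frac{|B|^2}{|\partial B|^2}.$$ (d) If $|\partial A|>0$, then the function $$g(t)=\frac{|A\oplus_2\sqrt{t}B|^2}{|\partial(A\oplus_2\sqrt{t}B)|^2},\qquad t\ge0,$$ is concave on $\mathbb{R}_+$.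
   Context: $h_K(x)=\max_{y\in K}\langle x,y\rangle$ is the support function. For compact convex sets $K,L$ containing the origin, the $\ell_2$-sum $K\oplus_2L$ is the compact convex set with $h_{K\oplus_2L}(x)=(h_K(x)^2+h_L(x)^2)^{1/2}$. An $L_2$-zonotope is an $\ell_2$-sum of finitely many centered segments $[-w,w]$; an $L_2$-zonoid is a Hausdorff limit of $L_2$-zonotopes (equivalently an origin-centered, possibly lower-dimensional, ellipsoid). A zonotope is a finite Minkowski sum of segments; a zonoid is a Hausdorff limit of zonotopes. $|\cdot|$ is $n$-dimensional volume. $V$ is the mixed volume, normalized by $V(K,\dots,K)=|K|$, and $K[j]$ means $K$ repeated $j$ times. $|\partial K|=nV(K[n-1],B_2^n)$ is the surface area, with $B_2^n$ the closed Euclidean unit ball. *)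

theory Defs
  imports "HOL-Analysis.Analysis"
begin

abbreviation vol :: "(real ^ 'n) set \<Rightarrow> real" where
  "vol K \<equiv> measure lebesgue K"

text \<open>For nonempty compact \<open>K\<close> the supremum is the maximum of \<open>\<langle>x, y\<rangle>\<close> over \<open>y \<in> K\<close>.\<close>

definition support_function :: "(real ^ 'n) set \<Rightarrow> real ^ 'n \<Rightarrow> real" where
  "support_function K x = (SUP y\<in>K. x \<bullet> y)"

text \<open>A nonempty compact convex set is determined by its support function, so the set below is
  unique; it exists whenever \<open>K\<close> and \<open>L\<close> are compact, convex and contain the origin, and only
  such arguments are meaningful.\<close>

definition l2_sum :: "(real ^ 'n) set \<Rightarrow> (real ^ 'n) set \<Rightarrow> (real ^ 'n) set"
    (infixl "\<oplus>\<^sub>2" 65) where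
  "K \<oplus>\<^sub>2 L = (THE M. M \<noteq> {} \<and> compact M \<and> convex M \<and>
     (\<forall>x. support_function M x = sqrt ((support_function K x)\<^sup>2 + (support_function L x)\<^sup>2)))"

definition hausdorff_distance :: "(real ^ 'n) set \<Rightarrow> (real ^ 'n) set \<Rightarrow> real" where
  "hausdorff_distance K L = max (SUP x\<in>K. infdist x L) (SUP y\<in>L. infdist y K)"

text \<open>Hausdorff limits are taken in the space of nonempty compact sets.\<close>

definition hausdorff_limit :: "(nat \<Rightarrow> (real ^ 'n) set) \<Rightarrow> (real ^ 'n) set \<Rightarrow> bool" where
  "hausdorff_limit P K \<longleftrightarrow> K \<noteq> {} \<and> compact K \<and> (\<lambda>m. hausdorff_distance (P m) K) \<longlonglongrightarrow> 0"

text \<open>The set \<open>{0}\<close> in which the iterated sum starts is the unit of \<open>\<oplus>\<^sub>2\<close>, and is itself the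
  degenerate segment \<open>[-0, 0]\<close>.\<close>

definition L2_zonotope :: "(real ^ 'n) set \<Rightarrow> bool" where
  "L2_zonotope P \<longleftrightarrow> (\<exists>ws. P = foldr (\<lambda>w K. closed_segment (- w) w \<oplus>\<^sub>2 K) ws {0})"

definition L2_zonoid :: "(real ^ 'n) set \<Rightarrow> bool" where
  "L2_zonoid K \<longleftrightarrow> (\<exists>P. (\<forall>m. L2_zonotope (P m)) \<and> hausdorff_limit P K)"

text \<open>Addition of sets is the Minkowski sum of \<^theory>\<open>HOL-Library.Set_Algebras\<close>.\<close>

definition zonotope :: "(real ^ 'n) set \<Rightarrow> bool" where
  "zonotope P \<longleftrightarrow> (\<exists>ss. P = (\<Sum>(a, b)\<leftarrow>ss. closed_segment a b))"

definition zonoid :: "(real ^ 'n) set \<Rightarrow> bool" where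
  "zonoid K \<longleftrightarrow> (\<exists>P. (\<forall>m. zonotope (P m)) \<and> hausdorff_limit P K)"

text \<open>
  Minkowski's definition of \<open>V(K\<^sub>1, \<dots>, K\<^sub>n)\<close> for compact convex sets in \<open>\<real>\<^sup>n\<close>: the volume
  \<open>|\<lambda>\<^sub>1 K\<^sub>1 + \<dots> + \<lambda>\<^sub>n K\<^sub>n|\<close> is a homogeneous polynomial of degree \<open>n\<close> in \<open>\<lambda>\<^sub>1, \<dots>, \<lambda>\<^sub>n \<ge> 0\<close>, and
  can be written uniquely as
  \<open>\<Sum>i\<^sub>1, \<dots>, i\<^sub>n. c(i\<^sub>1, \<dots>, i\<^sub>n) \<lambda>\<^bsub>i\<^sub>1\<^esub> \<cdots> \<lambda>\<^bsub>i\<^sub>n\<^esub>\<close> with \<open>c\<close> symmetric; then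
  \<open>V(K\<^sub>1, \<dots>, K\<^sub>n) = c(1, \<dots>, n)\<close>.  This gives \<open>V(K, \<dots>, K) = |K|\<close>.
  The list of bodies must have length \<open>n\<close>; indices start at \<open>0\<close>.
\<close>

definition mixed_volume :: "(real ^ 'n) set list \<Rightarrow> real" where
  "mixed_volume Ks = (THE v. \<exists>c :: nat list \<Rightarrow> real.
     (\<forall>is js. mset is = mset js \<longrightarrow> c is = c js) \<and>
     (\<forall>l. (\<forall>i<CARD('n). 0 \<le> l i) \<longrightarrow>
        vol (\<Sum>i<CARD('n). (*\<^sub>R) (l i) ` (Ks ! i)) =
        (\<Sum>is\<in>{is. set is \<subseteq> {..<CARD('n)} \<and> length is = CARD('n)}. c is * (\<Prod>i\<leftarrow>is. l i))) \<and>
     v = c [0..<CARD('n)])"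

text \<open>\<open>V(K[j], L\<^sub>1, \<dots>, L\<^sub>k)\<close>; meaningful when \<open>j + k = n\<close>.\<close>

abbreviation mixed_volume_rep :: "(real ^ 'n) set \<Rightarrow> nat \<Rightarrow> (real ^ 'n) set list \<Rightarrow> real" where
  "mixed_volume_rep K j Ls \<equiv> mixed_volume (replicate j K @ Ls)"

definition surface_area :: "(real ^ 'n) set \<Rightarrow> real" where
  "surface_area K = real CARD('n) * mixed_volume_rep K (CARD('n) - 1) [cball 0 1]"

end

theory Submission
  imports Defs "HOL-Combinatorics.Multiset_Permutations"
begin

text \<open>
  An \<open>L\<^sub>2\<close>-zonoid is an ellipsoid \<open>A = T B\<close>, where \<open>B\<close> is the unit ball, and \<open>h\<^sub>A(x) = \<bar>T\<^sup>t x\<bar>\<close>.  The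
  volume of a zonotope is the sum of the determinants of all \<open>n\<close>-tuples of its generators (up to
  \<open>n!\<close>), which makes mixed volumes of zonotopes explicit; those of zonoids follow by continuity,
  using polarization.  The ball is itself a limit of zonotopes, so row operations and rotation
  invariance show that for zonotopes \<open>Z\<^sub>i\<close>
  \<open>V(A[n-k], Z\<^sub>1, \<dots>, Z\<^sub>k) = c \<bar>det T\<bar> (\<Sum>u. d\<^sub>1(u) \<cdots> d\<^sub>k(u))\<close>,
  where \<open>u\<close> runs over the choices of one generator from each \<open>Z\<^sub>i\<close> and \<open>d\<^sub>i(u)\<close> is the distance of
  \<open>T\<^sup>-\<^sup>1 u\<^sub>i\<close> from the span of \<open>T\<^sup>-\<^sup>1 u\<^sub>1, \<dots>, T\<^sup>-\<^sup>1 u\<^bsub>i-1\<^esub>\<close>.  Now \<open>1 / d\<^sub>i(u)\<^sup>2\<close> is the minimum of \<open>h\<^sub>A(x)\<^sup>2\<close>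
  subject to \<open>\<langle>x, u\<^sub>i\<rangle> = 1\<close> and \<open>\<langle>x, u\<^sub>j\<rangle> = 0\<close> for \<open>j < i\<close>.  The constraints do not involve \<open>A\<close>, and
  \<open>\<oplus>\<^sub>2\<close> adds the functions \<open>h\<^sup>2\<close>, so each \<open>1 / d\<^sub>i(u)\<^sup>2\<close> is superadditive.  Convexity of
  \<open>\<Prod>\<^sub>i r\<^sub>i\<^bsup>-1/2\<^esup>\<close> transfers superadditivity to \<open>(\<bar>A\<bar> / V)\<^bsup>2/k\<^esup>\<close>, homogeneity turns it into concavity,
  and the surface area is the case \<open>k = 1\<close>, \<open>Z\<^sub>1 = B\<close>.
\<close>

section \<open>Support functions and Hausdorff convergence\<close>

text \<open>The exponent 2/k comes from homogeneity. In the variables r_i = 1/d_i^2 the sum of the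
  products of the d_i has degree -k/2, so its power -2/k has degree 1; for such a function,
  convexity before taking the power becomes superadditivity after it. Three obstacles shape the
  proof. \<open>mixed_volume\<close> is a definite description and says nothing until Minkowski's
  polynomial is known to exist. Existence is proved for zonotopes and carried to zonoids, while
  polarization, a finite combination of volumes, supplies uniqueness and continuity. Next, row
  operations act on generators, which a ball does not have, so each identity for the ball is proved
  for determinants of approximating zonotopes and carried to the limit; the constant c stays
  abstract and cancels. Finally, A or B may be degenerate and still have positive mixed volume. Then
  a volume is 0 and superadditivity shrinks to monotonicity. Positivity of the mixed volume of the
  sum is not given and has to be derived.\<close>

definition convex_body :: "(real ^ 'n) set \<Rightarrow> bool" where
  "convex_body K \<longleftrightarrow> K \<noteq> {} \<and> compact K \<and> convex K"

lemma inner_le_support_function: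
  fixes K :: "(real ^ 'n) set"
  assumes "compact K" "y \<in> K"
  shows "x \<bullet> y \<le> support_function K x"
proof -
  have "compact ((\<bullet>) x ` K)"
    using assms by (intro compact_continuous_image continuous_intros)
  then show ?thesis
    unfolding support_function_def
    using assms(2) by (intro cSUP_upper bounded_imp_bdd_above compact_imp_bounded)
qed

lemma support_function_le:
  assumes "K \<noteq> {}" "\<And>y. y \<in> K \<Longrightarrow> x \<bullet> y \<le> c"
  shows "support_function K x \<le> c"
  unfolding support_function_def using assms by (intro cSUP_least) auto

lemma support_function_attained:
  fixes K :: "(real ^ 'n) set"
  assumes "compact K" "K \<noteq> {}"
  obtains y where "y \<in> K" "support_function K x = x \<bullet> y"
proof -
  have "continuous_on K (\<lambda>y. x \<bullet> y)"
    by (intro continuous_intros)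
  from continuous_attains_sup[OF assms this] obtain y where y: "y \<in> K" "\<forall>z\<in>K. x \<bullet> z \<le> x \<bullet> y"
    by auto
  have "support_function K x = x \<bullet> y"
    using y assms by (intro antisym support_function_le inner_le_support_function) auto
  with y that show ?thesis by blast
qed

text \<open>A point of \<open>K\<close> outside \<open>L\<close> would be strictly separated from
  \<open>L\<close>. The library puts \<open>L\<close> on the upper side of the hyperplane, so
  \<open>- a\<close> is the direction in which \<open>K\<close> would reach further than
  \<open>L\<close>.\<close>

lemma subset_if_support_function_le:
  fixes K L :: "(real ^ 'n) set"
  assumes "compact K" "convex_body L" "\<And>x. support_function K x \<le> support_function L x"
  shows "K \<subseteq> L"
proof
  fix z assume z: "z \<in> K"
  show "z \<in> L"
  proof (rule ccontr)
    assume "z \<notin> L"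
    then obtain a b where ab: "inner a z < b" "\<forall>x\<in>L. inner a x > b"
      using separating_hyperplane_closed_point[of L z] assms(2)
      by (auto simp: convex_body_def compact_imp_closed)
    have "(- a) \<bullet> z \<le> support_function L (- a)"
      using inner_le_support_function[OF assms(1) z, of "-a"] assms(3)[of "-a"] by linarith
    also have "\<dots> \<le> - b"
      using ab assms(2) by (intro support_function_le) (auto simp: convex_body_def less_imp_le)
    finally show False using ab by simp
  qed
qed

lemma support_function_mono:
  fixes K L :: "(real ^ 'n) set"
  assumes "K \<noteq> {}" "compact L" "K \<subseteq> L"
  shows "support_function K x \<le> support_function L x"
  using assms by (intro support_function_le inner_le_support_function) auto

lemma convex_body_eqI:
  assumes "convex_body K" "convex_body L" "\<And>x. support_function K x = support_function L x"
  shows "K = L"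
  using assms by (intro antisym subset_if_support_function_le) (auto simp: convex_body_def)

text \<open>Discharges the definite description: a convex body is determined by its support
  function, so exhibiting one body with the right support function is enough.\<close>

lemma l2_sum_eqI:
  assumes "convex_body M"
    and "\<And>x. support_function M x = sqrt ((support_function K x)\<^sup>2 + (support_function L x)\<^sup>2)"
  shows "K \<oplus>\<^sub>2 L = M"
  unfolding l2_sum_def
proof (rule the_equality)
  fix N assume "N \<noteq> {} \<and> compact N \<and> convex N \<and>
     (\<forall>x. support_function N x = sqrt ((support_function K x)\<^sup>2 + (support_function L x)\<^sup>2))"
  then show "N = M" using assms by (intro convex_body_eqI) (auto simp: convex_body_def)
qed (use assms in \<open>auto simp: convex_body_def\<close>)

lemma support_function_cball:
  fixes x :: "real ^ 'n"
  assumes "0 \<le> r"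
  shows "support_function (cball 0 r) x = r * norm x"
proof (rule antisym)
  show "support_function (cball 0 r) x \<le> r * norm x"
  proof (rule support_function_le)
    fix y :: "real ^ 'n" assume "y \<in> cball 0 r"
    then have "norm x * norm y \<le> norm x * r" by (intro mult_left_mono) auto
    then show "x \<bullet> y \<le> r * norm x"
      using norm_cauchy_schwarz[of x y] by (simp add: mult.commute)
  qed (use assms in auto)
  have "x \<bullet> (r *\<^sub>R sgn x) \<le> support_function (cball 0 r) x"
    using assms by (intro inner_le_support_function) (auto simp: norm_sgn)
  then show "r * norm x \<le> support_function (cball 0 r) x"
    by (cases "x = 0") (auto simp: sgn_div_norm power2_norm_eq_inner[symmetric] power2_eq_square field_simps)
qed

lemma support_function_linear_image:
  fixes T :: "real ^ 'n ^ 'n"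
  shows "support_function ((*v) T ` K) x = support_function K (transpose T *v x)"
  unfolding support_function_def by (simp add: image_image dot_lmul_matrix transpose_matrix_vector)

lemma support_function_ellipsoid:
  fixes T :: "real ^ 'n ^ 'n"
  shows "support_function ((*v) T ` cball 0 1) x = norm (transpose T *v x)"
  by (simp add: support_function_linear_image support_function_cball)

lemma compact_set_plus:
  fixes K L :: "(real ^ 'n) set"
  assumes "compact K" "compact L"
  shows "compact (K + L)"
proof -
  have "{x + y |x y. x \<in> K \<and> y \<in> L} = K + L"
    by (auto simp: set_plus_def)
  then show ?thesis using compact_sums[OF assms] by simp
qed

lemma support_function_plus:
  fixes K L :: "(real ^ 'n) set"
  assumes "compact K" "K \<noteq> {}" "compact L" "L \<noteq> {}"
  shows "support_function (K + L) x = support_function K x + support_function L x"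
proof (rule antisym)
  show "support_function (K + L) x \<le> support_function K x + support_function L x"
  proof (rule support_function_le)
    show "K + L \<noteq> {}" using assms by (auto simp: set_plus_def)
    fix y assume "y \<in> K + L"
    then obtain a b where "y = a + b" "a \<in> K" "b \<in> L" by (elim set_plus_elim)
    then show "x \<bullet> y \<le> support_function K x + support_function L x"
      using inner_le_support_function[OF assms(1), of a x] inner_le_support_function[OF assms(3), of b x]
      by (simp add: inner_add_right)
  qed
  obtain y where y: "y \<in> K" "support_function K x = x \<bullet> y"
    using support_function_attained[OF assms(1,2)] .
  obtain z where z: "z \<in> L" "support_function L x = x \<bullet> z"
    using support_function_attained[OF assms(3,4)] .
  note yz = y z
  have "compact (K + L)"
    using assms by (intro compact_set_plus)
  then have "x \<bullet> (y + z) \<le> support_function (K + L) x"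
    using yz by (intro inner_le_support_function) auto
  then show "support_function K x + support_function L x \<le> support_function (K + L) x"
    using yz by (simp add: inner_add_right)
qed

lemma set_plus_eq_empty_iff: "A + B = {} \<longleftrightarrow> A = {} \<or> B = {}"
  by (auto simp: set_plus_def)

lemma convex_body_plus: "convex_body K \<Longrightarrow> convex_body L \<Longrightarrow> convex_body (K + L)"
  by (simp add: convex_body_def compact_set_plus convex_set_plus set_plus_eq_empty_iff)

lemma convex_body_singleton: "convex_body {a}"
  by (auto simp: convex_body_def)

lemma convex_body_sum: "(\<And>i. i \<in> I \<Longrightarrow> convex_body (K i)) \<Longrightarrow> convex_body (sum K I)"
  by (induction I rule: infinite_finite_induct) (auto simp: convex_body_plus convex_body_singleton)

lemma convex_body_cball: "0 \<le> r \<Longrightarrow> convex_body (cball a r)"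
  by (auto simp: convex_body_def)

lemma convex_body_segment: "convex_body (closed_segment a b)"
  by (auto simp: convex_body_def)

lemma convex_body_linear_image:
  fixes K :: "(real ^ 'n) set"
  assumes "linear f" "convex_body K"
  shows "convex_body (f ` K)"
  using assms by (auto simp: convex_body_def linear_continuous_on linear_linear
      convex_linear_image intro!: compact_continuous_image)

lemma convex_body_scaleR:
  fixes K :: "(real ^ 'n) set"
  shows "convex_body K \<Longrightarrow> convex_body ((*\<^sub>R) c ` K)"
  by (rule convex_body_linear_image) (auto intro: linearI simp: scaleR_add_right)

lemma cball_plus_cball:
  fixes a b :: real
  assumes "0 \<le> a" "0 \<le> b"
  shows "cball (0::real ^ 'n) a + cball 0 b = cball 0 (a + b)"
  using assms by (intro convex_body_eqI convex_body_plus convex_body_cball)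
    (auto simp: support_function_plus support_function_cball algebra_simps)

text \<open>Hausdorff convergence, in a form that does not require the distance to be well behaved on
  empty or unbounded sets.\<close>

definition hconv :: "(nat \<Rightarrow> (real ^ 'n) set) \<Rightarrow> (real ^ 'n) set \<Rightarrow> bool" where
  "hconv P K \<longleftrightarrow> (\<forall>e>0. \<forall>\<^sub>F m in sequentially. P m \<subseteq> K + cball 0 e \<and> K \<subseteq> P m + cball 0 e)"

lemma hconv_const: "hconv (\<lambda>_. K) K"
  using set_zero_plus2[of "cball 0 _" K] by (auto simp: hconv_def add.commute)

lemma hconv_plus:
  assumes "hconv P K" "hconv Q L"
  shows "hconv (\<lambda>m. P m + Q m) (K + L)"
  unfolding hconv_def
proof (intro allI impI)
  fix e :: real assume e: "e > 0"
  have eq: "(X + cball 0 (e/2)) + (Y + cball 0 (e/2)) = (X + Y) + cball 0 e" for X Y :: "(real ^ 'n) set"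
    using cball_plus_cball[of "e/2" "e/2", where 'n='n] e by (simp add: add.assoc add.left_commute add.commute)
  have "\<forall>\<^sub>F m in sequentially. P m \<subseteq> K + cball 0 (e/2) \<and> K \<subseteq> P m + cball 0 (e/2)"
    "\<forall>\<^sub>F m in sequentially. Q m \<subseteq> L + cball 0 (e/2) \<and> L \<subseteq> Q m + cball 0 (e/2)"
    using assms e by (auto simp: hconv_def)
  then show "\<forall>\<^sub>F m in sequentially. P m + Q m \<subseteq> K + L + cball 0 e \<and> K + L \<subseteq> P m + Q m + cball 0 e"
  proof eventually_elim
    case (elim m)
    then show ?case
      unfolding eq[symmetric] by (intro conjI set_plus_mono2) auto
  qed
qed

lemma hconv_sum: "(\<And>i. i \<in> I \<Longrightarrow> hconv (P i) (K i)) \<Longrightarrow> hconv (\<lambda>m. \<Sum>i\<in>I. P i m) (\<Sum>i\<in>I. K i)"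
  by (induction I rule: infinite_finite_induct) (auto simp: hconv_const hconv_plus)

lemma linear_image_set_plus: "linear f \<Longrightarrow> f ` (A + B) = f ` A + f ` B"
  by (force simp: set_plus_def linear_add)

lemma hconv_linear_image:
  fixes f :: "real ^ 'n \<Rightarrow> real ^ 'n"
  assumes "linear f" "hconv P K"
  shows "hconv (\<lambda>m. f ` P m) (f ` K)"
  unfolding hconv_def
proof (intro allI impI)
  fix e :: real assume e: "e > 0"
  obtain B where B: "B > 0" "\<And>x. norm (f x) \<le> B * norm x"
    using linear_bounded_pos[OF assms(1)] by blast
  have sub: "f ` (cball 0 (e / B)) \<subseteq> cball 0 e"
  proof clarsimp
    fix x :: "real ^ 'n" assume "norm x \<le> e / B"
    then have "B * norm x \<le> e" using B(1) by (simp add: field_simps)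
    then show "norm (f x) \<le> e" using B(2)[of x] by linarith
  qed
  have "\<forall>\<^sub>F m in sequentially. P m \<subseteq> K + cball 0 (e/B) \<and> K \<subseteq> P m + cball 0 (e/B)"
    using assms e B(1) by (auto simp: hconv_def)
  then show "\<forall>\<^sub>F m in sequentially. f ` P m \<subseteq> f ` K + cball 0 e \<and> f ` K \<subseteq> f ` P m + cball 0 e"
  proof eventually_elim
    case (elim m)
    then have "f ` P m \<subseteq> f ` K + f ` cball 0 (e/B)" "f ` K \<subseteq> f ` P m + f ` cball 0 (e/B)"
      using linear_image_set_plus[OF assms(1)] by (metis image_mono)+
    then show ?case using set_plus_mono2[OF order_refl sub] by (meson order_trans)
  qed
qed

lemma linear_scaleR_fun: "linear ((*\<^sub>R) c)"
  by (auto intro: linearI simp: scaleR_add_right)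

lemma hconv_scaleR:
  fixes K :: "(real ^ 'n) set"
  shows "hconv P K \<Longrightarrow> hconv (\<lambda>m. (*\<^sub>R) c ` P m) ((*\<^sub>R) c ` K)"
  by (rule hconv_linear_image) (rule linear_scaleR_fun)

text \<open>For nonempty compact sets the suprema in \<open>hausdorff_distance\<close> are genuine
  upper bounds and distances to a set are attained, so a small distance yields both
  inclusions.\<close>

lemma hausdorff_limit_imp_hconv:
  fixes K :: "(real ^ 'n) set"
  assumes "hausdorff_limit P K" "\<And>m. convex_body (P m)"
  shows "hconv P K"
  unfolding hconv_def
proof (intro allI impI)
  fix e :: real assume e: "e > 0"
  have K: "compact K" "K \<noteq> {}" and lim: "(\<lambda>m. hausdorff_distance (P m) K) \<longlonglongrightarrow> 0"
    using assms(1) by (auto simp: hausdorff_limit_def)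
  have aux: "A \<subseteq> B + cball 0 e" if AB: "compact A" "compact B" "B \<noteq> {}" and lt: "(SUP x\<in>A. infdist x B) < e" for A B :: "(real ^ 'n) set"
  proof
    fix x assume x: "x \<in> A"
    have "compact ((\<lambda>x. infdist x B) ` A)"
      using AB by (intro compact_continuous_image continuous_intros)
    then have "infdist x B \<le> (SUP x\<in>A. infdist x B)"
      using x by (intro cSUP_upper bounded_imp_bdd_above compact_imp_bounded)
    then have "infdist x B < e" using lt by linarith
    moreover obtain b where "b \<in> B" "infdist x B = dist x b"
      using infdist_attains_inf[of B x] AB compact_imp_closed by metis
    ultimately have "b \<in> B" "x - b \<in> cball 0 e" by (auto simp: dist_norm norm_minus_commute)
    then have "b + (x - b) \<in> B + cball 0 e" by (rule set_plus_intro)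
    then show "x \<in> B + cball 0 e" by simp
  qed
  have "\<forall>\<^sub>F m in sequentially. hausdorff_distance (P m) K < e"
    using order_tendstoD(2)[OF lim e] .
  then show "\<forall>\<^sub>F m in sequentially. P m \<subseteq> K + cball 0 e \<and> K \<subseteq> P m + cball 0 e"
  proof eventually_elim
    case (elim m)
    then show ?case
      using aux[of "P m" K] aux[of K "P m"] K assms(2)[of m]
      by (auto simp: hausdorff_distance_def convex_body_def)
  qed
qed

text \<open>A convex combination of points of \<open>K\<close> lies in the convex
  \<open>e/3\<close>-neighbourhood of some \<open>P m\<close>, hence within \<open>2e/3\<close> of
  \<open>K\<close>; closedness of \<open>K\<close> finishes.\<close>

lemma hconv_convex_body:
  fixes K :: "(real ^ 'n) set"
  assumes "hconv P K" "\<And>m. convex_body (P m)" "compact K" "K \<noteq> {}"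
  shows "convex_body K"
proof -
  have "convex K"
    unfolding convex_def
  proof (intro ballI allI impI)
    fix x y and u v :: real assume *: "x \<in> K" "y \<in> K" "0 \<le> u" "0 \<le> v" "u + v = 1"
    have "\<exists>z\<in>K. dist z (u *\<^sub>R x + v *\<^sub>R y) < e" if e: "e > 0" for e
    proof -
      have "\<forall>\<^sub>F m in sequentially. P m \<subseteq> K + cball 0 (e/3) \<and> K \<subseteq> P m + cball 0 (e/3)"
        using assms(1) e unfolding hconv_def by auto
      then obtain m where m: "P m \<subseteq> K + cball 0 (e/3)" "K \<subseteq> P m + cball 0 (e/3)"
        using eventually_happens'[OF sequentially_bot] by blast
      have "convex (P m + cball 0 (e/3))"
        using assms(2)[of m] by (auto simp: convex_body_def intro!: convex_set_plus)
      then have "u *\<^sub>R x + v *\<^sub>R y \<in> P m + cball 0 (e/3)"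
        using m(2) * by (auto simp: convex_def)
      also have "\<dots> \<subseteq> (K + cball 0 (e/3)) + cball 0 (e/3)"
        using m(1) by (rule set_plus_mono2) auto
      also have "\<dots> = K + cball 0 (e/3 + e/3)"
        using e by (simp add: add.assoc cball_plus_cball)
      finally obtain a b where "u *\<^sub>R x + v *\<^sub>R y = a + b" "a \<in> K" "norm b \<le> e/3 + e/3"
        by (elim set_plus_elim) auto
      then show ?thesis using e by (intro bexI[of _ a]) (auto simp: dist_norm)
    qed
    then have "u *\<^sub>R x + v *\<^sub>R y \<in> closure K" by (simp add: closure_approachable)
    then show "u *\<^sub>R x + v *\<^sub>R y \<in> K" using assms(3) compact_imp_closed closure_closed by metis
  qed
  then show ?thesis using assms by (auto simp: convex_body_def)
qed

text \<open>The upper bound is semicontinuity of the measure, valid because the frontier of a convex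
  set is negligible. For the lower bound, \<open>K\<close> is exhausted in volume by inner parallel
  bodies, each of which is eventually contained in \<open>P m\<close>.\<close>

lemma vol_hconv:
  fixes K :: "(real ^ 'n) set"
  assumes "hconv P K" "\<And>m. convex_body (P m)" "convex_body K"
  shows "(\<lambda>m. vol (P m)) \<longlonglongrightarrow> vol K"
proof (rule order_tendstoI)
  have K: "compact K" "convex K" "K \<noteq> {}" and P: "\<And>m. compact (P m)"
    using assms by (auto simp: convex_body_def)
  fix a assume a: "a > vol K"
  obtain d where d: "d > 0" "\<And>T. T \<in> lmeasurable \<Longrightarrow> (\<And>y. y \<in> T \<Longrightarrow> \<exists>x. x \<in> K \<and> dist x y < d)
                        \<Longrightarrow> vol T < vol K + (a - vol K)"
    using measure_semicontinuous_with_hausdist_explicit[of K "a - vol K"] a K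
      negligible_convex_frontier[OF K(2)] compact_imp_bounded[OF K(1)] by auto
  have "\<forall>\<^sub>F m in sequentially. P m \<subseteq> K + cball 0 (d/2) \<and> K \<subseteq> P m + cball 0 (d/2)"
    using assms(1) d unfolding hconv_def by auto
  then show "\<forall>\<^sub>F m in sequentially. vol (P m) < a"
  proof eventually_elim
    case (elim m)
    have "vol (P m) < vol K + (a - vol K)"
    proof (rule d(2))
      fix y assume "y \<in> P m"
      then obtain x b where "y = x + b" "x \<in> K" "b \<in> cball 0 (d/2)"
        using elim by (meson set_plus_elim subsetD)
      then show "\<exists>x. x \<in> K \<and> dist x y < d"
        using d(1) by (intro exI[of _ x]) (auto simp: dist_norm)
    qed (use P lmeasurable_compact in auto)
    then show ?case by simp
  qed
next
  have K: "compact K" "convex K" "K \<noteq> {}" and P: "\<And>m. compact (P m)"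
    using assms by (auto simp: convex_body_def)
  fix a assume a: "a < vol K"
  \<comment> \<open>Inner parallel bodies: the points of \<open>K\<close> at depth at least
    \<open>1 / real (Suc j)\<close>. They increase to the interior of \<open>K\<close>.\<close>
  define S where "S = (\<lambda>j::nat. {x \<in> K. cball x (1 / real (Suc j)) \<subseteq> K})"
  have closed_S: "closed (S j)" for j
  proof -
    have "S j = (\<Inter>z\<in>cball 0 (1 / real (Suc j)). (\<lambda>x. x + z) -` K)"
    proof (intro equalityI subsetI)
      fix x assume "x \<in> (\<Inter>z\<in>cball 0 (1 / real (Suc j)). (\<lambda>x. x + z) -` K)"
      then have *: "x + z \<in> K" if "norm z \<le> 1 / real (Suc j)" for z using that by auto
      have "y \<in> K" if "y \<in> cball x (1 / real (Suc j))" for y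
        using *[of "y - x"] that by (auto simp: dist_norm norm_minus_commute)
      then show "x \<in> S j" using *[of 0] by (auto simp: S_def)
    qed (auto simp: S_def dist_norm)
    moreover have "closed ((\<lambda>x. x + z) -` K)" for z
      using K by (intro closed_vimage compact_imp_closed continuous_intros)
    ultimately show ?thesis by auto
  qed
  have S_lm: "S j \<in> lmeasurable" for j
  proof -
    have "bounded (S j)" by (rule bounded_subset[OF compact_imp_bounded[OF K(1)]]) (auto simp: S_def)
    then show ?thesis using closed_S by (intro lmeasurable_compact) (simp add: compact_eq_bounded_closed)
  qed
  have S_mono: "S i \<subseteq> S j" if "i \<le> j" for i j
  proof
    fix x assume x: "x \<in> S i"
    have "1 / real (Suc j) \<le> 1 / real (Suc i)" using \<open>i \<le> j\<close> by (simp add: frac_le)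
    then have "cball x (1 / real (Suc j)) \<subseteq> cball x (1 / real (Suc i))" by (rule subset_cball)
    then show "x \<in> S j" using x unfolding S_def by blast
  qed
  have "incseq S"
    unfolding incseq_def using S_mono by blast
  have Un: "(\<Union>j. S j) = interior K"
  proof (intro equalityI subsetI)
    fix x assume "x \<in> (\<Union>j. S j)"
    then obtain j where "cball x (1 / real (Suc j)) \<subseteq> K" by (auto simp: S_def)
    then show "x \<in> interior K"
      unfolding mem_interior_cball by (intro exI[of _ "1 / real (Suc j)"]) auto
  next
    fix x assume "x \<in> interior K"
    then obtain e where e: "e > 0" "cball x e \<subseteq> K" unfolding mem_interior_cball by blast
    obtain j where "1 / real (Suc j) < e" using nat_approx_posE[OF e(1)] by blast
    then have "cball x (1 / real (Suc j)) \<subseteq> K"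
      using e(2) subset_cball[of "1 / real (Suc j)" e x] by auto
    moreover have "x \<in> K" using e by auto
    ultimately have "x \<in> S j" by (simp add: S_def)
    then show "x \<in> (\<Union>j. S j)" by blast
  qed
  have int_lm: "interior K \<in> lmeasurable"
    using K by (simp add: compact_imp_bounded lmeasurable_interior)
  have "(\<lambda>j. vol (S j)) \<longlonglongrightarrow> vol (\<Union>j. S j)"
  proof (rule Lim_measure_incseq)
    show "range S \<subseteq> sets lebesgue" using S_lm by (auto dest: fmeasurableD)
    show "incseq S" by fact
    show "emeasure lebesgue (\<Union>i. S i) \<noteq> \<infinity>" using int_lm Un by (metis fmeasurableD2 infinity_ennreal_def)
  qed
  moreover have "vol (interior K) = vol K"
    using measure_interior[OF compact_imp_bounded[OF K(1)] negligible_convex_frontier[OF K(2)]] .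
  ultimately have "(\<lambda>j. vol (S j)) \<longlonglongrightarrow> vol K" using Un by simp
  then have "\<forall>\<^sub>F j in sequentially. a < vol (S j)" using a by (rule order_tendstoD(1))
  then obtain j where j: "a < vol (S j)"
    using eventually_happens'[OF sequentially_bot] by blast
  define e where "e = 1 / real (Suc j)"
  have e: "e > 0" by (simp add: e_def)
  have "\<forall>\<^sub>F m in sequentially. P m \<subseteq> K + cball 0 e \<and> K \<subseteq> P m + cball 0 e"
    using assms(1) e unfolding hconv_def by auto
  then show "\<forall>\<^sub>F m in sequentially. a < vol (P m)"
  proof eventually_elim
    case (elim m)
    have "S j \<subseteq> P m"
    proof
      fix x assume x: "x \<in> S j"
      \<comment> \<open>From
        \<open>{x} + cball 0 e \<subseteq> K \<subseteq> P m + cball 0 e\<close> the ball is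
        cancelled at the level of support functions, where it adds the same term on both
        sides.\<close>
      have "{x} \<subseteq> P m"
      proof (rule subset_if_support_function_le)
        show "convex_body (P m)" by fact
        fix v
        have "{x} + cball 0 e \<subseteq> K"
        proof
          fix y assume "y \<in> {x} + cball 0 e"
          then obtain b where "y = x + b" "norm b \<le> e" by (elim set_plus_elim) auto
          then have "y \<in> cball x e" by (simp add: dist_norm)
          then show "y \<in> K" using x by (auto simp: S_def e_def)
        qed
        then have "support_function ({x} + cball 0 e) v \<le> support_function (P m + cball 0 e) v"
          using elim convex_body_plus[OF assms(2)[of m] convex_body_cball[of e 0]] e
          by (intro support_function_mono) (auto simp: convex_body_def set_plus_eq_empty_iff)
        then show "support_function {x} v \<le> support_function (P m) v"
          using e assms(2)[of m] by (simp add: support_function_plus convex_body_def)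
      qed auto
      then show "x \<in> P m" by simp
    qed
    then have "vol (S j) \<le> vol (P m)"
      using S_lm P lmeasurable_compact by (intro measure_mono_fmeasurable) (auto dest: fmeasurableD)
    then show ?case using j by linarith
  qed
qed

section \<open>Volumes of sums of segments\<close>

definition ray_segment :: "real ^ 'n \<Rightarrow> (real ^ 'n) set" where
  "ray_segment w = (\<lambda>u. u *\<^sub>R w) ` {0..1}"

lemma ray_segment_eq: "ray_segment w = closed_segment 0 w"
  by (auto simp: ray_segment_def closed_segment_def image_iff)

lemma convex_body_ray_segment: "convex_body (ray_segment w)"
  by (simp add: ray_segment_eq convex_body_segment)

lemma ray_segment_zero [simp]: "ray_segment 0 = {0}"
  by (simp add: ray_segment_eq)

lemma linear_image_ray_segment: "linear f \<Longrightarrow> f ` ray_segment w = ray_segment (f w)"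
  by (simp add: ray_segment_eq closed_segment_linear_image[symmetric] linear_0)

lemma ray_segment_scaleR:
  assumes "0 \<le> t"
  shows "ray_segment (t *\<^sub>R w) = (\<lambda>u. u *\<^sub>R w) ` {0..t}"
proof (cases "t = 0")
  case False
  show ?thesis
  proof (intro equalityI subsetI)
    fix x assume "x \<in> (\<lambda>u. u *\<^sub>R w) ` {0..t}"
    then obtain u where "x = u *\<^sub>R w" "0 \<le> u" "u \<le> t" by (elim imageE) (rule that, auto)
    then show "x \<in> ray_segment (t *\<^sub>R w)"
      using False assms unfolding ray_segment_def
      by (intro image_eqI[where x = "u / t"]) auto
  next
    fix x assume "x \<in> ray_segment (t *\<^sub>R w)"
    then show "x \<in> (\<lambda>u. u *\<^sub>R w) ` {0..t}"
      using assms by (auto simp: ray_segment_def image_iff mult_left_le_one_le intro!: bexI[of _ "_ * t"])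
  qed
qed auto

text \<open>On each line parallel to \<open>w\<close> the section of \<open>K + [0, t w]\<close> is that of \<open>K\<close> lengthened by
  \<open>t\<close>, so the part gained between \<open>t\<close> and \<open>t + s\<close> is a translate of the part gained
  between \<open>0\<close> and \<open>s\<close>.\<close>

lemma vol_plus_segment_increment:
  fixes K :: "(real ^ 'n) set"
  assumes K: "convex_body K" and "0 \<le> s" "0 \<le> t"
  shows "vol (K + ray_segment ((s + t) *\<^sub>R w)) - vol (K + ray_segment (t *\<^sub>R w)) =
         vol (K + ray_segment (s *\<^sub>R w)) - vol K"
proof -
  define E where "E r = K + (\<lambda>u. u *\<^sub>R w) ` {0..r}" for r
  have E: "E r = K + ray_segment (r *\<^sub>R w)" if "0 \<le> r" for r
    using that by (simp add: E_def ray_segment_scaleR)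
  have lm: "E r \<in> lmeasurable" if "0 \<le> r" for r
    using convex_body_plus[OF K convex_body_ray_segment] that
    by (auto simp: E convex_body_def intro: lmeasurable_compact)
  have mem: "x \<in> E r \<longleftrightarrow> (\<exists>k\<in>K. \<exists>u\<in>{0..r}. x = k + u *\<^sub>R w)" for x r
    by (auto simp: E_def set_plus_def)
  have mono: "E r \<subseteq> E r'" if "r \<le> r'" for r r'
    using that by (force simp: mem)
  have tr: "E (s + t) - E t = (+) (t *\<^sub>R w) ` (E s - E 0)"
  proof (intro equalityI subsetI)
    fix y assume y: "y \<in> E (s + t) - E t"
    then obtain k v where kv: "k \<in> K" "0 \<le> v" "v \<le> s + t" "y = k + v *\<^sub>R w"
      by (auto simp: mem)
    have "t < v" using y kv by (force simp: mem)
    have "y - t *\<^sub>R w = k + (v - t) *\<^sub>R w" using kv by (simp add: algebra_simps)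
    then have "y - t *\<^sub>R w \<in> E s" using kv \<open>t < v\<close> unfolding mem by (intro bexI[of _ k] bexI[of _ "v - t"]) auto
    moreover have "y - t *\<^sub>R w \<notin> E 0"
    proof
      assume "y - t *\<^sub>R w \<in> E 0"
      then have "y - t *\<^sub>R w \<in> K" by (auto simp: mem)
      then have "y \<in> E t" unfolding mem using assms by (intro bexI[of _ "y - t *\<^sub>R w"] bexI[of _ t]) auto
      then show False using y by blast
    qed
    ultimately show "y \<in> (+) (t *\<^sub>R w) ` (E s - E 0)"
      by (intro image_eqI[where x = "y - t *\<^sub>R w"]) auto
  next
    fix y assume "y \<in> (+) (t *\<^sub>R w) ` (E s - E 0)"
    then obtain x where x: "y = x + t *\<^sub>R w" "x \<in> E s" "x \<notin> E 0" by (auto simp: add.commute)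
    then obtain k u where ku: "k \<in> K" "0 \<le> u" "u \<le> s" "x = k + u *\<^sub>R w"
      by (auto simp: mem)
    have "y = k + (u + t) *\<^sub>R w" using x ku by (simp add: algebra_simps)
    then have "y \<in> E (s + t)" unfolding mem using ku assms by (intro bexI[of _ k] bexI[of _ "u + t"]) auto
    moreover have "y \<notin> E t"
    proof
      assume "y \<in> E t"
      then obtain k' u' where ku': "k' \<in> K" "0 \<le> u'" "u' \<le> t" "y = k' + u' *\<^sub>R w"
        by (auto simp: mem)
      have xk': "x + (t - u') *\<^sub>R w = k'" using ku' x by (simp add: algebra_simps)
      \<comment> \<open>\<open>k = x - u w\<close> and \<open>k' = x + (t - u') w\<close> are points
        of \<open>K\<close> on opposite sides of \<open>x\<close> along the line in direction
        \<open>w\<close>, so convexity puts \<open>x\<close> itself into \<open>K\<close>, against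
        \<open>x \<notin> E 0\<close>.\<close>
      have "x \<in> K"
      proof (cases "u + (t - u') = 0")
        case True
        then have "u = 0" using ku ku' by linarith
        then show ?thesis using ku by simp
      next
        case False
        define d where "d = u + (t - u')"
        have d: "d > 0" using False ku ku' by (simp add: d_def)
        have k: "k = x - u *\<^sub>R w" using ku by simp
        have "((t - u') / d) *\<^sub>R k + (u / d) *\<^sub>R k' \<in> K"
          using K ku ku' d by (intro convexD) (auto simp: convex_body_def d_def divide_simps)
        moreover have "((t - u') / d) *\<^sub>R k + (u / d) *\<^sub>R k' = ((t - u') / d + u / d) *\<^sub>R x"
        proof -
          have "\<alpha> *\<^sub>R (x - u *\<^sub>R w) + \<beta> *\<^sub>R (x + v *\<^sub>R w) = (\<alpha> + \<beta>) *\<^sub>R x"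
            if "\<alpha> * u = \<beta> * v" for \<alpha> \<beta> v
            by (simp add: scaleR_right_diff_distrib scaleR_right_distrib scaleR_left_distrib that)
          then show ?thesis unfolding k xk'[symmetric] by simp
        qed
        moreover have "(t - u') / d + u / d = 1" using d by (simp add: d_def divide_simps)
        ultimately show ?thesis by simp
      qed
      then show False using x by (force simp: mem)
    qed
    ultimately show "y \<in> E (s + t) - E t" by blast
  qed
  have "vol (E (s + t) - E t) = vol (E s - E 0)"
    unfolding tr by (rule measure_translation)
  moreover have "vol (E (s + t) - E t) = vol (E (s + t)) - vol (E t)"
    using assms by (intro measurable_measure_Diff lm mono fmeasurableD) auto
  moreover have "vol (E s - E 0) = vol (E s) - vol (E 0)"
    using assms by (intro measurable_measure_Diff lm mono fmeasurableD) auto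
  moreover have "E 0 = K" by (simp add: E)
  ultimately have "vol (E (s + t)) - vol (E t) = vol (E s) - vol K" by simp
  then show ?thesis using E[of "s + t"] E[of t] E[of s] assms(2,3) by simp
qed

text \<open>Cauchy's functional equation with monotonicity in place of continuity: for every
  \<open>m\<close> both \<open>m g(t)\<close> and \<open>m t g(1)\<close> lie between
  \<open>k g(1)\<close> and \<open>(k+1) g(1)\<close>, where \<open>k\<close> is the integer part of
  \<open>m t\<close>. Their difference stays bounded while \<open>m\<close> grows.\<close>

lemma additive_mono_imp_linear:
  fixes g :: "real \<Rightarrow> real"
  assumes add: "\<And>s t. 0 \<le> s \<Longrightarrow> 0 \<le> t \<Longrightarrow> g (s + t) = g s + g t"
    and mono: "\<And>s t. 0 \<le> s \<Longrightarrow> s \<le> t \<Longrightarrow> g s \<le> g t" and "0 \<le> t"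
  shows "g t = t * g 1"
proof -
  have g0: "g 0 = 0" using add[of 0 0] by simp
  have mult: "g (real m * t) = real m * g t" if "0 \<le> t" for m t
    using that by (induction m) (auto simp: g0 algebra_simps add)
  have g1: "0 \<le> g 1" using mono[of 0 1] g0 by simp
  have bound: "real m * \<bar>g t - t * g 1\<bar> \<le> g 1" for m
  proof -
    define k where "k = nat \<lfloor>real m * t\<rfloor>"
    have k: "real k \<le> real m * t" "real m * t \<le> real (k + 1)"
      using \<open>0 \<le> t\<close> by (auto simp: k_def of_nat_nat) linarith
    have "real k * g 1 \<le> real m * g t" "real m * g t \<le> real (k + 1) * g 1"
      using mono[OF _ k(1)] mono[OF _ k(2)] mult[of 1 k] mult[of 1 "k+1"] mult[OF \<open>0 \<le> t\<close>, of m] \<open>0 \<le> t\<close>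
      by auto
    moreover have "real k * g 1 \<le> real m * t * g 1" "real m * t * g 1 \<le> real (k + 1) * g 1"
      using k g1 by (auto intro: mult_right_mono)
    ultimately have "\<bar>real m * g t - real m * t * g 1\<bar> \<le> g 1"
      by (simp add: algebra_simps abs_le_iff)
    moreover have "real m * \<bar>g t - t * g 1\<bar> = \<bar>real m * g t - real m * t * g 1\<bar>"
      by (simp add: abs_mult_pos' right_diff_distrib mult.assoc)
    ultimately show ?thesis by simp
  qed
  have "\<bar>g t - t * g 1\<bar> = 0"
  proof (rule ccontr)
    assume "\<bar>g t - t * g 1\<bar> \<noteq> 0"
    then have "\<bar>g t - t * g 1\<bar> > 0" by simp
    then obtain m where "g 1 < real m * \<bar>g t - t * g 1\<bar>" using reals_Archimedean3 by blast
    then show False using bound[of m] by simp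
  qed
  then show ?thesis by simp
qed

lemma vol_mono:
  assumes "convex_body K" "convex_body L" "K \<subseteq> L"
  shows "vol K \<le> vol L"
  using assms by (intro measure_mono_fmeasurable)
    (auto simp: convex_body_def lmeasurable_compact intro: fmeasurableD)

text \<open>The gain in volume is additive in \<open>t\<close> by the translation argument and
  monotone, hence linear. This makes the volume of a zonotope affine in the length of each generator
  separately.\<close>

lemma vol_plus_segment_affine:
  fixes K :: "(real ^ 'n) set"
  assumes K: "convex_body K" and "0 \<le> t"
  shows "vol (K + ray_segment (t *\<^sub>R w)) = vol K + t * (vol (K + ray_segment w) - vol K)"
proof -
  define g where "g r = vol (K + ray_segment (r *\<^sub>R w)) - vol K" for r
  have "g t = t * g 1"
  proof (rule additive_mono_imp_linear)
    fix s t :: real assume st: "0 \<le> s" "0 \<le> t"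
    show "g (s + t) = g s + g t"
      using vol_plus_segment_increment[OF K st, of w] by (simp add: g_def)
  next
    fix s t :: real assume st: "0 \<le> s" "s \<le> t"
    have "K + ray_segment (s *\<^sub>R w) \<subseteq> K + ray_segment (t *\<^sub>R w)"
      using st by (intro set_plus_mono2) (auto simp: ray_segment_scaleR)
    then show "g s \<le> g t"
      using K by (simp add: g_def vol_mono convex_body_plus convex_body_ray_segment)
  qed fact
  then show ?thesis by (simp add: g_def)
qed

section \<open>Multiaffine and homogeneous functions\<close>

text \<open>Splitting off one variable \<open>x\<close> writes \<open>p\<close> as
  \<open>p0 + t x * p1\<close>, where \<open>p0\<close> and \<open>p1\<close> are again multiaffine
  in the remaining variables; the subsets containing \<open>x\<close> take their coefficients from
  \<open>p1\<close>.\<close>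

lemma multiaffine_expansion:
  fixes p :: "('i \<Rightarrow> real) \<Rightarrow> real"
  assumes "finite I"
    and "\<And>t t'. (\<And>i. i \<in> I \<Longrightarrow> t i = t' i) \<Longrightarrow> p t = p t'"
    and "\<And>j t. j \<in> I \<Longrightarrow> (\<And>i. 0 \<le> t i) \<Longrightarrow> p t = p (t(j := 0)) + t j * (p (t(j := 1)) - p (t(j := 0)))"
  shows "\<exists>c. \<forall>t. (\<forall>i. 0 \<le> t i) \<longrightarrow> p t = (\<Sum>J\<in>Pow I. c J * (\<Prod>j\<in>J. t j))"
  using assms
proof (induction I arbitrary: p rule: finite_induct)
  case empty
  then have "p t = p (\<lambda>_. 0)" for t by blast
  then show ?case by (intro exI[of _ "\<lambda>_. p (\<lambda>_. 0)"]) auto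
next
  case (insert x I)
  define p0 p1 where "p0 t = p (t(x := 0))" and "p1 t = p (t(x := 1)) - p (t(x := 0))" for t
  have upd: "p (t(x := a)) = p ((t(j := 0))(x := a)) + t j * (p ((t(j := 1))(x := a)) - p ((t(j := 0))(x := a)))"
    if "j \<in> I" "\<And>i. 0 \<le> t i" "0 \<le> a" for j a and t :: "'i \<Rightarrow> real"
  proof -
    have "j \<noteq> x" using that insert.hyps by auto
    then have tw: "(t(x := a))(j := b) = (t(j := b))(x := a)" for b by (simp add: fun_upd_twist)
    have "p (t(x := a)) = p ((t(x := a))(j := 0)) +
      (t(x := a)) j * (p ((t(x := a))(j := 1)) - p ((t(x := a))(j := 0)))"
      using that by (intro insert.prems(2)) auto
    then show ?thesis unfolding tw using \<open>j \<noteq> x\<close> by simp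
  qed
  have "\<exists>c. \<forall>t. (\<forall>i. 0 \<le> t i) \<longrightarrow> p0 t = (\<Sum>J\<in>Pow I. c J * (\<Prod>j\<in>J. t j))"
  proof (rule insert.IH)
    show "p0 t = p0 t'" if "\<And>i. i \<in> I \<Longrightarrow> t i = t' i" for t t'
      unfolding p0_def using that by (intro insert.prems(1)) auto
    show "p0 t = p0 (t(j := 0)) + t j * (p0 (t(j := 1)) - p0 (t(j := 0)))"
      if "j \<in> I" "\<And>i. 0 \<le> t i" for j t
      unfolding p0_def using that by (intro upd) auto
  qed
  then obtain c0 where c0: "\<And>t. (\<And>i. 0 \<le> t i) \<Longrightarrow> p0 t = (\<Sum>J\<in>Pow I. c0 J * (\<Prod>j\<in>J. t j))"
    by blast
  have "\<exists>c. \<forall>t. (\<forall>i. 0 \<le> t i) \<longrightarrow> p1 t = (\<Sum>J\<in>Pow I. c J * (\<Prod>j\<in>J. t j))"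
  proof (rule insert.IH)
    show "p1 t = p1 t'" if "\<And>i. i \<in> I \<Longrightarrow> t i = t' i" for t t'
    proof -
      have "p (t(x := 1)) = p (t'(x := 1))" "p (t(x := 0)) = p (t'(x := 0))"
        using that by (auto intro!: insert.prems(1))
      then show ?thesis by (simp add: p1_def)
    qed
    show "p1 t = p1 (t(j := 0)) + t j * (p1 (t(j := 1)) - p1 (t(j := 0)))"
      if "j \<in> I" "\<And>i. 0 \<le> t i" for j t
      unfolding p1_def using upd[of j t 0] upd[of j t 1] that by (simp add: algebra_simps)
  qed
  then obtain c1 where c1: "\<And>t. (\<And>i. 0 \<le> t i) \<Longrightarrow> p1 t = (\<Sum>J\<in>Pow I. c1 J * (\<Prod>j\<in>J. t j))"
    by blast
  define c where "c J = (if x \<in> J then c1 (J - {x}) else c0 J)" for J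
  show ?case
  proof (intro exI[of _ c] allI impI)
    fix t :: "'i \<Rightarrow> real" assume t: "\<forall>i. 0 \<le> t i"
    have "p t = p0 t + t x * p1 t"
      unfolding p0_def p1_def by (rule insert.prems(2)) (use t in auto)
    also have "\<dots> = (\<Sum>J\<in>Pow I. c0 J * (\<Prod>j\<in>J. t j)) + (\<Sum>J\<in>Pow I. t x * (c1 J * (\<Prod>j\<in>J. t j)))"
      using t by (simp add: c0 c1 sum_distrib_left)
    also have "(\<Sum>J\<in>Pow I. c0 J * (\<Prod>j\<in>J. t j)) = (\<Sum>J\<in>Pow I. c J * (\<Prod>j\<in>J. t j))"
      using insert.hyps by (intro sum.cong) (auto simp: c_def)
    also have "(\<Sum>J\<in>Pow I. t x * (c1 J * (\<Prod>j\<in>J. t j))) = (\<Sum>J\<in>insert x ` Pow I. c J * (\<Prod>j\<in>J. t j))"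
    proof (subst sum.reindex)
      show "inj_on (insert x) (Pow I)" using insert.hyps by (auto simp: inj_on_def)
      show "(\<Sum>J\<in>Pow I. t x * (c1 J * (\<Prod>j\<in>J. t j))) = sum ((\<lambda>J. c J * (\<Prod>j\<in>J. t j)) \<circ> insert x) (Pow I)"
      proof (intro sum.cong refl)
        fix J assume J: "J \<in> Pow I"
        then have "x \<notin> J" "finite J" using insert.hyps finite_subset by auto
        then show "t x * (c1 J * (\<Prod>j\<in>J. t j)) = ((\<lambda>J. c J * (\<Prod>j\<in>J. t j)) \<circ> insert x) J"
          by (simp add: c_def)
      qed
    qed
    also have "(\<Sum>J\<in>Pow I. c J * (\<Prod>j\<in>J. t j)) + (\<Sum>J\<in>insert x ` Pow I. c J * (\<Prod>j\<in>J. t j)) =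
      (\<Sum>J\<in>Pow (insert x I). c J * (\<Prod>j\<in>J. t j))"
      unfolding Pow_insert using insert.hyps by (intro sum.union_disjoint[symmetric]) auto
    finally show "p t = (\<Sum>J\<in>Pow (insert x I). c J * (\<Prod>j\<in>J. t j))" .
  qed
qed

text \<open>Comparing powers of \<open>r\<close> in the expansion of \<open>p (r t)\<close> leaves
  only monomials of size \<open>n\<close>. At the indicator of an \<open>n\<close>-set
  \<open>J\<close> every other \<open>n\<close>-set contributes 0, as it has an index outside
  \<open>J\<close>, so the coefficient of \<open>J\<close> is the value of \<open>p\<close>
  there.\<close>

lemma multiaffine_homogeneous:
  fixes p :: "('i \<Rightarrow> real) \<Rightarrow> real"
  assumes I: "finite I"
    and local: "\<And>t t'. (\<And>i. i \<in> I \<Longrightarrow> t i = t' i) \<Longrightarrow> p t = p t'"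
    and affine: "\<And>j t. j \<in> I \<Longrightarrow> (\<And>i. 0 \<le> t i) \<Longrightarrow> p t = p (t(j := 0)) + t j * (p (t(j := 1)) - p (t(j := 0)))"
    and hom: "\<And>r t. 0 \<le> r \<Longrightarrow> (\<And>i. 0 \<le> t i) \<Longrightarrow> p (\<lambda>i. r * t i) = r ^ n * p t"
  shows "p (\<lambda>_. 1) = (\<Sum>J | J \<subseteq> I \<and> card J = n. p (indicat_real J))"
proof -
  obtain c where c: "\<And>t. (\<And>i. 0 \<le> t i) \<Longrightarrow> p t = (\<Sum>J\<in>Pow I. c J * (\<Prod>j\<in>J. t j))"
    using multiaffine_expansion[OF I local affine] by blast
  have top: "p t = (\<Sum>J | J \<subseteq> I \<and> card J = n. c J * (\<Prod>j\<in>J. t j))" if t: "\<And>i. 0 \<le> t i" for t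
  proof -
    define a where "a m = (\<Sum>J | J \<subseteq> I \<and> card J = m. c J * (\<Prod>j\<in>J. t j))" for m
    \<comment> \<open>The maximum keeps the power \<open>n\<close> in range even if
      \<open>n > card I\<close>; then \<open>a n\<close> is an empty sum and the comparison yields
      \<open>p t = 0\<close>.\<close>
    define N where "N = max n (card I)"
    have "(\<Sum>m\<le>N. (a m - (if m = n then p t else 0)) * r ^ m) = 0" if r: "0 \<le> r" for r
    proof -
      have "p (\<lambda>i. r * t i) = (\<Sum>J\<in>Pow I. c J * (\<Prod>j\<in>J. t j) * r ^ card J)"
        using t r by (subst c) (auto intro!: sum.cong simp: prod.distrib)
      also have "\<dots> = (\<Sum>m\<le>N. \<Sum>J | J \<in> Pow I \<and> card J = m. c J * (\<Prod>j\<in>J. t j) * r ^ card J)"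
        using I card_mono[OF I] by (intro sum.group[symmetric]) (auto simp: N_def le_max_iff_disj)
      also have "\<dots> = (\<Sum>m\<le>N. a m * r ^ m)"
        by (intro sum.cong refl) (auto simp: a_def sum_distrib_right intro!: sum.cong)
      finally have "(\<Sum>m\<le>N. a m * r ^ m) = r ^ n * p t" using hom[OF r t] by simp
      moreover have "(\<Sum>m\<le>N. (if m = n then p t else 0) * r ^ m) = r ^ n * p t"
        by (subst sum.remove[of _ n]) (auto simp: N_def)
      ultimately show ?thesis by (simp add: left_diff_distrib sum_subtractf)
    qed
    then have "{0..} \<subseteq> {r. (\<Sum>m\<le>N. (a m - (if m = n then p t else 0)) * r ^ m) = 0}" by auto
    then have "infinite {r. (\<Sum>m\<le>N. (a m - (if m = n then p t else 0)) * r ^ m) = 0}"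
      using infinite_Ici[of "0::real"] infinite_super by blast
    then have "a n - p t = 0"
      unfolding polyfun_finite_roots by (auto simp: N_def)
    then show ?thesis by (simp add: a_def)
  qed
  have "c J = p (indicat_real J)" if J: "J \<subseteq> I" "card J = n" for J
  proof -
    have "p (indicat_real J) = (\<Sum>J' | J' \<subseteq> I \<and> card J' = n. c J' * (\<Prod>j\<in>J'. indicat_real J j))"
      by (rule top) auto
    also have "\<dots> = (\<Sum>J' | J' \<subseteq> I \<and> card J' = n. if J' = J then c J else 0)"
    proof (intro sum.cong refl)
      fix J' assume J': "J' \<in> {J'. J' \<subseteq> I \<and> card J' = n}"
      then have fin: "finite J" "finite J'" using I J finite_subset by auto
      show "c J' * (\<Prod>j\<in>J'. indicat_real J j) = (if J' = J then c J else 0)"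
      proof (cases "J' = J")
        case False
        then have "\<not> J' \<subseteq> J" using J J' fin card_subset_eq by blast
        then obtain j where "j \<in> J'" "j \<notin> J" by blast
        then have "(\<Prod>j\<in>J'. indicat_real J j) = 0"
          using fin by (intro prod_zero bexI[of _ j]) auto
        then show ?thesis using False by simp
      qed auto
    qed
    also have "\<dots> = c J" using J I by (subst sum.delta) auto
    finally show ?thesis ..
  qed
  then show ?thesis using top[of "\<lambda>_. 1"] by simp
qed

text \<open>The library's \<open>measure_linear_image\<close> requires a well-ordered index type.\<close>

lemma vol_linear_image:
  fixes f :: "real ^ 'n \<Rightarrow> real ^ 'n"
  assumes "linear f" "compact S"
  shows "vol (f ` S) = \<bar>det (matrix f)\<bar> * vol S"
proof -
  \<comment> \<open>For the volume-preserving elementary maps, the coordinate swap and the shear,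
    the claim has to be checked on boxes only.\<close>
  have suff: "\<forall>S. compact S \<longrightarrow> vol (f ` S) = \<bar>det (matrix f)\<bar> * vol S"
    if "linear f" "\<bar>det (matrix f)\<bar> = 1" "\<And>a b. vol (f ` cbox a b) = vol (cbox a b)"
    for f :: "real ^ 'n \<Rightarrow> real ^ 'n"
  proof (intro allI impI)
    fix S :: "(real ^ 'n) set" assume "compact S"
    then have "S \<in> lmeasurable" by (rule lmeasurable_compact)
    moreover have "vol (f ` cbox a b) = 1 * vol (cbox a b)" for a b using that(3) by simp
    ultimately have "f ` S \<in> lmeasurable \<and> 1 * vol S = vol (f ` S)"
      by (rule measure_linear_sufficient[OF that(1)])
    then show "vol (f ` S) = \<bar>det (matrix f)\<bar> * vol S" using that(2) by simp
  qed
  have "\<forall>S. compact S \<longrightarrow> vol (f ` S) = \<bar>det (matrix f)\<bar> * vol S"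
  proof (rule induct_linear_elementary[OF \<open>linear f\<close>])
    fix f g :: "real ^ 'n \<Rightarrow> real ^ 'n"
    assume *: "linear f" "linear g" "\<forall>S. compact S \<longrightarrow> vol (f ` S) = \<bar>det (matrix f)\<bar> * vol S"
      "\<forall>S. compact S \<longrightarrow> vol (g ` S) = \<bar>det (matrix g)\<bar> * vol S"
    show "\<forall>S. compact S \<longrightarrow> vol ((f \<circ> g) ` S) = \<bar>det (matrix (f \<circ> g))\<bar> * vol S"
    proof (intro allI impI)
      fix S :: "(real ^ 'n) set" assume "compact S"
      moreover have "compact (g ` S)"
        using \<open>compact S\<close> *(2) by (intro compact_continuous_image linear_continuous_on) (auto simp: linear_linear)
      ultimately show "vol ((f \<circ> g) ` S) = \<bar>det (matrix (f \<circ> g))\<bar> * vol S"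
        using * by (simp add: image_comp[symmetric] matrix_compose det_mul abs_mult del: o_apply image_comp)
    qed
  next
    fix f :: "real ^ 'n \<Rightarrow> real ^ 'n" and i
    assume f: "linear f" "\<And>x. f x $ i = 0"
    have "axis i 1 \<notin> range f" using f(2) by (metis axis_nth rangeE zero_neq_one)
    then have "\<not> inj f" using linear_injective_imp_surjective[OF f(1)] by blast
    then have "det (matrix f) = 0" "\<And>S. vol (f ` S) = 0"
      using det_nz_iff_inj[OF f(1)] negligible_linear_singular_image[OF f(1)] negligible_imp_measure0 by blast+
    then show "\<forall>S. compact S \<longrightarrow> vol (f ` S) = \<bar>det (matrix f)\<bar> * vol S" by simp
  next
    fix c :: "'n \<Rightarrow> real"
    have "det (matrix (\<lambda>x. \<chi> i. c i * x $ i)) = prod c UNIV"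
      by (subst det_diagonal) (auto simp: matrix_def axis_def)
    then show "\<forall>S. compact S \<longrightarrow> vol ((\<lambda>x. \<chi> i. c i * x $ i) ` S) = \<bar>det (matrix (\<lambda>x. \<chi> i. c i * x $ i))\<bar> * vol S"
      by (simp add: measure_stretch lmeasurable_compact)
  next
    fix m n :: 'n assume "m \<noteq> n"
    define h where "h x = (\<chi> i. x $ Transposition.transpose m n i)" for x :: "real ^ 'n"
    have lin: "linear h" by (rule linearI) (simp_all add: vec_eq_iff h_def)
    have "orthogonal_transformation h"
      unfolding orthogonal_transformation
    proof (intro conjI lin allI)
      fix v
      have "(norm (h v))\<^sup>2 = (\<Sum>i\<in>UNIV. v $ Transposition.transpose m n i * v $ Transposition.transpose m n i)"
        by (simp add: power2_norm_eq_inner inner_vec_def h_def)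
      also have "\<dots> = (\<Sum>i\<in>UNIV. v $ i * v $ i)"
        by (rule sum.permute[OF permutes_swap_id, of _ UNIV, symmetric, unfolded o_def]) auto
      also have "\<dots> = (norm v)\<^sup>2" by (simp add: power2_norm_eq_inner inner_vec_def)
      finally show "norm (h v) = norm v" by simp
    qed
    then have det: "\<bar>det (matrix h)\<bar> = 1"
      using det_orthogonal_matrix orthogonal_transformation_matrix by fastforce
    have "vol (h ` cbox a b) = vol (cbox a b)" for a b
    proof (cases "cbox a b = {}")
      case False
      have inv: "h (h x) = x" for x by (simp add: h_def)
      have sub: "h ` cbox a b \<subseteq> cbox (h a) (h b)" for a b
        by (auto simp: mem_box_cart h_def)
      have "h ` cbox a b = cbox (h a) (h b)"
        using sub[of a b] sub[of "h a" "h b"] inv by (auto simp: image_iff) (metis image_eqI subset_iff)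
      moreover have "(\<Prod>i\<in>UNIV. h b $ i - h a $ i) = (\<Prod>i\<in>UNIV. b $ i - a $ i)"
        unfolding h_def using prod.permute[OF permutes_swap_id, of m UNIV n "\<lambda>i. b $ i - a $ i"]
        by (simp add: o_def)
      moreover from calculation(1) have "cbox (h a) (h b) \<noteq> {}" using False by auto
      ultimately show ?thesis using False by (simp add: content_cbox_cart)
    qed simp
    from suff[OF lin det this]
    show "\<forall>S. compact S \<longrightarrow> vol ((\<lambda>x. \<chi> i. x $ Transposition.transpose m n i) ` S) =
       \<bar>det (matrix (\<lambda>x::real ^ 'n. \<chi> i. x $ Transposition.transpose m n i))\<bar> * vol S"
      by (simp add: h_def[abs_def])
  next
    fix m n :: 'n assume mn: "m \<noteq> n"
    define h where "h x = (\<chi> i. if i = m then x $ m + x $ n else x $ i)" for x :: "real ^ 'n"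
    have lin: "linear h" by (rule linearI) (auto simp: vec_eq_iff h_def algebra_simps)
    have "matrix h = (\<chi> k. if k = m then row m (mat 1) + 1 *s row n (mat 1) else row k (mat 1))"
      using mn by (auto simp: vec_eq_iff matrix_def h_def row_def mat_def axis_def)
    then have det: "\<bar>det (matrix h)\<bar> = 1"
      using det_row_operation[OF mn, of "mat 1 :: real ^ 'n ^ 'n" 1] by simp
    have "vol (h ` cbox a b) = vol (cbox a b)" for a b
    proof (cases "cbox a b = {}")
      case False
      \<comment> \<open>The lower corner is moved to the origin before shearing; by linearity this
        translates the image and leaves its volume unchanged.\<close>
      have cb: "cbox a b = (+) a ` cbox 0 (b - a)" using cbox_translation[of a 0 "b - a"] by simp
      then have "h ` cbox a b = (+) (h a) ` h ` cbox 0 (b - a)"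
        using lin by (simp add: image_image linear_add)
      then have "vol (h ` cbox a b) = vol (h ` cbox 0 (b - a))" by (simp add: measure_translation)
      also have "\<dots> = vol (cbox 0 (b - a))"
        unfolding h_def[abs_def] using False mn cb by (intro measure_shear_interval) auto
      also have "\<dots> = vol (cbox a b)" unfolding cb by (rule measure_translation[symmetric])
      finally show ?thesis .
    qed simp
    from suff[OF lin det this]
    show "\<forall>S. compact S \<longrightarrow> vol ((\<lambda>x. \<chi> i. if i = m then x $ m + x $ n else x $ i) ` S) =
       \<bar>det (matrix (\<lambda>x::real ^ 'n. \<chi> i. if i = m then x $ m + x $ n else x $ i))\<bar> * vol S"
      by (simp add: h_def[abs_def])
  qed
  with assms(2) show ?thesis by blast
qed

lemma vol_scaleR:
  fixes K :: "(real ^ 'n) set"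
  assumes "convex_body K" "0 \<le> r"
  shows "vol ((*\<^sub>R) r ` K) = r ^ CARD('n) * vol K"
proof -
  have "compact K" using assms by (auto simp: convex_body_def)
  then have "vol ((*\<^sub>R) r ` K) = \<bar>det (matrix ((*\<^sub>R) r :: real ^ 'n \<Rightarrow> _))\<bar> * vol K"
    by (intro vol_linear_image[OF linear_scaleR_fun])
  also have "matrix ((*\<^sub>R) r :: real ^ 'n \<Rightarrow> _) = r *\<^sub>R mat 1"
    by (simp add: matrix_def mat_def axis_def vec_eq_iff)
  also have "det (r *\<^sub>R mat 1 :: real ^ 'n ^ 'n) = r ^ CARD('n)"
    by (subst det_diagonal) (auto simp: mat_def)
  finally show ?thesis using assms by simp
qed

text \<open>The classical decomposition of a zonotope into parallelepipeds, without constructing the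
  tiling: the volume is multiaffine in the generator lengths and homogeneous of degree n, so only
  n-element subsets of generators survive.\<close>

lemma vol_sum_segments_subsets:
  fixes w :: "'i \<Rightarrow> real ^ 'n"
  assumes I: "finite I"
  shows "vol (\<Sum>i\<in>I. ray_segment (w i)) = (\<Sum>J | J \<subseteq> I \<and> card J = CARD('n). vol (\<Sum>i\<in>J. ray_segment (w i)))"
proof -
  define p where "p t = vol (\<Sum>i\<in>I. ray_segment (t i *\<^sub>R w i))" for t
  have "p (\<lambda>_. 1) = (\<Sum>J | J \<subseteq> I \<and> card J = CARD('n). p (indicat_real J))"
  proof (rule multiaffine_homogeneous[OF I])
    show "p t = p t'" if "\<And>i. i \<in> I \<Longrightarrow> t i = t' i" for t t'
      using that by (simp add: p_def)
    show "p t = p (t(j := 0)) + t j * (p (t(j := 1)) - p (t(j := 0)))" if "j \<in> I" "\<And>i. 0 \<le> t i" for j t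
    proof -
      define K where "K = (\<Sum>i\<in>I - {j}. ray_segment (t i *\<^sub>R w i))"
      have K: "convex_body K" unfolding K_def by (intro convex_body_sum convex_body_ray_segment)
      have "p (t(j := a)) = vol (K + ray_segment (a *\<^sub>R w j))" for a
      proof -
        have "(\<Sum>i\<in>I - {j}. ray_segment ((t(j := a)) i *\<^sub>R w i)) = K"
          unfolding K_def by (intro sum.cong) auto
        then show ?thesis
          using I \<open>j \<in> I\<close> by (simp add: p_def sum.remove add.commute)
      qed
      from this[of "t j"] this[of 0] this[of 1] show ?thesis
        using vol_plus_segment_affine[OF K, of "t j" "w j"] that by simp
    qed
    show "p (\<lambda>i. r * t i) = r ^ CARD('n) * p t" if "0 \<le> r" for r t
    proof -
      have "(\<Sum>i\<in>I. ray_segment ((r * t i) *\<^sub>R w i)) = (*\<^sub>R) r ` (\<Sum>i\<in>I. ray_segment (t i *\<^sub>R w i))"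
        by (subst sum_set_linear) (auto simp: linear_image_set_plus linear_scaleR_fun linear_image_ray_segment intro!: sum.cong)
      then show ?thesis
        using that by (simp add: p_def vol_scaleR convex_body_sum convex_body_ray_segment)
    qed
  qed
  moreover have "p (indicat_real J) = vol (\<Sum>i\<in>J. ray_segment (w i))" if "J \<subseteq> I" for J
  proof -
    have "(\<Sum>i\<in>I. ray_segment (indicat_real J i *\<^sub>R w i)) = (\<Sum>i\<in>J. ray_segment (w i))"
      using I that by (intro sum.mono_neutral_cong_right) auto
    then show ?thesis by (simp add: p_def)
  qed
  ultimately show ?thesis by (simp add: p_def)
qed

section \<open>Volumes of zonotopes\<close>

text \<open>Lists of vectors are turned into matrices through an arbitrary enumeration of the index type;
  only \<open>\<bar>detl us\<bar>\<close> matters below, and it does not depend on this choice.\<close>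

definition row_index :: "'n::finite \<Rightarrow> nat" where
  "row_index = (SOME e. bij_betw e UNIV {..<CARD('n)})"

lemma bij_betw_row_index: "bij_betw (row_index :: 'n::finite \<Rightarrow> nat) UNIV {..<CARD('n)}"
proof -
  have "\<exists>e :: 'n \<Rightarrow> nat. bij_betw e UNIV {..<CARD('n)}"
    using ex_bij_betw_finite_nat[of "UNIV :: 'n set"] by (simp add: atLeast0LessThan)
  then show ?thesis unfolding row_index_def by (rule someI_ex)
qed

lemma row_index_less: "row_index (r :: 'n::finite) < CARD('n)"
  using bij_betw_row_index by (auto simp: bij_betw_def)

lemma row_index_eq_iff: "row_index r = row_index s \<longleftrightarrow> r = (s :: 'n::finite)"
  using bij_betw_row_index[where 'n='n] by (auto simp: bij_betw_def inj_def)

lemma ex_row_index: "k < CARD('n) \<Longrightarrow> \<exists>r :: 'n::finite. row_index r = k"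
  using bij_betw_row_index[where 'n='n] by (metis bij_betw_def imageE lessThan_iff)

definition detl :: "(real ^ 'n) list \<Rightarrow> real" where
  "detl us = det (\<chi> r. us ! row_index r)"

definition zono :: "(real ^ 'n) list \<Rightarrow> (real ^ 'n) set" where
  "zono ws = (\<Sum>w\<leftarrow>ws. ray_segment w)"

lemma zono_simps [simp]: "zono [] = 0" "zono (w # ws) = ray_segment w + zono ws"
  "zono (ws @ ws') = zono ws + zono ws'"
  by (simp_all add: zono_def)

lemma convex_body_zono: "convex_body (zono ws)"
  by (induction ws) (auto simp: convex_body_plus convex_body_ray_segment convex_body_singleton)

lemma zono_nth: "zono ws = (\<Sum>i<length ws. ray_segment (ws ! i))"
  by (simp add: zono_def sum_list_sum_nth atLeast0LessThan)

lemma linear_image_zono: "linear f \<Longrightarrow> f ` zono ws = zono (map f ws)"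
  by (induction ws) (simp_all add: linear_image_set_plus linear_image_ray_segment linear_0)

text \<open>The sum of the segments is the image of the unit cube under the transpose of the matrix
  whose rows are \<open>us\<close>.\<close>

lemma vol_parallelepiped:
  fixes us :: "(real ^ 'n) list"
  assumes "length us = CARD('n)"
  shows "vol (zono us) = \<bar>detl us\<bar>"
proof -
  define M :: "real ^ 'n ^ 'n" where "M = (\<chi> r. us ! row_index r)"
  define f where "f = (*v) (transpose M)"
  have f: "f x = (\<Sum>r\<in>UNIV. x $ r *\<^sub>R us ! row_index r)" for x
    by (simp add: f_def M_def matrix_mult_sum column_transpose row_def scalar_mult_eq_scaleR)
  have "zono us = (\<Sum>r\<in>UNIV. ray_segment (us ! row_index (r::'n)))"
    unfolding zono_nth assms by (rule sum.reindex_bij_betw[OF bij_betw_row_index, symmetric])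
  also have "\<dots> = {\<Sum>r\<in>UNIV. s r |s. \<forall>r\<in>UNIV. s r \<in> ray_segment (us ! row_index (r::'n))}"
    by (rule set_sum_alt) simp
  also have "\<dots> = f ` cbox 0 1"
  proof (intro equalityI subsetI)
    fix x assume "x \<in> {\<Sum>r\<in>UNIV. s r |s. \<forall>r\<in>UNIV. s r \<in> ray_segment (us ! row_index (r::'n))}"
    then obtain s where s: "x = (\<Sum>r\<in>UNIV. s r)" "\<forall>r. s r \<in> ray_segment (us ! row_index (r::'n))" by auto
    then have "\<forall>r. \<exists>c. c \<in> {0..1} \<and> s r = c *\<^sub>R us ! row_index r" by (simp add: ray_segment_def image_iff Bex_def)
    then obtain c where c: "\<And>r. c r \<in> {0..1} \<and> s r = c r *\<^sub>R us ! row_index r" by metis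
    have "x = f (\<chi> r. c r)" using c by (simp add: f s(1))
    moreover have "(\<chi> r. c r) \<in> cbox 0 1" using c by (simp add: mem_box_cart)
    ultimately show "x \<in> f ` cbox 0 1" by blast
  next
    fix x assume "x \<in> f ` cbox 0 1"
    then obtain y where y: "x = f y" "y \<in> cbox 0 1" by auto
    then show "x \<in> {\<Sum>r\<in>UNIV. s r |s. \<forall>r\<in>UNIV. s r \<in> ray_segment (us ! row_index (r::'n))}"
      by (intro CollectI exI[of _ "\<lambda>r. y $ r *\<^sub>R us ! row_index r"])
         (auto simp: f ray_segment_def mem_box_cart)
  qed
  finally have "vol (zono us) = vol (f ` cbox 0 1)" by simp
  also have "\<dots> = \<bar>det (matrix f)\<bar> * vol (cbox 0 (1 :: real ^ 'n))"
    by (rule vol_linear_image) (auto simp: f_def)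
  also have "matrix f = transpose M" by (simp add: f_def)
  also have "vol (cbox 0 (1 :: real ^ 'n)) = 1" by (simp add: content_cbox_cart interval_ne_empty_cart)
  finally show ?thesis by (simp add: det_transpose detl_def M_def)
qed

text \<open>Isolates the only row that depends on \<open>u\<close>, in the conditional form on which
  the determinant rules for rows operate.\<close>

lemma detl_split:
  fixes u :: "real ^ 'n"
  assumes "length acc < CARD('n)"
  obtains r0 where "\<And>u. (\<chi> r. (acc @ u # us) ! row_index r) =
      (\<chi> r. if r = r0 then u else (acc @ 0 # us) ! row_index (r::'n))"
    "row_index r0 = length acc"
proof -
  obtain r0 :: 'n where r0: "row_index r0 = length acc" using ex_row_index[OF assms] by blast
  show ?thesis
  proof
    fix u
    show "(\<chi> r. (acc @ u # us) ! row_index r) =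
      (\<chi> r. if r = r0 then u else (acc @ 0 # us) ! row_index (r::'n))"
    proof -
      have "(acc @ u # us) ! row_index r = (if r = r0 then u else (acc @ 0 # us) ! row_index r)" for r
        using row_index_eq_iff[of r r0] r0 by (auto simp: nth_append nth_Cons')
      then show ?thesis by simp
    qed
  qed fact
qed

lemma linear_detl:
  fixes acc us :: "(real ^ 'n) list"
  assumes "length acc < CARD('n)"
  shows "linear (\<lambda>u. detl (acc @ u # us))"
proof -
  obtain r0 :: 'n where r0: "\<And>u. (\<chi> r. (acc @ u # us) ! row_index r) =
      (\<chi> r. if r = r0 then u else (acc @ 0 # us) ! row_index (r::'n))"
    using detl_split[OF assms] by blast
  show ?thesis
  proof (rule linearI)
    fix x y and c :: real
    show "detl (acc @ (x + y) # us) = detl (acc @ x # us) + detl (acc @ y # us)"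
      unfolding detl_def r0 by (rule det_row_add)
    show "detl (acc @ (c *\<^sub>R x) # us) = c *\<^sub>R detl (acc @ x # us)"
      unfolding detl_def r0 using det_row_mul[of r0 c "\<lambda>_. x" "\<lambda>r. (acc @ 0 # us) ! row_index r"]
      unfolding scalar_mult_eq_scaleR by simp
  qed
qed

lemma detl_scaleR:
  fixes acc us :: "(real ^ 'n) list"
  assumes "length acc < CARD('n)"
  shows "detl (acc @ (c *\<^sub>R u) # us) = c * detl (acc @ u # us)"
  using linear_cmul[OF linear_detl[OF assms], of c u us] by simp

lemma detl_add_span:
  fixes acc us vs :: "(real ^ 'n) list"
  assumes "length (acc @ u # us) = CARD('n)" "x \<in> span (set acc \<union> set us)"
  shows "detl (acc @ (u + x) # us) = detl (acc @ u # us)"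
proof -
  have "length acc < CARD('n)" using assms by simp
  then obtain r0 :: 'n where r0: "\<And>u. (\<chi> r. (acc @ u # us) ! row_index r) =
      (\<chi> r. if r = r0 then u else (acc @ 0 # us) ! row_index (r::'n))" and len: "row_index r0 = length acc"
    using detl_split by blast
  define A where "A = (\<chi> r. (acc @ u # us) ! row_index (r::'n))"
  have rows: "row j A = (acc @ u # us) ! row_index j" for j by (simp add: row_def A_def vec_eq_iff)
  have "set acc \<union> set us \<subseteq> {row j A |j. j \<noteq> r0}"
  proof
    fix y assume "y \<in> set acc \<union> set us"
    then obtain i where i: "i < CARD('n)" "i \<noteq> length acc" "(acc @ u # us) ! i = y"
    proof
      assume "y \<in> set acc"
      then obtain i where "i < length acc" "acc ! i = y" by (auto simp: in_set_conv_nth)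
      then show ?thesis using assms(1) by (intro that[of i]) (auto simp: nth_append)
    next
      assume "y \<in> set us"
      then obtain i where "i < length us" "us ! i = y" by (auto simp: in_set_conv_nth)
      then show ?thesis using assms(1) by (intro that[of "Suc (length acc + i)"]) (auto simp: nth_append)
    qed
    moreover obtain j :: 'n where "row_index j = i" using ex_row_index i by blast
    ultimately show "y \<in> {row j A |j. j \<noteq> r0}" using len by (auto simp: rows)
  qed
  then have "x \<in> vec.span {row j A |j. j \<noteq> r0}"
    using assms(2) span_mono[of "set acc \<union> set us"] by (auto simp: span_vec_eq)
  then have "det (\<chi> k. if k = r0 then row r0 A + x else row k A) = det A" by (rule det_row_span)
  moreover have "(\<chi> k. if k = r0 then row r0 A + x else row k A) = (\<chi> r. (acc @ (u + x) # us) ! row_index (r::'n))"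
  proof -
    have "row r0 A = u" using len by (simp add: rows)
    moreover have "row k A = (acc @ 0 # us) ! row_index k" if "k \<noteq> r0" for k
      using that row_index_eq_iff[of k r0] len by (auto simp: rows nth_append nth_Cons')
    ultimately show ?thesis unfolding r0 by (simp add: vec_eq_iff)
  qed
  ultimately show ?thesis by (simp add: detl_def A_def)
qed

lemma detl_map:
  fixes us :: "(real ^ 'n) list"
  assumes "length us = CARD('n)"
  shows "detl (map ((*v) T) us) = det T * detl us"
proof -
  have "(\<chi> r. map ((*v) T) us ! row_index (r::'n)) = (\<chi> r. us ! row_index r) ** transpose T"
    using assms row_index_less[where 'n='n]
    by (simp add: vec_eq_iff matrix_matrix_mult_def matrix_vector_mult_def transpose_def mult.commute)
  then show ?thesis by (simp add: detl_def det_mul det_transpose mult.commute)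
qed

section \<open>Sums over all choices of one entry from each list\<close>

lemma sum_product_lists_Cons:
  fixes F :: "_ \<Rightarrow> 'b::comm_monoid_add"
  shows "(\<Sum>us\<leftarrow>product_lists (g # gs). F us) = (\<Sum>x\<leftarrow>g. \<Sum>us\<leftarrow>product_lists gs. F (x # us))"
  by (induction g) (simp_all add: o_def)

text \<open>Kept folded so that sums over \<open>product_lists\<close> are unfolded through
  \<open>sum_product_lists_Cons\<close> instead.\<close>

declare product_lists.simps(2) [simp del]

lemma sum_list_sum_swap: "(\<Sum>x\<leftarrow>xs. \<Sum>i\<in>A. f x i) = (\<Sum>i\<in>A. \<Sum>x\<leftarrow>xs. f x i)"
  for f :: "_ \<Rightarrow> _ \<Rightarrow> real"
  by (induction xs) (simp_all add: sum.distrib)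

lemma sum_list_swap: "(\<Sum>x\<leftarrow>xs. \<Sum>y\<leftarrow>ys. f x y) = (\<Sum>y\<leftarrow>ys. \<Sum>x\<leftarrow>xs. f x y)"
  for f :: "_ \<Rightarrow> _ \<Rightarrow> real"
  by (induction xs) (simp_all add: sum_list_addf)

lemma sum_product_lists_append:
  fixes F :: "_ \<Rightarrow> 'b::comm_monoid_add"
  shows "(\<Sum>us\<leftarrow>product_lists (gs @ hs). F us) = (\<Sum>us\<leftarrow>product_lists gs. \<Sum>vs\<leftarrow>product_lists hs. F (us @ vs))"
  by (induction gs arbitrary: F) (simp_all add: sum_product_lists_Cons)

lemma sum_product_lists_map:
  fixes F :: "_ \<Rightarrow> 'b::comm_monoid_add"
  shows "(\<Sum>us\<leftarrow>product_lists (map (map f) gs). F us) = (\<Sum>us\<leftarrow>product_lists gs. F (map f us))"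
  by (induction gs arbitrary: F) (simp_all add: sum_product_lists_Cons o_def)

lemma sum_product_lists_cong:
  assumes "\<And>us. length us = length gs \<Longrightarrow> F us = G us"
  shows "(\<Sum>us\<leftarrow>product_lists gs. F us) = (\<Sum>us\<leftarrow>product_lists gs. G us)"
  using assms in_set_product_lists_length by (metis (no_types, lifting) map_cong)

lemma sum_product_lists_commute:
  fixes F :: "'a multiset \<Rightarrow> real"
  shows "(\<Sum>us\<leftarrow>product_lists (a # b # gs). F (mset us)) = (\<Sum>us\<leftarrow>product_lists (b # a # gs). F (mset us))"
proof -
  show ?thesis
    unfolding sum_product_lists_Cons by (subst sum_list_swap) (simp add: add_mset_commute)
qed

text \<open>A summand that sees only the multiset of choices is insensitive to swapping adjacent
  lists, and such swaps generate all reorderings.\<close>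

lemma sum_product_lists_mset_cong:
  fixes F :: "'a multiset \<Rightarrow> real"
  assumes "mset gs = mset hs"
  shows "(\<Sum>us\<leftarrow>product_lists gs. F (mset us)) = (\<Sum>us\<leftarrow>product_lists hs. F (mset us))"
  using assms
proof (induction gs arbitrary: hs F)
  case (Cons g gs)
  then obtain as bs where hs: "hs = as @ g # bs"
    by (metis list.set_intros(1) set_mset_mset split_list)
  then have gs: "mset gs = mset (as @ bs)" using Cons.prems by simp
  \<comment> \<open>Bubbles \<open>g\<close> to the front. \<open>F\<close> is kept general because
    each entry already chosen is absorbed into it by \<open>add_mset\<close>.\<close>
  have move: "(\<Sum>us\<leftarrow>product_lists (as @ g # bs). F (mset us)) = (\<Sum>us\<leftarrow>product_lists (g # as @ bs). F (mset us))" for F :: "'a multiset \<Rightarrow> real"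
  proof (induction as arbitrary: F)
    case (Cons a as)
    have "(\<Sum>us\<leftarrow>product_lists ((a # as) @ g # bs). F (mset us)) = (\<Sum>x\<leftarrow>a. \<Sum>us\<leftarrow>product_lists (as @ g # bs). F (add_mset x (mset us)))"
      by (simp add: sum_product_lists_Cons)
    also have "\<dots> = (\<Sum>x\<leftarrow>a. \<Sum>us\<leftarrow>product_lists (g # as @ bs). F (add_mset x (mset us)))"
      using Cons.IH[of "\<lambda>M. F (add_mset _ M)"] by simp
    also have "\<dots> = (\<Sum>us\<leftarrow>product_lists (a # g # as @ bs). F (mset us))"
      by (subst (2) sum_product_lists_Cons) simp
    also have "\<dots> = (\<Sum>us\<leftarrow>product_lists (g # a # as @ bs). F (mset us))"
      by (rule sum_product_lists_commute)
    finally show ?case by simp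
  qed simp
  have "(\<Sum>us\<leftarrow>product_lists (g # gs). F (mset us)) = (\<Sum>us\<leftarrow>product_lists (g # as @ bs). F (mset us))"
    unfolding sum_product_lists_Cons using Cons.IH[OF gs, of "\<lambda>M. F (add_mset _ M)"] by simp
  then show ?case using move hs by simp
qed simp

abbreviation index_lists :: "'i set \<Rightarrow> nat \<Rightarrow> 'i list set" where
  "index_lists I m \<equiv> {is. set is \<subseteq> I \<and> length is = m}"

lemma sum_index_lists_Suc:
  assumes "finite I"
  shows "(\<Sum>is\<in>index_lists I (Suc m). F is) = (\<Sum>i\<in>I. \<Sum>is\<in>index_lists I m. F (i # is))"
proof -
  have "index_lists I (Suc m) = (\<lambda>(i, is). i # is) ` (I \<times> index_lists I m)"
    by (force simp: length_Suc_conv image_iff)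
  then have "(\<Sum>is\<in>index_lists I (Suc m). F is) = (\<Sum>(i, is)\<in>I \<times> index_lists I m. F (i # is))"
    by (simp add: sum.reindex inj_on_def case_prod_unfold)
  then show ?thesis by (simp add: sum.cartesian_product)
qed

text \<open>To choose an entry of a concatenation is to choose a block first and then an entry of
  that block. This is the expansion of an m-th power of a sum, with ordered index lists in place of
  multinomial coefficients.\<close>

lemma sum_product_lists_replicate_concat:
  fixes F :: "'a list \<Rightarrow> real"
  shows "(\<Sum>us\<leftarrow>product_lists (replicate m (concat (map G [0..<k]))). F us) =
    (\<Sum>is\<in>index_lists {..<k} m. \<Sum>us\<leftarrow>product_lists (map G is). F us)"
proof (induction m arbitrary: F)
  case 0
  have "index_lists {..<k} 0 = {[]}" by auto
  then show ?case by simp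
next
  case (Suc m)
  have cc: "(\<Sum>x\<leftarrow>concat (map G js). f x) = (\<Sum>j\<leftarrow>js. \<Sum>x\<leftarrow>G j. f x)" for js and f :: "'a \<Rightarrow> real"
    by (induction js) simp_all
  have "(\<Sum>us\<leftarrow>product_lists (replicate (Suc m) (concat (map G [0..<k]))). F us) =
    (\<Sum>j\<leftarrow>[0..<k]. \<Sum>x\<leftarrow>G j. \<Sum>is\<in>index_lists {..<k} m. \<Sum>us\<leftarrow>product_lists (map G is). F (x # us))"
    by (simp add: sum_product_lists_Cons cc Suc.IH)
  also have "\<dots> = (\<Sum>j<k. \<Sum>is\<in>index_lists {..<k} m. \<Sum>x\<leftarrow>G j. \<Sum>us\<leftarrow>product_lists (map G is). F (x # us))"
    by (simp add: interv_sum_list_conv_sum_set_nat atLeast0LessThan)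
       (simp only: sum_list_sum_swap)
  also have "\<dots> = (\<Sum>is\<in>index_lists {..<k} (Suc m). \<Sum>us\<leftarrow>product_lists (map G is). F us)"
    by (subst sum_index_lists_Suc) (simp_all add: sum_product_lists_Cons sum_list_sum_swap)
  finally show ?case .
qed

text \<open>Index lists with a repetition give determinant 0; those without are the orderings of
  n-element sets, each ordering giving the volume of the same parallelepiped. The factor
  \<open>fact CARD('n)\<close> counts the orderings.\<close>

lemma vol_zono:
  fixes ws :: "(real ^ 'n) list"
  shows "fact CARD('n) * vol (zono ws) = (\<Sum>us\<leftarrow>product_lists (replicate CARD('n) ws). \<bar>detl us\<bar>)"
proof -
  define N where "N = length ws"
  define h where "h is = \<bar>detl (map ((!) ws) is)\<bar>" for "is"
  \<comment> \<open>Splitting \<open>ws\<close> into singletons turns lists of generators into lists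
    of positions, so equal generators at different positions remain distinguishable.\<close>
  have ws: "ws = concat (map (\<lambda>i. [ws ! i]) [0..<N])"
    by (simp add: N_def concat_map_singleton map_nth)
  have pl: "product_lists (map (\<lambda>i. [ws ! i]) is) = [map ((!) ws) is]" for "is"
    by (induction "is") (simp_all add: product_lists.simps(2))
  have fin: "finite (index_lists {..<N} CARD('n))" using finite_lists_length_eq[of "{..<N}"] by simp
  have h_set: "h is = vol (\<Sum>i\<in>set is. ray_segment (ws ! i))" if "distinct is" "length is = CARD('n)" for "is"
  proof -
    have "h is = vol (zono (map ((!) ws) is))" using that by (simp add: h_def vol_parallelepiped)
    also have "zono (map ((!) ws) is) = (\<Sum>i\<in>set is. ray_segment (ws ! i))"
      using that by (simp add: zono_def o_def sum_list_distinct_conv_sum_set)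
    finally show ?thesis .
  qed
  have h_zero: "h is = 0" if nd: "\<not> distinct is" and l: "length is = CARD('n)" for "is"
  proof -
    obtain a b where ab: "a < length is" "b < length is" "a \<noteq> b" "is ! a = is ! b"
      using nd by (auto simp: distinct_conv_nth)
    obtain r :: 'n where r: "row_index r = a" using ex_row_index[of a] ab l by auto
    obtain s :: 'n where s: "row_index s = b" using ex_row_index[of b] ab l by auto
    note rs = r s
    have "r \<noteq> s" using rs ab by auto
    then have "det (\<chi> r. map ((!) ws) is ! row_index (r::'n)) = 0"
      using ab rs l by (intro det_identical_rows[of r s]) (auto simp: row_def)
    then show ?thesis by (simp add: h_def detl_def)
  qed
  have "(\<Sum>us\<leftarrow>product_lists (replicate CARD('n) ws). \<bar>detl us\<bar>) =
    (\<Sum>is\<in>index_lists {..<N} CARD('n). h is)"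
    by (subst ws, subst sum_product_lists_replicate_concat) (simp add: pl h_def)
  also have "\<dots> = (\<Sum>is | is \<in> index_lists {..<N} CARD('n) \<and> distinct is. h is)"
    using fin by (intro sum.mono_neutral_right) (auto simp: h_zero)
  \<comment> \<open>Distinct lists are grouped by their underlying set.\<close>
  also have "\<dots> = (\<Sum>J | J \<subseteq> {..<N} \<and> card J = CARD('n). \<Sum>is | is \<in> {is. is \<in> index_lists {..<N} CARD('n) \<and> distinct is} \<and> set is = J. h is)"
    by (intro sum.group[symmetric] finite_subset[OF _ fin]) (auto simp: distinct_card)
  also have "\<dots> = (\<Sum>J | J \<subseteq> {..<N} \<and> card J = CARD('n). fact CARD('n) * vol (\<Sum>i\<in>J. ray_segment (ws ! i)))"
  proof (intro sum.cong refl)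
    fix J assume J: "J \<in> {J. J \<subseteq> {..<N} \<and> card J = CARD('n)}"
    then have fJ: "finite J" using finite_subset by auto
    have eq: "{is. is \<in> {is. is \<in> index_lists {..<N} CARD('n) \<and> distinct is} \<and> set is = J} = permutations_of_set J"
      using J by (auto simp: permutations_of_set_def distinct_card)
    have "(\<Sum>is\<in>permutations_of_set J. h is) = (\<Sum>is\<in>permutations_of_set J. vol (\<Sum>i\<in>J. ray_segment (ws ! i)))"
    proof (intro sum.cong refl)
      fix "is" assume "is \<in> permutations_of_set J"
      then have "distinct is" "set is = J" by (auto simp: permutations_of_set_def)
      then show "h is = vol (\<Sum>i\<in>J. ray_segment (ws ! i))" using J h_set[of "is"] distinct_card[of "is"] by auto
    qed
    then show "(\<Sum>is | is \<in> {is. is \<in> index_lists {..<N} CARD('n) \<and> distinct is} \<and> set is = J. h is) =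
      fact CARD('n) * vol (\<Sum>i\<in>J. ray_segment (ws ! i))"
      unfolding eq using fJ J by simp
  qed
  also have "\<dots> = fact CARD('n) * vol (zono ws)"
    unfolding sum_distrib_left[symmetric]
    using vol_sum_segments_subsets[of "{..<N}" "\<lambda>i. ws ! i"] by (simp add: zono_nth N_def)
  finally show ?thesis by simp
qed

text \<open>The mixed volume of the zonotopes generated by the entries of \<open>gens\<close>, as
  \<open>polarized_volume_zono\<close> confirms.\<close>

definition zono_mixed :: "(real ^ 'n) list list \<Rightarrow> real" where
  "zono_mixed gens = (\<Sum>us\<leftarrow>product_lists gens. \<bar>detl us\<bar>) / fact CARD('n)"

text \<open>The absolute determinant is the volume of a Minkowski sum and therefore depends only on
  the multiset of rows; no determinant has to be permuted.\<close>

lemma zono_mixed_mset_cong: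
  fixes gs hs :: "(real ^ 'n) list list"
  assumes "mset gs = mset hs" "length gs = CARD('n)"
  shows "zono_mixed gs = zono_mixed hs"
proof -
  define F where "F M = vol (\<Sum>w\<in>#M. ray_segment (w :: real ^ 'n))" for M
  have F: "F (mset us) = \<bar>detl us\<bar>" if "length us = CARD('n)" for us
    using that by (simp add: F_def vol_parallelepiped[symmetric] zono_def sum_mset_sum_list flip: mset_map)
  have "length hs = CARD('n)" using assms mset_eq_length by metis
  then have "(\<Sum>us\<leftarrow>product_lists hs. \<bar>detl us\<bar>) = (\<Sum>us\<leftarrow>product_lists hs. F (mset us))"
    "(\<Sum>us\<leftarrow>product_lists gs. \<bar>detl us\<bar>) = (\<Sum>us\<leftarrow>product_lists gs. F (mset us))"
    using assms by (auto intro!: sum_product_lists_cong simp: F)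
  then show ?thesis using sum_product_lists_mset_cong[OF assms(1), of F] by (simp add: zono_mixed_def)
qed

lemma sum_zono_concat:
  fixes h :: "nat \<Rightarrow> (real ^ 'n) list"
  shows "(\<Sum>i<k. zono (h i)) = zono (concat (map h [0..<k]))"
  by (induction k) simp_all

text \<open>\<open>acc\<close> collects the rows already chosen, so that the induction can pull one
  scalar at a time out of its row; nonnegative scalars pass through the absolute value.\<close>

lemma sum_detl_scaled:
  fixes G :: "nat \<Rightarrow> (real ^ 'n) list"
  assumes "length acc + length is = CARD('n)" "\<And>i. i \<in> set is \<Longrightarrow> 0 \<le> l i"
  shows "(\<Sum>us\<leftarrow>product_lists (map (\<lambda>i. map ((*\<^sub>R) (l i)) (G i)) is). \<bar>detl (acc @ us)\<bar>) =
    (\<Prod>i\<leftarrow>is. l i) * (\<Sum>us\<leftarrow>product_lists (map G is). \<bar>detl (acc @ us)\<bar>)"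
  using assms
proof (induction "is" arbitrary: acc)
  case (Cons i "is")
  have IH: "(\<Sum>us\<leftarrow>product_lists (map (\<lambda>i. map ((*\<^sub>R) (l i)) (G i)) is). \<bar>detl (acc @ x # us)\<bar>) =
     (\<Prod>i\<leftarrow>is. l i) * (\<Sum>us\<leftarrow>product_lists (map G is). \<bar>detl (acc @ x # us)\<bar>)" for x
    using Cons.IH[of "acc @ [x]"] Cons.prems by simp
  have "length acc < CARD('n)" using Cons.prems by simp
  then have "\<bar>detl (acc @ (l i *\<^sub>R x) # us)\<bar> = l i * \<bar>detl (acc @ x # us)\<bar>" for x us
    using Cons.prems by (simp add: detl_scaleR abs_mult)
  then show ?case
    by (simp add: sum_product_lists_Cons IH o_def sum_list_const_mult mult_ac)
qed simp

text \<open>Minkowski's polynomial for zonotopes, read off from the generator formula: dilation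
  scales generators and Minkowski addition concatenates their lists.\<close>

lemma vol_sum_zono:
  fixes G :: "nat \<Rightarrow> (real ^ 'n) list"
  assumes "\<And>i. i < k \<Longrightarrow> 0 \<le> l i"
  shows "vol (\<Sum>i<k. (*\<^sub>R) (l i) ` zono (G i)) =
    (\<Sum>is\<in>index_lists {..<k} CARD('n). zono_mixed (map G is) * (\<Prod>i\<leftarrow>is. l i))"
proof -
  have "(\<Sum>i<k. (*\<^sub>R) (l i) ` zono (G i)) = zono (concat (map (\<lambda>i. map ((*\<^sub>R) (l i)) (G i)) [0..<k]))"
    by (simp add: linear_image_zono linear_scaleR_fun sum_zono_concat)
  then have "fact CARD('n) * vol (\<Sum>i<k. (*\<^sub>R) (l i) ` zono (G i)) =
    (\<Sum>is\<in>index_lists {..<k} CARD('n). \<Sum>us\<leftarrow>product_lists (map (\<lambda>i. map ((*\<^sub>R) (l i)) (G i)) is). \<bar>detl us\<bar>)"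
    by (simp add: vol_zono sum_product_lists_replicate_concat)
  also have "\<dots> = (\<Sum>is\<in>index_lists {..<k} CARD('n). fact CARD('n) * (zono_mixed (map G is) * (\<Prod>i\<leftarrow>is. l i)))"
  proof (intro sum.cong refl)
    fix "is" assume "is \<in> index_lists {..<k} CARD('n)"
    then show "(\<Sum>us\<leftarrow>product_lists (map (\<lambda>i. map ((*\<^sub>R) (l i)) (G i)) is). \<bar>detl us\<bar>) =
        fact CARD('n) * (zono_mixed (map G is) * (\<Prod>i\<leftarrow>is. l i))"
      using sum_detl_scaled[of "[]" "is" l G] assms by (force simp: zono_mixed_def subset_iff)
  qed
  finally show ?thesis by (simp flip: sum_distrib_left)
qed

section \<open>Mixed volumes of zonoids\<close>

text \<open>The polarization formula. It makes sense for any list of bodies before a Minkowski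
  polynomial is known to exist, and involves nothing but volumes of Minkowski sums.\<close>

definition polarized_volume :: "(real ^ 'n) set list \<Rightarrow> real" where
  "polarized_volume Ks =
     (\<Sum>S\<in>Pow {..<CARD('n)}. (-1) ^ (CARD('n) - card S) * vol (\<Sum>i\<in>S. Ks ! i)) / fact CARD('n)"

text \<open>The condition on \<open>c\<close> inside the description of \<open>mixed_volume\<close>,
  named so that existence of coefficients and uniqueness of the value can be treated
  separately.\<close>

definition minkowski_coeffs :: "(real ^ 'n) set list \<Rightarrow> (nat list \<Rightarrow> real) \<Rightarrow> bool" where
  "minkowski_coeffs Ks c \<longleftrightarrow>
     (\<forall>is js. mset is = mset js \<longrightarrow> c is = c js) \<and>
     (\<forall>l. (\<forall>i<CARD('n). 0 \<le> l i) \<longrightarrow>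
        vol (\<Sum>i<CARD('n). (*\<^sub>R) (l i) ` (Ks ! i)) =
        (\<Sum>is\<in>index_lists {..<CARD('n)} CARD('n). c is * (\<Prod>i\<leftarrow>is. l i)))"

text \<open>Inserting a fixed \<open>x\<close> from \<open>U - A\<close> pairs the sets in question
  with opposite signs.\<close>

lemma sum_alternating_supersets:
  fixes A U :: "'a set"
  assumes "finite U" "A \<subset> U"
  shows "(\<Sum>S | A \<subseteq> S \<and> S \<subseteq> U. (-1) ^ (card U - card S)) = (0 :: real)"
proof -
  obtain x where x: "x \<in> U" "x \<notin> A" using assms by blast
  define F where "F = {S. A \<subseteq> S \<and> S \<subseteq> U - {x}}"
  have fin: "finite F" using assms by (auto simp: F_def intro: finite_subset[of _ "Pow U"])
  have "{S. A \<subseteq> S \<and> S \<subseteq> U} = F \<union> insert x ` F"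
  proof (intro equalityI subsetI)
    fix S assume S: "S \<in> {S. A \<subseteq> S \<and> S \<subseteq> U}"
    show "S \<in> F \<union> insert x ` F"
    proof (cases "x \<in> S")
      case True
      then have "S = insert x (S - {x})" "S - {x} \<in> F" using S x by (auto simp: F_def)
      then show ?thesis by blast
    qed (use S in \<open>auto simp: F_def\<close>)
  qed (use x in \<open>auto simp: F_def\<close>)
  moreover have "F \<inter> insert x ` F = {}" "inj_on (insert x) F"
    by (auto simp: F_def inj_on_def)
  ultimately have "(\<Sum>S | A \<subseteq> S \<and> S \<subseteq> U. (-1) ^ (card U - card S)) =
      (\<Sum>S\<in>F. (-1) ^ (card U - card S) + (-1) ^ (card U - card (insert x S)) :: real)"
    using fin by (simp add: sum.union_disjoint sum.reindex sum.distrib)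
  also have "\<dots> = 0"
  proof (intro sum.neutral ballI)
    fix S assume S: "S \<in> F"
    then have "finite S" "x \<notin> S" "S \<subset> U" using assms x by (auto simp: F_def finite_subset)
    then have "card (insert x S) = Suc (card S)" "card S < card U"
      using assms psubset_card_mono by auto
    then have "card U - card S = Suc (card U - card (insert x S))" by simp
    then show "(-1) ^ (card U - card S) + (-1) ^ (card U - card (insert x S)) = (0 :: real)" by simp
  qed
  finally show ?thesis .
qed

lemma prod_list_indicator: "(\<Prod>i\<leftarrow>is. indicat_real S i) = (if set is \<subseteq> S then 1 else 0)"
  by (induction "is") auto

text \<open>Evaluating the polynomial at 0/1 vectors and taking the alternating sum cancels every
  index list that misses an index. The remaining lists are the permutations of all indices, on which
  a symmetric \<open>c\<close> is constant. Bodies must be nonempty because only then does scaling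
  by 0 produce \<open>{0}\<close>.\<close>

lemma minkowski_coeffs_polarization:
  fixes Ks :: "(real ^ 'n) set list"
  assumes c: "minkowski_coeffs Ks c" and ne: "\<And>i. i < CARD('n) \<Longrightarrow> Ks ! i \<noteq> {}"
  shows "c [0..<CARD('n)] = polarized_volume Ks"
proof -
  let ?n = "CARD('n)"
  let ?L = "index_lists {..<?n} ?n"
  have fin: "finite ?L" using finite_lists_length_eq[of "{..<?n}" ?n] by simp
  have p: "vol (\<Sum>i\<in>S. Ks ! i) = (\<Sum>is\<in>?L. if set is \<subseteq> S then c is else 0)" if S: "S \<subseteq> {..<?n}" for S
  proof -
    have "(\<Sum>i<?n. (*\<^sub>R) (indicat_real S i) ` (Ks ! i)) = (\<Sum>i\<in>S. Ks ! i)"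
    proof -
      have "(*\<^sub>R) (indicat_real S i) ` (Ks ! i) = (if i \<in> S then Ks ! i else 0)" if "i \<in> {..<?n}" for i
        using ne[of i] that by (auto simp: set_zero image_constant_conv)
      then have "(\<Sum>i<?n. (*\<^sub>R) (indicat_real S i) ` (Ks ! i)) = (\<Sum>i<?n. if i \<in> S then Ks ! i else 0)"
        by (intro sum.cong) auto
      also have "\<dots> = (\<Sum>i\<in>S. Ks ! i)"
        using S by (intro sum.mono_neutral_cong_right) auto
      finally show ?thesis .
    qed
    then have "vol (\<Sum>i\<in>S. Ks ! i) = (\<Sum>is\<in>?L. c is * (\<Prod>i\<leftarrow>is. indicat_real S i))"
      using c[unfolded minkowski_coeffs_def, THEN conjunct2, rule_format, of "indicat_real S"] by simp
    then show ?thesis by (simp add: prod_list_indicator if_distrib[of "\<lambda>x. c _ * x"] cong: if_cong)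
  qed
  have "fact ?n * polarized_volume Ks =
     (\<Sum>S\<in>Pow {..<?n}. \<Sum>is\<in>?L. (-1) ^ (?n - card S) * (if set is \<subseteq> S then c is else 0))"
    by (simp add: polarized_volume_def p sum_distrib_left flip: sum_divide_distrib)
       (simp add: sum_distrib_left[symmetric])
  also have "\<dots> = (\<Sum>is\<in>?L. \<Sum>S\<in>Pow {..<?n}. (-1) ^ (?n - card S) * (if set is \<subseteq> S then c is else 0))"
    by (rule sum.swap)
  also have "\<dots> = (\<Sum>is\<in>?L. c is * (\<Sum>S | set is \<subseteq> S \<and> S \<subseteq> {..<?n}. (-1) ^ (card {..<?n} - card S)))"
  proof (intro sum.cong refl)
    fix "is" assume "is \<in> ?L"
    have "(\<Sum>S\<in>Pow {..<?n}. (-1) ^ (?n - card S) * (if set is \<subseteq> S then c is else 0)) =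
      (\<Sum>S | set is \<subseteq> S \<and> S \<subseteq> {..<?n}. c is * (-1) ^ (?n - card S))"
      by (intro sum.mono_neutral_cong_right) auto
    then show "(\<Sum>S\<in>Pow {..<?n}. (-1) ^ (?n - card S) * (if set is \<subseteq> S then c is else 0)) =
      c is * (\<Sum>S | set is \<subseteq> S \<and> S \<subseteq> {..<?n}. (-1) ^ (card {..<?n} - card S))"
      by (simp add: sum_distrib_left)
  qed
  also have "\<dots> = (\<Sum>is\<in>permutations_of_set {..<?n}. c [0..<?n])"
  proof (intro sum.mono_neutral_cong_right fin ballI)
    show "permutations_of_set {..<?n} \<subseteq> ?L"
    proof
      fix "is" assume "is \<in> permutations_of_set {..<?n}"
      then have "distinct is" "set is = {..<?n}" by (auto simp: permutations_of_set_def)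
      then show "is \<in> ?L" using distinct_card[of "is"] by simp
    qed
  next
    fix "is" assume "is \<in> ?L - permutations_of_set {..<?n}"
    moreover from this have "set is \<noteq> {..<?n}"
      using card_distinct[of "is"] by (auto simp: permutations_of_set_def)
    ultimately have "set is \<subset> {..<?n}" by blast
    then show "c is * (\<Sum>S | set is \<subseteq> S \<and> S \<subseteq> {..<?n}. (-1) ^ (card {..<?n} - card S)) = 0"
      using sum_alternating_supersets[of "{..<?n}" "set is"] by simp
  next
    fix "is" assume "is \<in> permutations_of_set {..<?n}"
    then have "is": "distinct is" "set is = {..<?n}" by (auto simp: permutations_of_set_def)
    then have "mset is = mset [0..<?n]"
      using set_eq_iff_mset_eq_distinct[of "is" "[0..<?n]"] by (simp add: lessThan_atLeast0)
    then have "c is = c [0..<?n]" using c unfolding minkowski_coeffs_def by blast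
    moreover have "{S. set is \<subseteq> S \<and> S \<subseteq> {..<?n}} = {{..<?n}}" using "is" by auto
    ultimately show "c is * (\<Sum>S | set is \<subseteq> S \<and> S \<subseteq> {..<?n}. (-1) ^ (card {..<?n} - card S)) = c [0..<?n]"
      by simp
  qed
  also have "\<dots> = fact ?n * c [0..<?n]" by simp
  finally show ?thesis by simp
qed

lemma mixed_volume_eq_polarized:
  fixes Ks :: "(real ^ 'n) set list"
  assumes c: "minkowski_coeffs Ks c" and ne: "\<And>i. i < CARD('n) \<Longrightarrow> Ks ! i \<noteq> {}"
  shows "mixed_volume Ks = polarized_volume Ks"
proof -
  have "mixed_volume Ks = (THE v. \<exists>c. minkowski_coeffs Ks c \<and> v = c [0..<CARD('n)])"
    unfolding mixed_volume_def minkowski_coeffs_def by (simp only: conj_assoc)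
  also have "\<dots> = polarized_volume Ks"
  proof (rule the_equality)
    show "\<exists>c. minkowski_coeffs Ks c \<and> polarized_volume Ks = c [0..<CARD('n)]"
      using c minkowski_coeffs_polarization[OF c ne] by (intro exI[of _ c]) simp
  qed (use minkowski_coeffs_polarization ne in blast)
  finally show ?thesis .
qed

section \<open>From zonotopes to zonoids\<close>

text \<open>Moving every segment to start at the origin costs one translation, which volumes do not
  see; the generator list carries all that matters.\<close>

definition translate_of_zono :: "(real ^ 'n) set \<Rightarrow> (real ^ 'n) list \<Rightarrow> bool" where
  "translate_of_zono K ws \<longleftrightarrow> (\<exists>a. K = {a} + zono ws)"

lemma translate_of_zono_zono: "translate_of_zono (zono ws) ws"
  by (auto simp: translate_of_zono_def intro!: exI[of _ 0])

lemma convex_body_translate_of_zono: "translate_of_zono K ws \<Longrightarrow> convex_body K"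
  by (auto simp: translate_of_zono_def convex_body_plus convex_body_singleton convex_body_zono)

lemma closed_segment_eq_translate: "closed_segment a b = {a} + ray_segment (b - a)"
  by (simp add: ray_segment_eq insert_set_plus closed_segment_translation[of a 0 "b - a", symmetric])

lemma zonotope_imp_translate_of_zono:
  assumes "zonotope K"
  shows "\<exists>ws. translate_of_zono K ws"
proof -
  obtain ss where ss: "K = (\<Sum>(a, b)\<leftarrow>ss. closed_segment a b)" using assms by (auto simp: zonotope_def)
  have "\<exists>x ws. (\<Sum>(a, b)\<leftarrow>ss. closed_segment a b) = {x} + zono ws"
  proof (induction ss)
    case Nil
    show ?case by (intro exI[of _ 0] exI[of _ "[]"]) simp
  next
    case (Cons s ss)
    obtain a b where s: "s = (a, b)" by (cases s)
    obtain x ws where x: "(\<Sum>(a, b)\<leftarrow>ss. closed_segment a b) = {x} + zono ws" using Cons.IH by blast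
    have "(\<Sum>(a, b)\<leftarrow>s # ss. closed_segment a b) = ({a} + ray_segment (b - a)) + ({x} + zono ws)"
      by (simp add: s x closed_segment_eq_translate[of a b])
    also have "\<dots> = ({a} + {x}) + zono ((b - a) # ws)" by (simp add: add_ac)
    also have "{a} + {x} = {a + x}" by (simp add: set_plus_def)
    finally show ?case by blast
  qed
  then show ?thesis using ss by (auto simp: translate_of_zono_def)
qed

lemma vol_translate: "vol ({a} + K) = vol K"
  by (simp add: insert_set_plus measure_translation)

text \<open>Translations accumulate in a single vector and drop out of the volume. The value 0 at
  other lengths makes \<open>c\<close> symmetric on all lists, since symmetry of
  \<open>zono_mixed\<close> is available at length n.\<close>

lemma minkowski_coeffs_zono:
  fixes Ks :: "(real ^ 'n) set list" and gens :: "(real ^ 'n) list list"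
  assumes "length gens = CARD('n)" "\<And>i. i < CARD('n) \<Longrightarrow> translate_of_zono (Ks ! i) (gens ! i)"
  shows "minkowski_coeffs Ks (\<lambda>is. if length is = CARD('n) then zono_mixed (map ((!) gens) is) else 0)"
  unfolding minkowski_coeffs_def
proof (intro conjI allI impI)
  fix "is" js :: "nat list" assume m: "mset is = mset js"
  then have "length is = length js" by (rule mset_eq_length)
  moreover have "mset (map ((!) gens) is) = mset (map ((!) gens) js)" using m by (metis mset_map)
  ultimately show "(if length is = CARD('n) then zono_mixed (map ((!) gens) is) else 0) =
      (if length js = CARD('n) then zono_mixed (map ((!) gens) js) else 0)"
    using zono_mixed_mset_cong by (metis length_map)
next
  fix l :: "nat \<Rightarrow> real" assume l: "\<forall>i<CARD('n). 0 \<le> l i"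
  obtain a where a: "\<And>i. i < CARD('n) \<Longrightarrow> Ks ! i = {a i} + zono (gens ! i)"
    using assms(2) unfolding translate_of_zono_def by metis
  have "(\<Sum>i<k. (*\<^sub>R) (l i) ` (Ks ! i)) = {\<Sum>i<k. l i *\<^sub>R a i} + (\<Sum>i<k. (*\<^sub>R) (l i) ` zono (gens ! i))"
    if "k \<le> CARD('n)" for k
    using that
  proof (induction k)
    case (Suc k)
    have "(*\<^sub>R) (l k) ` (Ks ! k) = {l k *\<^sub>R a k} + (*\<^sub>R) (l k) ` zono (gens ! k)"
      using Suc.prems by (simp add: a linear_image_set_plus linear_scaleR_fun)
    moreover have "{x} + {y} = {x + y}" for x y :: "real ^ 'n" by (simp add: set_plus_def)
    ultimately show ?case using Suc by (simp add: add_ac flip: \<open>\<And>x y. {x} + {y} = {x + y}\<close>)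
  qed (simp add: set_plus_def)
  then have "vol (\<Sum>i<CARD('n). (*\<^sub>R) (l i) ` (Ks ! i)) = vol (\<Sum>i<CARD('n). (*\<^sub>R) (l i) ` zono (gens ! i))"
    by (simp add: vol_translate)
  also have "\<dots> = (\<Sum>is\<in>index_lists {..<CARD('n)} CARD('n). zono_mixed (map ((!) gens) is) * (\<Prod>i\<leftarrow>is. l i))"
    using l by (intro vol_sum_zono) auto
  finally show "vol (\<Sum>i<CARD('n). (*\<^sub>R) (l i) ` (Ks ! i)) =
    (\<Sum>is\<in>index_lists {..<CARD('n)} CARD('n).
      (if length is = CARD('n) then zono_mixed (map ((!) gens) is) else 0) * (\<Prod>i\<leftarrow>is. l i))"
    by (auto intro: sum.cong)
qed

lemma polarized_volume_zono:
  fixes Ks :: "(real ^ 'n) set list" and gens :: "(real ^ 'n) list list"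
  assumes "length gens = CARD('n)" "\<And>i. i < CARD('n) \<Longrightarrow> translate_of_zono (Ks ! i) (gens ! i)"
  shows "polarized_volume Ks = zono_mixed gens"
proof -
  have "Ks ! i \<noteq> {}" if "i < CARD('n)" for i
    using convex_body_translate_of_zono[OF assms(2)[OF that]] by (auto simp: convex_body_def)
  from minkowski_coeffs_polarization[OF minkowski_coeffs_zono[OF assms] this]
  have "polarized_volume Ks = zono_mixed (map ((!) gens) [0..<CARD('n)])" by simp
  then show ?thesis using assms(1) map_nth[of gens] by simp
qed

text \<open>Continuity is immediate for a finite combination of volumes, though not for a definite
  description; this is what lets mixed volumes pass from zonotopes to their limits.\<close>

lemma tendsto_polarized_volume:
  fixes Ks :: "(real ^ 'n) set list"
  assumes "\<And>i. i < CARD('n) \<Longrightarrow> hconv (\<lambda>m. Ps m ! i) (Ks ! i)"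
    "\<And>i m. i < CARD('n) \<Longrightarrow> convex_body (Ps m ! i)" "\<And>i. i < CARD('n) \<Longrightarrow> convex_body (Ks ! i)"
  shows "(\<lambda>m. polarized_volume (Ps m)) \<longlonglongrightarrow> polarized_volume Ks"
  unfolding polarized_volume_def
  by (intro tendsto_divide tendsto_const tendsto_sum tendsto_mult vol_hconv hconv_sum convex_body_sum)
     (use assms in \<open>auto simp: subset_iff\<close>)

text \<open>A form of being a zonoid that provides generator lists for the approximants and that
  ellipsoids can be shown to satisfy directly.\<close>

definition zonoidal :: "(real ^ 'n) set \<Rightarrow> bool" where
  "zonoidal K \<longleftrightarrow> convex_body K \<and> (\<exists>P ws. hconv P K \<and> (\<forall>m. translate_of_zono (P m) (ws m)))"

lemma zonoid_imp_zonoidal: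
  assumes "zonoid K"
  shows "zonoidal K"
proof -
  obtain P where P: "\<And>m. zonotope (P m)" "hausdorff_limit P K"
    using assms by (auto simp: zonoid_def)
  then have "\<forall>m. \<exists>ws. translate_of_zono (P m) ws"
    using zonotope_imp_translate_of_zono by blast
  then obtain ws where ws: "\<And>m. translate_of_zono (P m) (ws m)"
    by metis
  then have "hconv P K"
    using P(2) by (intro hausdorff_limit_imp_hconv convex_body_translate_of_zono)
  moreover have "convex_body K"
    using P(2) by (intro hconv_convex_body[OF \<open>hconv P K\<close>] convex_body_translate_of_zono[OF ws])
      (auto simp: hausdorff_limit_def)
  ultimately show ?thesis using ws by (auto simp: zonoidal_def)
qed

text \<open>The coefficients of the approximating zonotopes are polarized volumes, hence converge;
  both symmetry and the polynomial identity survive the limit.\<close>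

lemma minkowski_coeffs_zonoidal:
  fixes Ks :: "(real ^ 'n) set list"
  assumes "length Ks = CARD('n)" "\<And>K. K \<in> set Ks \<Longrightarrow> zonoidal K"
  shows "\<exists>c. minkowski_coeffs Ks c"
proof -
  let ?n = "CARD('n)"
  have z: "zonoidal (Ks ! i)" if "i < ?n" for i using assms that by simp
  then have "\<forall>i. \<exists>P ws. i < ?n \<longrightarrow> hconv P (Ks ! i) \<and> (\<forall>m. translate_of_zono (P m) (ws m))"
    unfolding zonoidal_def by blast
  then obtain P ws where P: "\<And>i. i < ?n \<Longrightarrow> hconv (P i) (Ks ! i)"
    and tz: "\<And>i m. i < ?n \<Longrightarrow> translate_of_zono (P i m) (ws i m)" by metis
  have cb: "convex_body (Ks ! i)" if "i < ?n" for i using z that by (auto simp: zonoidal_def)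
  have cbP: "convex_body (P i m)" if "i < ?n" for i m using convex_body_translate_of_zono[OF tz[OF that]] .
  let ?ok = "\<lambda>is. length is = ?n \<and> set is \<subseteq> {..<?n}"
  define c where "c is = (if ?ok is then polarized_volume (map ((!) Ks) is) else 0)" for "is"
  define cm where "cm m is = zono_mixed (map (\<lambda>i. ws i m) is)" for m "is"
  have lim: "(\<lambda>m. cm m is) \<longlonglongrightarrow> c is" if ok: "?ok is" for "is"
  proof -
    have less: "is ! i < ?n" if "i < ?n" for i
      using ok that nth_mem[of i "is"] by (metis lessThan_iff subsetD)
    have "(\<lambda>m. polarized_volume (map (\<lambda>i. P i m) is)) \<longlonglongrightarrow> polarized_volume (map ((!) Ks) is)"
      using ok less by (intro tendsto_polarized_volume) (auto simp: P cb cbP)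
    moreover have "polarized_volume (map (\<lambda>i. P i m) is) = cm m is" for m
      unfolding cm_def using ok less tz by (intro polarized_volume_zono) auto
    ultimately show ?thesis using ok by (simp add: c_def)
  qed
  have "minkowski_coeffs Ks c"
    unfolding minkowski_coeffs_def
  proof (intro conjI allI impI)
    fix "is" js :: "nat list" assume m: "mset is = mset js"
    have eq: "length is = length js" "set is = set js" using mset_eq_length[OF m] mset_eq_setD[OF m] by simp_all
    show "c is = c js"
    proof (cases "?ok is")
      case True
      then have ok': "?ok js" using eq by auto
      have "cm m is = cm m js" for m
        unfolding cm_def using True \<open>mset is = mset js\<close> by (intro zono_mixed_mset_cong) (auto simp: mset_map)
      then show ?thesis using lim[OF True] lim[OF ok'] LIMSEQ_unique by simp
    qed (use eq in \<open>auto simp: c_def\<close>)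
  next
    fix l :: "nat \<Rightarrow> real" assume l: "\<forall>i<?n. 0 \<le> l i"
    have "(\<lambda>m. vol (\<Sum>i<?n. (*\<^sub>R) (l i) ` (P i m))) \<longlonglongrightarrow> vol (\<Sum>i<?n. (*\<^sub>R) (l i) ` (Ks ! i))"
      by (intro vol_hconv hconv_sum hconv_scaleR convex_body_sum convex_body_scaleR)
         (auto simp: P cb cbP)
    moreover have "vol (\<Sum>i<?n. (*\<^sub>R) (l i) ` (P i m)) =
        (\<Sum>is\<in>index_lists {..<?n} ?n. cm m is * (\<Prod>i\<leftarrow>is. l i))" for m
    proof -
      have "minkowski_coeffs (map (\<lambda>i. P i m) [0..<?n]) (\<lambda>is. if length is = ?n then zono_mixed (map ((!) (map (\<lambda>i. ws i m) [0..<?n])) is) else 0)"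
        using tz by (intro minkowski_coeffs_zono) auto
      then have "vol (\<Sum>i<?n. (*\<^sub>R) (l i) ` (map (\<lambda>i. P i m) [0..<?n] ! i)) =
        (\<Sum>is\<in>index_lists {..<?n} ?n. (if length is = ?n then zono_mixed (map ((!) (map (\<lambda>i. ws i m) [0..<?n])) is) else 0) * (\<Prod>i\<leftarrow>is. l i))"
        using l unfolding minkowski_coeffs_def by blast
      also have "(\<Sum>i<?n. (*\<^sub>R) (l i) ` (map (\<lambda>i. P i m) [0..<?n] ! i)) = (\<Sum>i<?n. (*\<^sub>R) (l i) ` (P i m))"
        by (intro sum.cong) auto
      also have "(\<Sum>is\<in>index_lists {..<?n} ?n. (if length is = ?n then zono_mixed (map ((!) (map (\<lambda>i. ws i m) [0..<?n])) is) else 0) * (\<Prod>i\<leftarrow>is. l i)) =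
         (\<Sum>is\<in>index_lists {..<?n} ?n. cm m is * (\<Prod>i\<leftarrow>is. l i))"
      proof (intro sum.cong refl)
        fix "is" assume "is": "is \<in> index_lists {..<?n} ?n"
        then have eq: "map ((!) (map (\<lambda>i. ws i m) [0..<?n])) is = map (\<lambda>i. ws i m) is" by auto
        then show "(if length is = ?n then zono_mixed (map ((!) (map (\<lambda>i. ws i m) [0..<?n])) is) else 0) * (\<Prod>i\<leftarrow>is. l i) = cm m is * (\<Prod>i\<leftarrow>is. l i)"
          unfolding eq cm_def using "is" by simp
      qed
      finally show ?thesis .
    qed
    moreover have "(\<lambda>m. \<Sum>is\<in>index_lists {..<?n} ?n. cm m is * (\<Prod>i\<leftarrow>is. l i)) \<longlonglongrightarrow>
       (\<Sum>is\<in>index_lists {..<?n} ?n. c is * (\<Prod>i\<leftarrow>is. l i))"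
      by (intro tendsto_sum tendsto_mult tendsto_const lim) auto
    ultimately show "vol (\<Sum>i<?n. (*\<^sub>R) (l i) ` (Ks ! i)) = (\<Sum>is\<in>index_lists {..<?n} ?n. c is * (\<Prod>i\<leftarrow>is. l i))"
      using LIMSEQ_unique by simp
  qed
  then show ?thesis by blast
qed

lemma mixed_volume_zonoidal:
  fixes Ks :: "(real ^ 'n) set list"
  assumes "length Ks = CARD('n)" "\<And>K. K \<in> set Ks \<Longrightarrow> zonoidal K"
  shows "mixed_volume Ks = polarized_volume Ks"
proof -
  obtain c where "minkowski_coeffs Ks c" using minkowski_coeffs_zonoidal[OF assms] by blast
  moreover have "Ks ! i \<noteq> {}" if "i < CARD('n)" for i
    using assms that by (auto simp: zonoidal_def convex_body_def)
  ultimately show ?thesis by (rule mixed_volume_eq_polarized)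
qed

lemma polarized_volume_linear_image:
  fixes Ks :: "(real ^ 'n) set list"
  assumes "linear f" "length Ks = CARD('n)" "\<And>K. K \<in> set Ks \<Longrightarrow> convex_body K"
  shows "polarized_volume (map ((`) f) Ks) = \<bar>det (matrix f)\<bar> * polarized_volume Ks"
proof -
  have "vol (\<Sum>i\<in>S. map ((`) f) Ks ! i) = \<bar>det (matrix f)\<bar> * vol (\<Sum>i\<in>S. Ks ! i)" if "S \<subseteq> {..<CARD('n)}" for S
  proof -
    have "(\<Sum>i\<in>S. map ((`) f) Ks ! i) = (\<Sum>i\<in>S. f ` (Ks ! i))"
      using that assms by (intro sum.cong) auto
    also have "\<dots> = f ` (\<Sum>i\<in>S. Ks ! i)"
      using sum_set_linear[of "(`) f" "\<lambda>i. Ks ! i" S] assms(1) by (simp add: linear_image_set_plus linear_0 o_def)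
    finally have "(\<Sum>i\<in>S. map ((`) f) Ks ! i) = f ` (\<Sum>i\<in>S. Ks ! i)" .
    moreover have "compact (\<Sum>i\<in>S. Ks ! i)"
    proof -
      have "convex_body (\<Sum>i\<in>S. Ks ! i)" using assms that by (intro convex_body_sum) auto
      then show ?thesis by (simp add: convex_body_def)
    qed
    ultimately show ?thesis using vol_linear_image[OF assms(1)] by simp
  qed
  then have "(\<Sum>S\<in>Pow {..<CARD('n)}. (-1) ^ (CARD('n) - card S) * vol (\<Sum>i\<in>S. map ((`) f) Ks ! i)) =
     (\<Sum>S\<in>Pow {..<CARD('n)}. \<bar>det (matrix f)\<bar> * ((-1) ^ (CARD('n) - card S) * vol (\<Sum>i\<in>S. Ks ! i)))"
    by (intro sum.cong) auto
  then show ?thesis by (simp add: polarized_volume_def sum_distrib_left)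
qed

section \<open>The ball as a limit of zonotopes\<close>

lemma vol_orthogonal_image:
  fixes f :: "real ^ 'n \<Rightarrow> real ^ 'n"
  assumes "orthogonal_transformation f" "S \<in> lmeasurable"
  shows "f ` S \<in> lmeasurable" "vol (f ` S) = vol S"
proof -
  have lin: "linear f" using assms by (simp add: orthogonal_transformation_linear)
  have "\<bar>det (matrix f)\<bar> = 1"
    using assms det_orthogonal_matrix orthogonal_transformation_matrix by fastforce
  then have "vol (f ` cbox a b) = 1 * vol (cbox a b)" for a b
    using vol_linear_image[OF lin compact_cbox, of a b] by simp
  from measure_linear_sufficient[OF lin assms(2) this]
  show "f ` S \<in> lmeasurable" "vol (f ` S) = vol S" by auto
qed

text \<open>The data of a Riemann sum over \<open>B\<close>: measurable cells \<open>E j\<close>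
  with reference points \<open>c j\<close>, which may lie outside their cells. The function to be
  summed is \<open>\<bar>x \<bullet> u\<bar>\<close> in the variable \<open>u\<close>.\<close>

definition fine_partition :: "real \<Rightarrow> (real ^ 'n) set \<Rightarrow> nat \<Rightarrow> (nat \<Rightarrow> (real ^ 'n) set) \<Rightarrow> (nat \<Rightarrow> real ^ 'n) \<Rightarrow> bool" where
  "fine_partition e B N E c \<longleftrightarrow> disjoint_family_on E {..<N} \<and> (\<Union>j<N. E j) = B \<and>
     (\<forall>j<N. E j \<in> lmeasurable \<and> (\<forall>u\<in>E j. dist u (c j) \<le> e))"

lemma ex_fine_partition:
  fixes B :: "(real ^ 'n) set"
  assumes "compact B" "e > 0"
  shows "\<exists>N E c. fine_partition e B N E c"
proof -
  obtain K where K: "finite K" "B \<subseteq> (\<Union>x\<in>K. ball x e)"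
    using seq_compact_imp_totally_bounded[of B] assms compact_imp_seq_compact by blast
  obtain xs where xs: "set xs = K" using finite_list K(1) by blast
  define N where "N = length xs"
  define E where "E = disjointed (\<lambda>j. B \<inter> ball (xs ! j) e)"
  have "(\<Union>j<N. E j) = (\<Union>j<N. B \<inter> ball (xs ! j) e)"
    using finite_UN_disjointed_eq[of "\<lambda>j. B \<inter> ball (xs ! j) e" N] by (simp add: E_def atLeast0LessThan)
  also have "\<dots> = B"
    using K(2) xs unfolding N_def by (force simp: in_set_conv_nth)
  finally have un: "(\<Union>j<N. E j) = B" .
  have lm: "E j \<in> lmeasurable" for j
  proof -
    have "B \<inter> ball (xs ! i) e \<in> lmeasurable" for i
      using assms by (intro fmeasurable.Int lmeasurable_compact lmeasurable_ball)
    then show ?thesis unfolding E_def disjointed_def by (intro fmeasurable.Diff fmeasurable.finite_UN) auto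
  qed
  have "dist u (xs ! j) \<le> e" if "u \<in> E j" for u j
    using disjointed_subset[of "\<lambda>j. B \<inter> ball (xs ! j) e" j] that by (auto simp: E_def dist_commute)
  moreover have "disjoint_family_on E {..<N}"
    using disjoint_family_disjointed[of "\<lambda>j. B \<inter> ball (xs ! j) e"]
    unfolding E_def disjoint_family_on_def by blast
  ultimately have "fine_partition e B N E ((!) xs)"
    unfolding fine_partition_def using un lm by blast
  then show ?thesis by blast
qed

lemma vol_fine_partition:
  assumes "fine_partition e B N E c" "A \<in> lmeasurable" "A \<subseteq> B"
  shows "vol A = (\<Sum>j<N. vol (A \<inter> E j))"
proof -
  have lm: "A \<inter> E j \<in> lmeasurable" if "j < N" for j
    using assms that by (auto simp: fine_partition_def intro: fmeasurable.Int)
  have disj: "disjoint_family_on (\<lambda>j. A \<inter> E j) {..<N}"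
    using assms(1) unfolding fine_partition_def disjoint_family_on_def by blast
  have "A = (\<Union>j<N. A \<inter> E j)" using assms by (auto simp: fine_partition_def)
  then have "vol A = vol (\<Union>j<N. A \<inter> E j)" by simp
  also have "\<dots> = (\<Sum>j<N. vol (A \<inter> E j))"
  proof (intro measure_finite_Union disj)
    show "emeasure lebesgue (A \<inter> E j) \<noteq> \<infinity>" if "j \<in> {..<N}" for j
      using fmeasurableD2[OF lm[of j]] that unfolding infinity_ennreal_def by blast
  qed (use lm in \<open>auto dest: fmeasurableD\<close>)
  finally show ?thesis .
qed

lemma abs_inner_diff_le: "\<bar>\<bar>x \<bullet> c\<bar> - \<bar>x \<bullet> d\<bar>\<bar> \<le> norm x * dist c d"
  for x :: "real ^ 'n"
proof -
  have "\<bar>\<bar>x \<bullet> c\<bar> - \<bar>x \<bullet> d\<bar>\<bar> \<le> \<bar>x \<bullet> (c - d)\<bar>" by (simp add: inner_diff_right)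
  also have "\<dots> \<le> norm x * dist c d" by (simp add: dist_norm Cauchy_Schwarz_ineq2)
  finally show ?thesis .
qed

text \<open>Both sums are written over the common refinement. Where two cells meet, their reference
  points are at most \<open>2 * e\<close> apart, and the sum is Lipschitz in the reference
  points.\<close>

lemma fine_partition_sums_close:
  assumes P: "fine_partition e B N E c" and Q: "fine_partition e B N' F d" and B: "B \<in> lmeasurable"
  shows "\<bar>(\<Sum>j<N. vol (E j) * \<bar>x \<bullet> c j\<bar>) - (\<Sum>l<N'. vol (F l) * \<bar>x \<bullet> d l\<bar>)\<bar> \<le> 2 * e * norm x * vol B"
proof -
  have E: "E j \<in> lmeasurable" "E j \<subseteq> B" if "j < N" for j using P that by (auto simp: fine_partition_def)
  have F: "F j \<in> lmeasurable" "F j \<subseteq> B" if "j < N'" for j using Q that by (auto simp: fine_partition_def)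
  have "(\<Sum>j<N. vol (E j) * \<bar>x \<bullet> c j\<bar>) = (\<Sum>j<N. \<Sum>l<N'. vol (E j \<inter> F l) * \<bar>x \<bullet> c j\<bar>)"
    using vol_fine_partition[OF Q E] by (intro sum.cong) (auto simp: sum_distrib_right)
  moreover have "(\<Sum>l<N'. vol (F l) * \<bar>x \<bullet> d l\<bar>) = (\<Sum>l<N'. \<Sum>j<N. vol (F l \<inter> E j) * \<bar>x \<bullet> d l\<bar>)"
    using vol_fine_partition[OF P F] by (intro sum.cong) (auto simp: sum_distrib_right)
  moreover have "\<dots> = (\<Sum>j<N. \<Sum>l<N'. vol (E j \<inter> F l) * \<bar>x \<bullet> d l\<bar>)"
    by (subst sum.swap) (simp add: Int_commute)
  ultimately have "\<bar>(\<Sum>j<N. vol (E j) * \<bar>x \<bullet> c j\<bar>) - (\<Sum>l<N'. vol (F l) * \<bar>x \<bullet> d l\<bar>)\<bar> =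
      \<bar>\<Sum>j<N. \<Sum>l<N'. vol (E j \<inter> F l) * (\<bar>x \<bullet> c j\<bar> - \<bar>x \<bullet> d l\<bar>)\<bar>"
    by (simp add: sum_subtractf right_diff_distrib)
  also have "\<dots> \<le> (\<Sum>j<N. \<Sum>l<N'. \<bar>vol (E j \<inter> F l) * (\<bar>x \<bullet> c j\<bar> - \<bar>x \<bullet> d l\<bar>)\<bar>)"
    by (intro order_trans[OF sum_abs] sum_mono sum_abs)
  also have "\<dots> \<le> (\<Sum>j<N. \<Sum>l<N'. vol (E j \<inter> F l) * (norm x * (2 * e)))"
  proof (intro sum_mono)
    fix j l assume jl: "j \<in> {..<N}" "l \<in> {..<N'}"
    show "\<bar>vol (E j \<inter> F l) * (\<bar>x \<bullet> c j\<bar> - \<bar>x \<bullet> d l\<bar>)\<bar> \<le> vol (E j \<inter> F l) * (norm x * (2 * e))"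
    proof (cases "E j \<inter> F l = {}")
      case False
      then obtain u where u: "u \<in> E j" "u \<in> F l" by blast
      then have "dist (c j) (d l) \<le> 2 * e"
        using P Q jl dist_triangle2[of "c j" "d l" u] unfolding fine_partition_def
        by (force simp: dist_commute)
      then have "\<bar>\<bar>x \<bullet> c j\<bar> - \<bar>x \<bullet> d l\<bar>\<bar> \<le> norm x * (2 * e)"
        using abs_inner_diff_le[of x "c j" "d l"] by (meson mult_left_mono norm_ge_zero order_trans)
      then show ?thesis by (simp add: abs_mult mult_left_mono)
    qed simp
  qed
  also have "\<dots> = (norm x * (2 * e)) * (\<Sum>j<N. vol (E j))"
    using vol_fine_partition[OF Q E] by (simp add: sum_distrib_right sum_distrib_left mult.commute)
  also have "(\<Sum>j<N. vol (E j)) = vol B"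
  proof -
    have "B \<inter> E j = E j" if "j < N" for j using E(2)[OF that] by blast
    then show ?thesis using vol_fine_partition[OF P B order_refl] by simp
  qed
  finally show ?thesis by (simp add: mult_ac)
qed

lemma fine_partition_orthogonal_image:
  fixes f :: "real ^ 'n \<Rightarrow> real ^ 'n"
  assumes "fine_partition e B N E c" "orthogonal_transformation f"
  shows "fine_partition e (f ` B) N (\<lambda>j. f ` E j) (\<lambda>j. f (c j))"
proof -
  have inj: "inj f" using assms(2) orthogonal_transformation_inj by blast
  have dist: "dist (f x) (f y) = dist x y" for x y
    using assms(2)
    by (simp add: dist_norm orthogonal_transformation_linear orthogonal_transformation_norm flip: linear_diff)
  show ?thesis
    using assms(1) vol_orthogonal_image(1)[OF assms(2)] inj dist
    unfolding fine_partition_def disjoint_family_on_def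
    by (auto simp: image_Int[OF inj, symmetric])
qed

text \<open>A Riemann sum \<open>S x\<close> for the integral of
  \<open>\<bar>x \<bullet> u\<bar>\<close> over the ball is nearly rotation invariant, because a
  rotated partition is again a fine partition of the ball. Being homogeneous, it is nearly
  \<open>norm x * S e0\<close>, and dividing by \<open>S e0\<close> gives the norm. The integral
  itself is never formed.\<close>

lemma ex_ball_generators:
  assumes "\<delta> > 0"
  shows "\<exists>ws :: (real ^ 'n) list. \<forall>x. \<bar>(\<Sum>w\<leftarrow>ws. \<bar>w \<bullet> x\<bar>) / 2 - norm x\<bar> \<le> \<delta> * norm x"
proof -
  define B :: "(real ^ 'n) set" where "B = cball 0 1"
  define e0 :: "real ^ 'n" where "e0 = axis undefined 1"
  \<comment> \<open>A region of positive volume inside the ball on which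
    \<open>e0 \<bullet> u \<ge> 1/4\<close>; it bounds \<open>S e0\<close> away from 0 independently
    of the partition.\<close>
  define G where "G = ball ((1/2) *\<^sub>R e0) (1/4)"
  have B: "compact B" "B \<in> lmeasurable" by (auto simp: B_def)
  have G: "G \<in> lmeasurable" "G \<subseteq> B" "vol G > 0"
  proof -
    have "norm e0 = 1" by (simp add: e0_def)
    then have "norm u \<le> 1" if "u \<in> G" for u
      using that norm_triangle_ineq[of "u - (1/2) *\<^sub>R e0" "(1/2) *\<^sub>R e0"]
      by (simp add: G_def dist_norm norm_minus_commute)
    then show "G \<subseteq> B" by (auto simp: B_def)
    show "vol G > 0" by (simp add: G_def content_ball_pos)
  qed (simp add: G_def)
  have norm0: "norm e0 = 1" by (simp add: e0_def)
  have GI: "e0 \<bullet> u \<ge> 1/4" if "u \<in> G" for u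
  proof -
    have "(1/2) * (e0 \<bullet> e0) - e0 \<bullet> u \<le> norm e0 * norm ((1/2) *\<^sub>R e0 - u)"
      using norm_cauchy_schwarz[of e0 "(1/2) *\<^sub>R e0 - u"] by (simp add: inner_diff_right)
    also have "\<dots> \<le> 1/4" using that by (simp add: G_def dist_norm norm0)
    finally show ?thesis using norm0 by (simp add: power2_norm_eq_inner[symmetric])
  qed
  \<comment> \<open>The bound \<open>1/8\<close> leaves
    \<open>\<bar>e0 \<bullet> c j\<bar> \<ge> 1/8\<close> on cells meeting \<open>G\<close>, whence
    \<open>S e0 \<ge> vol G / 8\<close>. The other bound makes the rotation error
    \<open>2 * e * vol B\<close> at most \<open>\<delta> * vol G / 8\<close>; adding 1 keeps its
    denominator positive.\<close>
  define e where "e = min (1/8) (\<delta> * vol G / (16 * (vol B + 1)))"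
  have volB: "vol B \<ge> 0" by simp
  have "0 < \<delta> * vol G / (16 * (vol B + 1))" using assms G(3) volB by (intro divide_pos_pos mult_pos_pos) linarith+
  then have e: "e > 0" "e \<le> 1/8" unfolding e_def by (simp_all only: min.cobounded1 min_less_iff_conj) simp
  have e2: "2 * e * vol B \<le> \<delta> * (vol G / 8)"
  proof -
    have "e * (16 * (vol B + 1)) \<le> \<delta> * vol G"
      using volB min.cobounded2[of "1/8" "\<delta> * vol G / (16 * (vol B + 1))"]
      unfolding e_def by (subst (asm) pos_le_divide_eq) (auto intro: add_nonneg_pos)
    moreover have "e * (16 * vol B) \<le> e * (16 * (vol B + 1))" using e by simp
    ultimately show ?thesis by simp
  qed
  obtain N E c where P: "fine_partition e B N E c" using ex_fine_partition[OF B(1) e(1)] by blast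
  define S where "S x = (\<Sum>j<N. vol (E j) * \<bar>x \<bullet> c j\<bar>)" for x
  have S0: "S e0 \<ge> vol G / 8"
  proof -
    have "vol G / 8 = (\<Sum>j<N. vol (G \<inter> E j) * (1/8))"
      using vol_fine_partition[OF P G(1,2)] by (simp add: sum_divide_distrib)
    also have "\<dots> \<le> S e0"
      unfolding S_def
    proof (intro sum_mono)
      fix j assume j: "j \<in> {..<N}"
      show "vol (G \<inter> E j) * (1/8) \<le> vol (E j) * \<bar>e0 \<bullet> c j\<bar>"
      proof (cases "G \<inter> E j = {}")
        case False
        then obtain u where u: "u \<in> G" "u \<in> E j" by blast
        have "dist u (c j) \<le> e" using P u j by (auto simp: fine_partition_def)
        then have "\<bar>e0 \<bullet> c j\<bar> \<ge> 1/8"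
          using abs_inner_diff_le[of e0 u "c j"] GI[OF u(1)] e norm0 by simp
        moreover have "vol (G \<inter> E j) \<le> vol (E j)"
          using P j G by (intro measure_mono_fmeasurable) (auto simp: fine_partition_def dest: fmeasurableD)
        ultimately show ?thesis by (intro mult_mono) auto
      qed simp
    qed
    finally show ?thesis .
  qed
  have inv: "\<bar>S (f x) - S x\<bar> \<le> 2 * e * norm x * vol B" if f: "orthogonal_transformation f" for f x
  proof -
    have "f ` B = B" unfolding B_def using image_orthogonal_transformation_cball[OF f, of 0 1] f
      by (simp add: orthogonal_transformation_linear linear_0)
    then have Q: "fine_partition e B N (\<lambda>j. f ` E j) (\<lambda>j. f (c j))"
      using fine_partition_orthogonal_image[OF P f] by simp
    have "(\<Sum>j<N. vol (f ` E j) * \<bar>f x \<bullet> f (c j)\<bar>) = S x"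
      unfolding S_def using P f
      by (intro sum.cong) (auto simp: vol_orthogonal_image fine_partition_def orthogonal_transformation_def)
    moreover have "norm (f x) = norm x" using f by (simp add: orthogonal_transformation_norm)
    ultimately show ?thesis using fine_partition_sums_close[OF P Q B(2), of "f x"] by (simp add: S_def)
  qed
  have close: "\<bar>S x - norm x * S e0\<bar> \<le> \<delta> * norm x * S e0" for x
  proof -
    obtain f where f: "orthogonal_transformation f" "f (norm x *\<^sub>R e0) = x"
      using orthogonal_transformation_exists[of "norm x *\<^sub>R e0" x] norm0 by auto
    have "S (norm x *\<^sub>R e0) = norm x * S e0"
      by (simp add: S_def abs_mult sum_distrib_left mult_ac)
    then have "\<bar>S x - norm x * S e0\<bar> \<le> norm x * (2 * e * vol B)"
      using inv[OF f(1), of "norm x *\<^sub>R e0"] f(2) norm0 by (simp add: mult_ac)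
    also have "\<dots> \<le> norm x * (\<delta> * S e0)"
      using e2 S0 assms by (intro mult_left_mono order_trans[OF e2]) auto
    finally show ?thesis by (simp add: mult_ac)
  qed
  \<comment> \<open>The factor 2 compensates the half in the statement, which is the form of the
    support function of a centred zonotope.\<close>
  define ws where "ws = map (\<lambda>j. (2 * vol (E j) / S e0) *\<^sub>R c j) [0..<N]"
  have pos: "S e0 > 0" using S0 G by linarith
  have "(\<Sum>w\<leftarrow>ws. \<bar>w \<bullet> x\<bar>) / 2 = S x / S e0" for x
  proof -
    have "(\<Sum>w\<leftarrow>ws. \<bar>w \<bullet> x\<bar>) = (\<Sum>j<N. 2 * (vol (E j) * \<bar>x \<bullet> c j\<bar>) / S e0)"
      using pos by (simp add: ws_def o_def interv_sum_list_conv_sum_set_nat atLeast0LessThan abs_mult inner_commute mult.assoc)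
    then show ?thesis by (simp add: S_def sum_divide_distrib sum_distrib_left)
  qed
  moreover have "\<bar>S x / S e0 - norm x\<bar> \<le> \<delta> * norm x" for x
  proof -
    have "\<bar>S x / S e0 - norm x\<bar> = \<bar>S x - norm x * S e0\<bar> / S e0"
    proof -
      have "S x / S e0 - norm x = (S x - norm x * S e0) / S e0"
        using pos by (simp add: diff_divide_distrib)
      then show ?thesis using pos by simp
    qed
    also have "\<dots> \<le> \<delta> * norm x" using close[of x] pos by (simp add: pos_divide_le_eq)
    finally show ?thesis .
  qed
  ultimately show ?thesis by (intro exI[of _ ws]) simp
qed

definition ball_gens :: "nat \<Rightarrow> (real ^ 'n) list" where
  "ball_gens m = (SOME ws. \<forall>x. \<bar>(\<Sum>w\<leftarrow>ws. \<bar>w \<bullet> x\<bar>) / 2 - norm x\<bar> \<le> 1 / real (Suc m) * norm x)"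

lemma ball_gens_close:
  "\<bar>(\<Sum>w\<leftarrow>ball_gens m. \<bar>w \<bullet> x\<bar>) / 2 - norm x\<bar> \<le> 1 / real (Suc m) * norm x"
proof -
  have "\<forall>x. \<bar>(\<Sum>w\<leftarrow>ball_gens m. \<bar>w \<bullet> x\<bar>) / 2 - norm x\<bar> \<le> 1 / real (Suc m) * norm x"
    unfolding ball_gens_def by (rule someI_ex, rule ex_ball_generators) simp
  then show ?thesis by blast
qed

text \<open>Shifting by half the sum of the generators centres the zonotope at the origin, so its
  support function is half the sum of the \<open>\<bar>w \<bullet> x\<bar>\<close>.\<close>

definition ball_zono :: "nat \<Rightarrow> (real ^ 'n) set" where
  "ball_zono m = {- (1/2) *\<^sub>R sum_list (ball_gens m)} + zono (ball_gens m)"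

lemma translate_of_zono_ball_zono: "translate_of_zono (ball_zono m) (ball_gens m)"
  by (auto simp: translate_of_zono_def ball_zono_def)

lemma support_function_ray_segment: "support_function (ray_segment w) x = max 0 (x \<bullet> w)"
proof -
  obtain y where y: "y \<in> ray_segment w" "support_function (ray_segment w) x = x \<bullet> y"
    using support_function_attained[of "ray_segment w" x] convex_body_ray_segment[of w] by (auto simp: convex_body_def)
  then obtain u where u: "y = u *\<^sub>R w" "0 \<le> u" "u \<le> 1"
    unfolding ray_segment_def by (elim imageE) (rule that, auto)
  have "u * (x \<bullet> w) \<le> max 0 (x \<bullet> w)"
    using u mult_left_le_one_le[of "x \<bullet> w" u] mult_nonneg_nonpos[of u "x \<bullet> w"] by (auto simp: max_def)
  moreover have "0 *\<^sub>R w \<in> ray_segment w" "1 *\<^sub>R w \<in> ray_segment w" unfolding ray_segment_def by (intro imageI; simp)+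
  then have "x \<bullet> 0 \<le> support_function (ray_segment w) x" "x \<bullet> w \<le> support_function (ray_segment w) x"
    using convex_body_ray_segment[of w] inner_le_support_function[of "ray_segment w" 0 x]
      inner_le_support_function[of "ray_segment w" w x] by (simp_all add: convex_body_def)
  ultimately show ?thesis using y u by simp
qed

lemma support_function_zono: "support_function (zono ws) x = (\<Sum>w\<leftarrow>ws. max 0 (x \<bullet> w))"
proof (induction ws)
  case Nil
  show ?case by (simp add: support_function_def)
next
  case (Cons w ws)
  then show ?case
    using convex_body_ray_segment[of w] convex_body_zono[of ws]
    by (simp add: convex_body_def support_function_plus support_function_ray_segment)
qed

lemma support_function_ball_zono:
  "support_function (ball_zono m) x = (\<Sum>w\<leftarrow>ball_gens m. \<bar>w \<bullet> x\<bar>) / 2"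
proof -
  have "support_function (ball_zono m) x = x \<bullet> (- (1/2) *\<^sub>R sum_list (ball_gens m)) + (\<Sum>w\<leftarrow>ball_gens m. max 0 (x \<bullet> w))"
    unfolding ball_zono_def using convex_body_zono[of "ball_gens m"]
    by (subst support_function_plus) (auto simp: convex_body_def support_function_zono, simp add: support_function_def)
  moreover have "(\<Sum>w\<leftarrow>ws. max 0 (x \<bullet> w)) - (x \<bullet> sum_list ws) / 2 = (\<Sum>w\<leftarrow>ws. \<bar>w \<bullet> x\<bar>) / 2" for ws
    by (induction ws) (auto simp: inner_add_right inner_commute max_def field_simps)
  ultimately show ?thesis by simp
qed

text \<open>Adding \<open>cball 0 e\<close> adds \<open>e * norm x\<close> to a support function, so
  closeness of support functions relative to \<open>norm x\<close> is exactly the pair of required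
  inclusions.\<close>

lemma hconv_ball_zono: "hconv ball_zono (cball (0 :: real ^ 'n) 1)"
  unfolding hconv_def
proof (intro allI impI)
  fix e :: real assume e: "e > 0"
  have "\<forall>\<^sub>F m in sequentially. 1 / real (Suc m) < e"
    using order_tendstoD(2)[OF LIMSEQ_inverse_real_of_nat e] by (simp add: inverse_eq_divide)
  then show "\<forall>\<^sub>F m in sequentially. ball_zono m \<subseteq> cball (0 :: real ^ 'n) 1 + cball 0 e \<and>
      cball (0 :: real ^ 'n) 1 \<subseteq> ball_zono m + cball 0 e"
  proof eventually_elim
    case (elim m)
    have cb: "convex_body (ball_zono m :: (real ^ 'n) set)" by (rule convex_body_translate_of_zono[OF translate_of_zono_ball_zono])
    have close: "\<bar>support_function (ball_zono m) x - norm x\<bar> \<le> e * norm x" for x :: "real ^ 'n"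
      unfolding support_function_ball_zono using ball_gens_close[of x m] elim
      by (meson less_imp_le mult_right_mono norm_ge_zero order_trans)
    show ?case
    proof
      show "ball_zono m \<subseteq> cball (0 :: real ^ 'n) 1 + cball 0 e"
      proof (rule subset_if_support_function_le)
        show "compact (ball_zono m :: (real ^ 'n) set)" using cb by (simp add: convex_body_def)
        show "convex_body (cball (0 :: real ^ 'n) 1 + cball 0 e)"
          using e by (intro convex_body_plus convex_body_cball) auto
        fix x :: "real ^ 'n"
        have "support_function (cball 0 1 + cball 0 e) x = norm x + e * norm x"
          using e by (simp add: support_function_plus support_function_cball)
        then show "support_function (ball_zono m) x \<le> support_function (cball 0 1 + cball 0 e) x"
          using close[of x] by (simp add: abs_le_iff)
      qed
      show "cball (0 :: real ^ 'n) 1 \<subseteq> ball_zono m + cball 0 e"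
      proof (rule subset_if_support_function_le)
        show "convex_body (ball_zono m + cball (0 :: real ^ 'n) e)" using cb e by (intro convex_body_plus convex_body_cball) auto
        fix x :: "real ^ 'n"
        have "support_function (ball_zono m + cball 0 e) x = support_function (ball_zono m) x + e * norm x"
          using cb e by (simp add: support_function_plus convex_body_def support_function_cball)
        then show "support_function (cball 0 1) x \<le> support_function (ball_zono m + cball 0 e) x"
          using close[of x] by (simp add: support_function_cball abs_le_iff)
      qed simp
    qed
  qed
qed

lemma translate_of_zono_linear_image:
  assumes "linear f" "translate_of_zono K ws"
  shows "translate_of_zono (f ` K) (map f ws)"
proof -
  obtain a where "K = {a} + zono ws" using assms(2) by (auto simp: translate_of_zono_def)
  then have "f ` K = {f a} + zono (map f ws)"
    using assms(1) by (simp add: linear_image_set_plus linear_image_zono)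
  then show ?thesis by (auto simp: translate_of_zono_def)
qed

lemma zonoidal_ellipsoid:
  fixes T :: "real ^ 'n ^ 'n"
  shows "zonoidal ((*v) T ` cball 0 1)"
  unfolding zonoidal_def
  by (intro conjI exI[of _ "\<lambda>m. (*v) T ` ball_zono m"] exI[of _ "\<lambda>m. map ((*v) T) (ball_gens m)"] allI
      convex_body_linear_image hconv_linear_image hconv_ball_zono translate_of_zono_linear_image
      translate_of_zono_ball_zono matrix_vector_mul_linear convex_body_cball) simp

lemma zonoidal_cball: "zonoidal (cball (0 :: real ^ 'n) 1)"
  using zonoidal_ellipsoid[of "mat 1"] by simp

section \<open>Mixed volumes of a ball with segments\<close>

lemma
  fixes T :: "real ^ 'n ^ 'n"
  assumes "invertible T"
  shows matrix_inv_right: "T ** matrix_inv T = mat 1" and matrix_inv_left: "matrix_inv T ** T = mat 1"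
  using assms someI_ex[of "\<lambda>T'. T ** T' = mat 1 \<and> T' ** T = mat 1"]
  unfolding invertible_def matrix_inv_def by blast+

section \<open>Gram-Schmidt residuals and determinants\<close>

text \<open>The component of \<open>v\<close> orthogonal to \<open>span S\<close>; its norm is the
  distance of \<open>v\<close> from that span.\<close>

definition ortho_residual :: "real ^ 'n \<Rightarrow> (real ^ 'n) set \<Rightarrow> real ^ 'n" where
  "ortho_residual v S = (SOME z. v - z \<in> span S \<and> (\<forall>y\<in>span S. y \<bullet> z = 0))"

lemma
  shows ortho_residual_span: "v - ortho_residual v S \<in> span S"
    and ortho_residual_orthogonal: "y \<in> span S \<Longrightarrow> y \<bullet> ortho_residual v S = 0"
proof -
  obtain p z where "p \<in> span S" "\<And>w. w \<in> span S \<Longrightarrow> orthogonal z w" "v = p + z"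
    using orthogonal_subspace_decomp_exists[of S v] by blast
  then have "v - z \<in> span S \<and> (\<forall>y\<in>span S. y \<bullet> z = 0)"
    by (simp add: orthogonal_def inner_commute)
  then have "v - ortho_residual v S \<in> span S \<and> (\<forall>y\<in>span S. y \<bullet> ortho_residual v S = 0)"
    unfolding ortho_residual_def by (rule someI)
  then show "v - ortho_residual v S \<in> span S" "y \<in> span S \<Longrightarrow> y \<bullet> ortho_residual v S = 0" by auto
qed

text \<open>Left unnormalised: the norms of the entries are the distances that enter the formula,
  and a vector depending on its predecessors gives a zero entry.\<close>

definition gram_schmidt :: "(real ^ 'n) list \<Rightarrow> (real ^ 'n) list" where
  "gram_schmidt vs = map (\<lambda>i. ortho_residual (vs ! i) (set (take i vs))) [0..<length vs]"

lemma length_gram_schmidt [simp]: "length (gram_schmidt vs) = length vs"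
  by (simp add: gram_schmidt_def)

lemma gram_schmidt_nth: "i < length vs \<Longrightarrow> gram_schmidt vs ! i = ortho_residual (vs ! i) (set (take i vs))"
  by (simp add: gram_schmidt_def)

lemma gram_schmidt_Nil [simp]: "gram_schmidt [] = []"
  by (simp add: gram_schmidt_def)

lemma gram_schmidt_snoc: "gram_schmidt (vs @ [v]) = gram_schmidt vs @ [ortho_residual v (set vs)]"
  by (rule nth_equalityI) (auto simp: gram_schmidt_nth nth_append)

text \<open>Rows are replaced from the last to the first. Each residual differs from its row by a
  combination of earlier rows, which are still the original ones at that moment.\<close>

lemma detl_gram_schmidt:
  fixes acc vs us :: "(real ^ 'n) list"
  assumes "length (acc @ vs @ us) = CARD('n)"
  shows "detl (acc @ gram_schmidt vs @ us) = detl (acc @ vs @ us)"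
  using assms
proof (induction vs arbitrary: us rule: rev_induct)
  case (snoc v vs)
  define z where "z = ortho_residual v (set vs)"
  have "v - z \<in> span (set vs)" unfolding z_def by (rule ortho_residual_span)
  then have "v - z \<in> span (set (acc @ vs) \<union> set us)"
    using span_mono[of "set vs" "set (acc @ vs) \<union> set us"] by auto
  then have "detl ((acc @ vs) @ (z + (v - z)) # us) = detl ((acc @ vs) @ z # us)"
    using snoc.prems by (intro detl_add_span) auto
  then show ?case
    using snoc.IH[of "z # us"] snoc.prems by (simp add: gram_schmidt_snoc z_def)
qed simp

lemma gram_schmidt_orthogonal:
  assumes "i < j" "j < length vs"
  shows "gram_schmidt vs ! i \<bullet> gram_schmidt vs ! j = 0"
proof -
  have "vs ! i - gram_schmidt vs ! i \<in> span (set (take i vs))"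
    using ortho_residual_span[of "vs ! i" "set (take i vs)"] assms by (simp add: gram_schmidt_nth)
  moreover have "span (set (take i vs)) \<subseteq> span (set (take j vs))"
    using assms set_take_subset_set_take[of i j vs] by (intro span_mono) simp
  moreover have "vs ! i \<in> span (set (take j vs))"
    using assms by (intro span_base) (auto simp: in_set_conv_nth intro!: exI[of _ i])
  ultimately have "vs ! i - (vs ! i - gram_schmidt vs ! i) \<in> span (set (take j vs))"
    by (metis span_diff subsetD)
  then have "gram_schmidt vs ! i \<in> span (set (take j vs))" by simp
  from ortho_residual_orthogonal[OF this, of "vs ! j"] show ?thesis
    using assms by (simp add: gram_schmidt_nth[of j])
qed

lemma detl_normalize:
  fixes acc vs :: "(real ^ 'n) list"
  assumes "length (acc @ vs) = CARD('n)"
  shows "detl (acc @ vs) = (\<Prod>v\<leftarrow>vs. norm v) * detl (acc @ map sgn vs)"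
  using assms
proof (induction vs arbitrary: acc)
  case (Cons v vs)
  have "detl (acc @ v # vs) = detl (acc @ (norm v *\<^sub>R sgn v) # vs)"
    by (cases "v = 0") (simp_all add: sgn_div_norm)
  also have "\<dots> = norm v * detl ((acc @ [sgn v]) @ vs)"
    using Cons.prems by (subst detl_scaleR) auto
  also have "\<dots> = norm v * ((\<Prod>v\<leftarrow>vs. norm v) * detl ((acc @ [sgn v]) @ map sgn vs))"
    using Cons.prems by (subst Cons.IH) auto
  finally show ?case by simp
qed simp

lemma tendsto_ellipsoid_zono:
  fixes T :: "real ^ 'n ^ 'n" and Zs :: "(real ^ 'n) set list"
  assumes "length Zs = k" "length gens = k" "k \<le> CARD('n)"
    and Z: "\<And>i. i < k \<Longrightarrow> translate_of_zono (Zs ! i) (gens ! i)"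
  shows "(\<lambda>m. zono_mixed (replicate (CARD('n) - k) (map ((*v) T) (ball_gens m)) @ gens))
    \<longlonglongrightarrow> polarized_volume (replicate (CARD('n) - k) ((*v) T ` cball 0 1) @ Zs)"
proof -
  let ?j = "CARD('n) - k"
  have lin: "linear ((*v) T)" by simp
  define Ps where "Ps m = replicate ?j ((*v) T ` ball_zono m) @ Zs" for m
  have tz: "translate_of_zono (Ps m ! i) ((replicate ?j (map ((*v) T) (ball_gens m)) @ gens) ! i)"
    if "i < CARD('n)" for i m
    unfolding Ps_def using assms that
    by (auto simp: nth_append intro!: translate_of_zono_linear_image[OF lin] translate_of_zono_ball_zono Z)
  have "(\<lambda>m. polarized_volume (Ps m)) \<longlonglongrightarrow> polarized_volume (replicate ?j ((*v) T ` cball 0 1) @ Zs)"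
  proof (rule tendsto_polarized_volume)
    fix i assume i: "i < CARD('n)"
    show "hconv (\<lambda>m. Ps m ! i) ((replicate ?j ((*v) T ` cball 0 1) @ Zs) ! i)"
      unfolding Ps_def using i hconv_const hconv_linear_image[OF lin hconv_ball_zono]
      by (auto simp: nth_append)
    show "convex_body (Ps m ! i)" for m by (rule convex_body_translate_of_zono[OF tz[OF i]])
    show "convex_body ((replicate ?j ((*v) T ` cball 0 1) @ Zs) ! i)"
    proof (cases "i < ?j")
      case True
      then show ?thesis by (simp add: nth_append convex_body_linear_image[OF lin] convex_body_cball)
    next
      case False
      then have "convex_body (Zs ! (i - ?j))"
        using assms i by (intro convex_body_translate_of_zono[OF Z]) auto
      then show ?thesis using False by (simp add: nth_append)
    qed
  qed
  moreover have "polarized_volume (Ps m) = zono_mixed (replicate ?j (map ((*v) T) (ball_gens m)) @ gens)" for m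
    using assms tz by (intro polarized_volume_zono) auto
  ultimately show ?thesis by simp
qed

definition ball_mixed :: "(real ^ 'n) list \<Rightarrow> real" where
  "ball_mixed vs = polarized_volume (replicate (CARD('n) - length vs) (cball 0 1) @ map ray_segment vs)"

lemma tendsto_ball_mixed:
  fixes vs :: "(real ^ 'n) list"
  assumes "length vs \<le> CARD('n)"
  shows "(\<lambda>m. (\<Sum>bs\<leftarrow>product_lists (replicate (CARD('n) - length vs) (ball_gens m)). \<bar>detl (bs @ vs)\<bar>) / fact CARD('n))
    \<longlonglongrightarrow> ball_mixed vs"
proof -
  have "product_lists (map (\<lambda>v. [v]) vs) = [vs]"
    by (induction vs) (simp_all add: product_lists.simps(2))
  moreover have "(*v) (mat 1) = (id :: real ^ 'n \<Rightarrow> _)" by auto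
  ultimately show ?thesis
    using tendsto_ellipsoid_zono[of "map ray_segment vs" "length vs" "map (\<lambda>v. [v]) vs" "mat 1"] assms
      translate_of_zono_zono[of "[_ :: real ^ 'n]"]
    by (simp add: ball_mixed_def zono_mixed_def sum_product_lists_append)
qed

lemma ball_mixed_nonneg: "length vs \<le> CARD('n) \<Longrightarrow> 0 \<le> ball_mixed (vs :: (real ^ 'n) list)"
  by (rule tendsto_lowerbound[OF tendsto_ball_mixed]) (auto intro!: always_eventually sum_list_nonneg divide_nonneg_nonneg)

text \<open>Writing each generator as \<open>T\<close> applied to \<open>matrix_inv T *v v\<close>
  puts \<open>T\<close> into every row, so \<open>det T\<close> factors out of all determinants
  before the limit. The ellipsoid turns into the ball and the generators are pulled back.\<close>

lemma mixed_ellipsoid_zono: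
  fixes T :: "real ^ 'n ^ 'n" and Zs :: "(real ^ 'n) set list"
  assumes k: "length Zs = k" "length gens = k" "k \<le> CARD('n)"
    and Z: "\<And>i. i < k \<Longrightarrow> translate_of_zono (Zs ! i) (gens ! i)" and T: "invertible T"
  shows "polarized_volume (replicate (CARD('n) - k) ((*v) T ` cball 0 1) @ Zs) =
     \<bar>det T\<bar> * (\<Sum>vs\<leftarrow>product_lists gens. ball_mixed (map ((*v) (matrix_inv T)) vs))"
proof (rule LIMSEQ_unique[OF tendsto_ellipsoid_zono[OF k Z]])
  let ?j = "CARD('n) - k"
  have id: "map ((*v) T) (map ((*v) (matrix_inv T)) vs) = vs" for vs
    using T by (simp add: o_def matrix_vector_mul_assoc matrix_inv_right)
  have "zono_mixed (replicate ?j (map ((*v) T) (ball_gens m)) @ gens) =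
     \<bar>det T\<bar> * (\<Sum>vs\<leftarrow>product_lists gens. (\<Sum>bs\<leftarrow>product_lists (replicate (CARD('n) - length (map ((*v) (matrix_inv T)) vs)) (ball_gens m)).
        \<bar>detl (bs @ map ((*v) (matrix_inv T)) vs)\<bar>) / fact CARD('n))" for m
  proof -
    have "(\<Sum>us\<leftarrow>product_lists (replicate ?j (map ((*v) T) (ball_gens m)) @ gens). \<bar>detl us\<bar>) =
       (\<Sum>bs\<leftarrow>product_lists (replicate ?j (ball_gens m)). \<Sum>vs\<leftarrow>product_lists gens. \<bar>detl (map ((*v) T) bs @ vs)\<bar>)"
      unfolding sum_product_lists_append
      using sum_product_lists_map[of "\<lambda>bs. \<Sum>vs\<leftarrow>product_lists gens. \<bar>detl (bs @ vs)\<bar>" "(*v) T" "replicate ?j (ball_gens m)"]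
      by simp
    also have "\<dots> = (\<Sum>bs\<leftarrow>product_lists (replicate ?j (ball_gens m)). \<Sum>vs\<leftarrow>product_lists gens.
       \<bar>det T\<bar> * \<bar>detl (bs @ map ((*v) (matrix_inv T)) vs)\<bar>)"
    proof (intro sum_product_lists_cong)
      fix bs vs :: "(real ^ 'n) list" assume len: "length bs = length (replicate ?j (ball_gens m))" "length vs = length gens"
      have "detl (map ((*v) T) bs @ vs) = detl (map ((*v) T) (bs @ map ((*v) (matrix_inv T)) vs))"
        using id[of vs] by simp
      also have "\<dots> = det T * detl (bs @ map ((*v) (matrix_inv T)) vs)"
        using len k by (intro detl_map) simp
      finally show "\<bar>detl (map ((*v) T) bs @ vs)\<bar> = \<bar>det T\<bar> * \<bar>detl (bs @ map ((*v) (matrix_inv T)) vs)\<bar>"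
        by (simp add: abs_mult)
    qed
    also have "\<dots> = (\<Sum>vs\<leftarrow>product_lists gens. \<Sum>bs\<leftarrow>product_lists (replicate ?j (ball_gens m)).
       \<bar>det T\<bar> * \<bar>detl (bs @ map ((*v) (matrix_inv T)) vs)\<bar>)"
      by (rule sum_list_swap)
    also have "\<dots> = (\<Sum>vs\<leftarrow>product_lists gens. \<Sum>bs\<leftarrow>product_lists (replicate (CARD('n) - length (map ((*v) (matrix_inv T)) vs)) (ball_gens m)).
       \<bar>det T\<bar> * \<bar>detl (bs @ map ((*v) (matrix_inv T)) vs)\<bar>)"
      using k by (intro sum_product_lists_cong) simp
    finally show ?thesis
      by (simp add: zono_mixed_def sum_list_const_mult) (simp add: sum_list_mult_const[symmetric] divide_inverse)
  qed
  moreover have "(\<lambda>m. \<bar>det T\<bar> * (\<Sum>vs\<leftarrow>product_lists gens. (\<Sum>bs\<leftarrow>product_lists (replicate (CARD('n) - length (map ((*v) (matrix_inv T)) vs)) (ball_gens m)).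
        \<bar>detl (bs @ map ((*v) (matrix_inv T)) vs)\<bar>) / fact CARD('n)))
     \<longlonglongrightarrow> \<bar>det T\<bar> * (\<Sum>vs\<leftarrow>product_lists gens. ball_mixed (map ((*v) (matrix_inv T)) vs))"
  proof -
    have sl: "(\<lambda>m. \<Sum>v\<leftarrow>xs. F m v) \<longlonglongrightarrow> (\<Sum>v\<leftarrow>xs. G v)" if "\<And>v. v \<in> set xs \<Longrightarrow> (\<lambda>m. F m v) \<longlonglongrightarrow> G v"
      for xs and F :: "nat \<Rightarrow> (real ^ 'n) list \<Rightarrow> real" and G
      using that by (induction xs) (auto intro!: tendsto_add)
    show ?thesis
      using k in_set_product_lists_length[of _ gens] by (intro tendsto_mult tendsto_const sl tendsto_ball_mixed) auto
  qed
  ultimately show "(\<lambda>m. zono_mixed (replicate ?j (map ((*v) T) (ball_gens m)) @ gens)) \<longlonglongrightarrow>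
     \<bar>det T\<bar> * (\<Sum>vs\<leftarrow>product_lists gens. ball_mixed (map ((*v) (matrix_inv T)) vs))" by simp
qed

text \<open>Row operations and extraction of norms are exact for each approximating determinant sum,
  hence hold in the limit.\<close>

lemma ball_mixed_gram_schmidt:
  fixes vs :: "(real ^ 'n) list"
  assumes "length vs \<le> CARD('n)"
  shows "ball_mixed vs = (\<Prod>v\<leftarrow>gram_schmidt vs. norm v) * ball_mixed (map sgn (gram_schmidt vs))"
proof (rule LIMSEQ_unique[OF tendsto_ball_mixed[OF assms]])
  let ?p = "\<Prod>v\<leftarrow>gram_schmidt vs. norm v"
  have p: "0 \<le> ?p" by (induction "gram_schmidt vs") (auto intro!: prod_list_nonneg)
  have "(\<Sum>bs\<leftarrow>product_lists (replicate (CARD('n) - length vs) (ball_gens m)). \<bar>detl (bs @ vs)\<bar>) =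
     ?p * (\<Sum>bs\<leftarrow>product_lists (replicate (CARD('n) - length vs) (ball_gens m)). \<bar>detl (bs @ map sgn (gram_schmidt vs))\<bar>)" for m
    unfolding sum_list_const_mult[symmetric]
  proof (rule sum_product_lists_cong)
    fix bs :: "(real ^ 'n) list" assume "length bs = length (replicate (CARD('n) - length vs) (ball_gens m))"
    then have len: "length bs + length vs = CARD('n)" using assms by simp
    have "detl (bs @ vs) = detl (bs @ gram_schmidt vs)"
      using detl_gram_schmidt[of bs vs "[]"] len by simp
    also have "\<dots> = ?p * detl (bs @ map sgn (gram_schmidt vs))"
      using len by (intro detl_normalize) simp
    finally show "\<bar>detl (bs @ vs)\<bar> = ?p * \<bar>detl (bs @ map sgn (gram_schmidt vs))\<bar>"
      using p by (simp add: abs_mult)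
  qed
  then show "(\<lambda>m. (\<Sum>bs\<leftarrow>product_lists (replicate (CARD('n) - length vs) (ball_gens m)). \<bar>detl (bs @ vs)\<bar>) / fact CARD('n))
     \<longlonglongrightarrow> ?p * ball_mixed (map sgn (gram_schmidt vs))"
    using tendsto_mult[OF tendsto_const tendsto_ball_mixed[of "map sgn (gram_schmidt vs)"], of ?p] assms by simp
qed

section \<open>Orthonormal lists and rotation invariance\<close>

definition orthonormal :: "(real ^ 'n) list \<Rightarrow> bool" where
  "orthonormal es \<longleftrightarrow> (\<forall>i<length es. \<forall>j<length es. es ! i \<bullet> es ! j = (if i = j then 1 else 0))"

lemma orthonormal_extend:
  fixes es :: "(real ^ 'n) list"
  assumes "orthonormal es" "length es \<le> CARD('n)"
  shows "\<exists>fs. orthonormal (es @ fs) \<and> length (es @ fs) = CARD('n)"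
  using assms
proof (induction "CARD('n) - length es" arbitrary: es)
  case 0
  then show ?case by (intro exI[of _ "[]"]) simp
next
  case (Suc d)
  have "dim (set es) \<le> card (set es)" by (rule dim_le_card') simp
  also have "\<dots> \<le> length es" by (rule card_length)
  also have "\<dots> < DIM(real ^ 'n)" using Suc.hyps(2) by simp
  finally obtain x where x: "x \<noteq> 0" "\<And>y. y \<in> span (set es) \<Longrightarrow> orthogonal x y"
    using orthogonal_to_subspace_exists by blast
  have sx: "sgn x \<bullet> sgn x = 1" using x(1) by (simp add: norm_sgn flip: power2_norm_eq_inner)
  have ex: "es ! i \<bullet> sgn x = 0" if "i < length es" for i
    using x(2)[of "es ! i"] that by (simp add: span_base orthogonal_def inner_commute sgn_div_norm)
  have "orthonormal (es @ [sgn x])"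
    using Suc.prems(1) sx ex unfolding orthonormal_def
    by (auto simp: nth_append inner_commute less_Suc_eq)
  moreover have "d = CARD('n) - length (es @ [sgn x])" "length (es @ [sgn x]) \<le> CARD('n)"
    using Suc.hyps(2) by simp_all
  ultimately obtain fs where "orthonormal ((es @ [sgn x]) @ fs)" "length ((es @ [sgn x]) @ fs) = CARD('n)"
    using Suc.hyps(1)[of "es @ [sgn x]"] by blast
  then show ?case by (intro exI[of _ "sgn x # fs"]) simp
qed

text \<open>After completing both lists to orthonormal bases, \<open>M (es @ fs)\<close> sends the
  vectors of \<open>es\<close> to coordinate vectors and the transpose of
  \<open>M (es' @ fs')\<close> sends these to the vectors of \<open>es'\<close>.\<close>

lemma orthonormal_transitive:
  fixes es es' :: "(real ^ 'n) list"
  assumes "orthonormal es" "orthonormal es'" "length es = length es'" "length es \<le> CARD('n)"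
  shows "\<exists>R. orthogonal_matrix R \<and> map ((*v) R) es = es'"
proof -
  obtain fs where fs: "orthonormal (es @ fs)" "length (es @ fs) = CARD('n)"
    using orthonormal_extend assms by blast
  obtain fs' where fs': "orthonormal (es' @ fs')" "length (es' @ fs') = CARD('n)"
    using orthonormal_extend[OF assms(2)] assms by auto
  define M where "M us = (\<chi> r. us ! row_index (r::'n))" for us :: "(real ^ 'n) list"
  have row: "row r (M us) = us ! row_index r" for r us by (simp add: M_def row_def vec_eq_iff)
  have om: "orthogonal_matrix (M us)" if "orthonormal us" "length us = CARD('n)" for us
    unfolding orthogonal_matrix_orthonormal_rows row norm_eq_1 orthogonal_def
    using that row_index_less[where 'n='n] row_index_eq_iff[where 'n='n]
    by (auto simp: orthonormal_def)
  define R where "R = transpose (M (es' @ fs')) ** M (es @ fs)"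
  have "R *v (es ! i) = es' ! i" if i: "i < length es" for i
  proof -
    have "i < CARD('n)" using i assms by simp
    then obtain s :: 'n where s: "row_index s = i" using ex_row_index by blast
    have "M (es @ fs) *v (es ! i) = axis s 1"
      using fs i s row_index_less[where 'n='n] row_index_eq_iff[of _ s]
      by (auto simp: vec_eq_iff matrix_vector_mul_component M_def axis_def orthonormal_def nth_append_left[symmetric, of i es fs] simp del: nth_append)
    then have "R *v (es ! i) = column s (transpose (M (es' @ fs')))"
      by (simp add: R_def matrix_vector_mul_assoc[symmetric] matrix_vector_mult_basis)
    also have "\<dots> = es' ! i" using i assms s by (simp add: column_transpose row nth_append)
    finally show ?thesis .
  qed
  then have "map ((*v) R) es = es'" using assms by (intro nth_equalityI) auto
  moreover have "orthogonal_matrix R"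
    unfolding R_def using om fs fs' by (intro orthogonal_matrix_mul) (auto simp: orthogonal_matrix_transpose)
  ultimately show ?thesis by blast
qed

lemma ball_mixed_orthogonal:
  fixes vs :: "(real ^ 'n) list"
  assumes "orthogonal_matrix R" "length vs \<le> CARD('n)"
  shows "ball_mixed (map ((*v) R) vs) = ball_mixed vs"
proof -
  have ot: "orthogonal_transformation ((*v) R)" using assms by (simp add: orthogonal_transformation_matrix)
  have lin: "linear ((*v) R)" by simp
  have "(*v) R ` cball 0 1 = cball 0 1"
    using image_orthogonal_transformation_cball[OF ot, of 0 1] by simp
  then have eq: "map ((`) ((*v) R)) (replicate (CARD('n) - length vs) (cball 0 1) @ map ray_segment vs) =
    replicate (CARD('n) - length vs) (cball 0 1) @ map ray_segment (map ((*v) R) vs)"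
    by (simp add: linear_image_ray_segment[OF lin])
  moreover have "polarized_volume (map ((`) ((*v) R)) (replicate (CARD('n) - length vs) (cball 0 1) @ map ray_segment vs)) =
    \<bar>det (matrix ((*v) R))\<bar> * polarized_volume (replicate (CARD('n) - length vs) (cball 0 1) @ map ray_segment vs)"
    using assms by (intro polarized_volume_linear_image lin) (auto simp: convex_body_cball convex_body_ray_segment)
  moreover have "\<bar>det (matrix ((*v) R))\<bar> = 1" using det_orthogonal_matrix[OF assms(1)] by auto
  ultimately show ?thesis unfolding eq by (simp add: ball_mixed_def)
qed

lemma orthonormal_normalized_gram_schmidt:
  assumes "0 \<notin> set (gram_schmidt vs)"
  shows "orthonormal (map sgn (gram_schmidt vs))"
  unfolding orthonormal_def
proof (intro allI impI)
  fix i j assume "i < length (map sgn (gram_schmidt vs))" "j < length (map sgn (gram_schmidt vs))"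
  then have ij: "i < length vs" "j < length vs" by simp_all
  have nz: "gram_schmidt vs ! i \<noteq> 0"
  proof
    assume "gram_schmidt vs ! i = 0"
    moreover have "gram_schmidt vs ! i \<in> set (gram_schmidt vs)" using ij by (intro nth_mem) simp
    ultimately show False using assms by simp
  qed
  have "gram_schmidt vs ! i \<bullet> gram_schmidt vs ! j = 0" if "i \<noteq> j"
    using gram_schmidt_orthogonal[of i j vs] gram_schmidt_orthogonal[of j i vs] that ij
    by (cases "i < j") (auto simp: inner_commute)
  then show "map sgn (gram_schmidt vs) ! i \<bullet> map sgn (gram_schmidt vs) ! j = (if i = j then 1 else 0)"
    using ij nz by (auto simp: sgn_div_norm power2_norm_eq_inner[symmetric] power2_eq_square field_simps)
qed

text \<open>Normalised nonzero residuals are orthonormal, and orthogonal matrices act transitively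
  on orthonormal lists, so \<open>ball_mixed\<close> takes one value on all of them: the constant
  \<open>c\<close>. If some residual is 0, both sides vanish.\<close>

lemma ball_mixed_eq_prod_norm:
  assumes "k \<le> CARD('n)"
  shows "\<exists>c\<ge>0. \<forall>vs :: (real ^ 'n) list. length vs = k \<longrightarrow> ball_mixed vs = c * (\<Prod>v\<leftarrow>gram_schmidt vs. norm v)"
proof (cases "\<exists>es :: (real ^ 'n) list. orthonormal es \<and> length es = k")
  case True
  then obtain es :: "(real ^ 'n) list" where es: "orthonormal es" "length es = k" by blast
  have "ball_mixed vs = ball_mixed es * (\<Prod>v\<leftarrow>gram_schmidt vs. norm v)" if vs: "length vs = k" for vs :: "(real ^ 'n) list"
  proof (cases "0 \<in> set (gram_schmidt vs)")
    case True
    then have "(\<Prod>v\<leftarrow>gram_schmidt vs. norm v) = 0" by (force simp: prod_list_zero_iff)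
    then show ?thesis using ball_mixed_gram_schmidt[of vs] assms vs by simp
  next
    case False
    obtain R where "orthogonal_matrix R" "map ((*v) R) es = map sgn (gram_schmidt vs)"
      using orthonormal_transitive[OF es(1) orthonormal_normalized_gram_schmidt[OF False]] es vs assms by auto
    then have "ball_mixed (map sgn (gram_schmidt vs)) = ball_mixed es"
      using ball_mixed_orthogonal[of R es] es assms by simp
    then show ?thesis using ball_mixed_gram_schmidt[of vs] assms vs by simp
  qed
  then show ?thesis using ball_mixed_nonneg[of es] es assms by blast
next
  case False
  have "ball_mixed vs = 0 * (\<Prod>v\<leftarrow>gram_schmidt vs. norm v)" if vs: "length vs = k" for vs :: "(real ^ 'n) list"
  proof -
    have "0 \<in> set (gram_schmidt vs)" using False orthonormal_normalized_gram_schmidt[of vs] vs by fastforce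
    then have "(\<Prod>v\<leftarrow>gram_schmidt vs. norm v) = 0" by (force simp: prod_list_zero_iff)
    then show ?thesis using ball_mixed_gram_schmidt[of vs] assms vs by simp
  qed
  then show ?thesis by blast
qed

text \<open>The reciprocal squared length of a Gram--Schmidt residual of \<open>T\<^sup>-\<^sup>1 vs\<close> is the minimum of
  \<open>\<bar>T\<^sup>t x\<bar>\<^sup>2\<close> over an affine subspace which does not depend on \<open>T\<close>; this is the source of all
  superadditivity below.\<close>

definition residual_norm :: "real ^ 'n ^ 'n \<Rightarrow> (real ^ 'n) list \<Rightarrow> nat \<Rightarrow> real" where
  "residual_norm T vs i = norm (gram_schmidt (map ((*v) (matrix_inv T)) vs) ! i)"

lemma inner_transpose: "(transpose T *v x) \<bullet> y = x \<bullet> (T *v y)"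
  for T :: "real ^ 'n ^ 'n"
  by (simp add: dot_lmul_matrix transpose_matrix_vector)

text \<open>The minimiser makes \<open>transpose T *v x\<close> a multiple of the residual
  \<open>z\<close>, namely z/|z|^2. It is orthogonal to the earlier pulled-back vectors and has
  inner product 1 with the \<open>i\<close>-th, and its norm is 1/|z|.\<close>

lemma residual_norm_attained:
  fixes T :: "real ^ 'n ^ 'n"
  assumes T: "invertible T" and i: "i < length vs" and pos: "residual_norm T vs i > 0"
  obtains x where "x \<bullet> vs ! i = 1" "\<And>j. j < i \<Longrightarrow> x \<bullet> vs ! j = 0"
    "norm (transpose T *v x) = 1 / residual_norm T vs i"
proof -
  define us where "us = map ((*v) (matrix_inv T)) vs"
  define z where "z = gram_schmidt us ! i"
  have us: "us ! j = matrix_inv T *v vs ! j" if "j < length vs" for j using that by (simp add: us_def)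
  have z: "z = ortho_residual (us ! i) (set (take i us))" using i by (simp add: z_def us_def gram_schmidt_nth)
  have nz: "norm z = residual_norm T vs i" by (simp add: residual_norm_def z_def us_def)
  define y where "y = z /\<^sub>R (norm z)\<^sup>2"
  define x where "x = transpose (matrix_inv T) *v y"
  have x: "x \<bullet> v = y \<bullet> (matrix_inv T *v v)" for v unfolding x_def by (rule inner_transpose)
  have sp: "p \<bullet> y = 0" if "p \<in> span (set (take i us))" for p
    using ortho_residual_orthogonal[OF that, of "us ! i"] by (simp add: y_def z)
  show ?thesis
  proof
    have "(us ! i - z) \<bullet> y = 0" using ortho_residual_span z sp by metis
    then have "us ! i \<bullet> y = z \<bullet> y" unfolding inner_diff_left by (rule eq_iff_diff_eq_0[THEN iffD2])
    then have "y \<bullet> us ! i = y \<bullet> z" using inner_commute by metis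
    also have "\<dots> = 1" using pos nz by (simp add: y_def power2_norm_eq_inner[symmetric])
    finally show "x \<bullet> vs ! i = 1" using i by (simp add: x us)
    show "x \<bullet> vs ! j = 0" if "j < i" for j
    proof -
      have "us ! j \<in> set (take i us)" using that i by (auto simp: in_set_conv_nth us_def intro!: exI[of _ j])
      then have "us ! j \<bullet> y = 0" by (intro sp span_base)
      then show ?thesis using that i by (simp add: x us inner_commute)
    qed
    have "transpose T *v x = y"
      using T by (simp add: x_def matrix_vector_mul_assoc matrix_transpose_mul[symmetric] matrix_inv_left
          transpose_mat del: transpose_matrix_vector)
    then show "norm (transpose T *v x) = 1 / residual_norm T vs i"
      using pos nz by (simp add: y_def power2_eq_square field_simps)
  qed
qed

text \<open>The constraints say that \<open>y = transpose T *v x\<close> is orthogonal to the span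
  of the earlier pulled-back vectors, so \<open>y \<bullet> z = 1\<close> for the residual
  \<open>z\<close>; Cauchy-Schwarz does the rest.\<close>

lemma residual_norm_minimal:
  fixes T :: "real ^ 'n ^ 'n"
  assumes T: "invertible T" and i: "i < length vs"
    and x: "x \<bullet> vs ! i = 1" "\<And>j. j < i \<Longrightarrow> x \<bullet> vs ! j = 0"
  shows "1 \<le> norm (transpose T *v x) * residual_norm T vs i"
proof -
  define us where "us = map ((*v) (matrix_inv T)) vs"
  define z where "z = gram_schmidt us ! i"
  define y where "y = transpose T *v x"
  have z: "z = ortho_residual (us ! i) (set (take i us))" using i by (simp add: z_def us_def gram_schmidt_nth)
  have y: "y \<bullet> us ! j = x \<bullet> vs ! j" if "j < length vs" for j
    unfolding y_def inner_transpose using that T by (simp add: us_def matrix_vector_mul_assoc matrix_inv_right)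
  have "y \<bullet> p = 0" if "p \<in> span (set (take i us))" for p
    using that
  proof (induction rule: span_induct_alt)
    case (step c v w)
    then obtain j where "j < i" "v = us ! j" by (auto simp: in_set_conv_nth)
    then show ?case using step y x i by (simp add: inner_add_right)
  qed simp
  then have "y \<bullet> (us ! i - z) = 0" using ortho_residual_span z by metis
  then have "y \<bullet> z = 1" using y[OF i] x by (simp add: inner_diff_right)
  then show ?thesis
    using norm_cauchy_schwarz[of y z] by (simp add: y_def z_def us_def residual_norm_def)
qed

section \<open>The inequality for ellipsoids\<close>

text \<open>Weighted AM-GM for 1/X^2 and 1/Y^2, that is, log-convexity of r^(-1/2) together with its
  monotonicity.\<close>

lemma weighted_reciprocal_le:
  fixes s W X Y :: real
  assumes s: "0 < s" "s < 1" and pos: "0 < W" "0 < X" "0 < Y"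
    and le: "s / X\<^sup>2 + (1 - s) / Y\<^sup>2 \<le> 1 / W\<^sup>2"
  shows "W \<le> X powr s * Y powr (1 - s)"
proof -
  have "(1 / X\<^sup>2) powr s * (1 / Y\<^sup>2) powr (1 - s) \<le> s * (1 / X\<^sup>2) + (1 - s) * (1 / Y\<^sup>2)"
    using s pos by (intro Youngs_inequality_0) auto
  also have "\<dots> \<le> 1 / W\<^sup>2" using le by simp
  finally have "(1 / X\<^sup>2) powr s * (1 / Y\<^sup>2) powr (1 - s) \<le> 1 / W\<^sup>2" .
  moreover have "(1 / Z\<^sup>2) powr r = 1 / (Z powr r)\<^sup>2" if "Z > 0" for Z r :: real
    using that by (simp add: powr_divide power2_eq_square powr_mult)
  ultimately have "1 / (X powr s * Y powr (1 - s))\<^sup>2 \<le> 1 / W\<^sup>2"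
    using pos by (simp add: power_mult_distrib)
  then have "W\<^sup>2 \<le> (X powr s * Y powr (1 - s))\<^sup>2"
    using pos by (simp add: divide_simps split: if_splits)
  then show ?thesis by (rule power2_le_imp_le) simp
qed

text \<open>The convexity of the product of the r_i^(-1/2), by two uses of weighted AM-GM: one
  inside each factor, one between the two resulting products.\<close>

lemma weighted_prod_le:
  fixes W X Y :: "nat \<Rightarrow> real"
  assumes s: "0 < s" "s < 1"
    and pos: "\<And>i. i < k \<Longrightarrow> 0 < W i" "\<And>i. i < k \<Longrightarrow> 0 < X i" "\<And>i. i < k \<Longrightarrow> 0 < Y i"
    and le: "\<And>i. i < k \<Longrightarrow> s / (X i)\<^sup>2 + (1 - s) / (Y i)\<^sup>2 \<le> 1 / (W i)\<^sup>2"
  shows "(\<Prod>i<k. W i) \<le> s * (\<Prod>i<k. X i) + (1 - s) * (\<Prod>i<k. Y i)"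
proof -
  have "(\<Prod>i<k. W i) \<le> (\<Prod>i<k. X i powr s * Y i powr (1 - s))"
    using s pos le by (intro prod_mono conjI weighted_reciprocal_le) (auto intro: less_imp_le)
  also have "\<dots> = (\<Prod>i<k. X i) powr s * (\<Prod>i<k. Y i) powr (1 - s)"
    using pos by (simp add: prod.distrib prod_powr_distrib less_imp_le)
  also have "\<dots> \<le> s * (\<Prod>i<k. X i) + (1 - s) * (\<Prod>i<k. Y i)"
    using s pos by (intro Youngs_inequality_0) (auto intro: prod_pos)
  finally show ?thesis .
qed

text \<open>After normalising both sums on the left-hand side to \<open>1\<close>, the claim reduces to convexity of the product of the \<open>1 / \<surd>r\<^sub>i\<close> in \<open>r\<close>.\<close>

lemma reverse_minkowski:
  fixes dW dX dY :: "'a \<Rightarrow> nat \<Rightarrow> real"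
  assumes k: "1 \<le> k"
    and nonneg: "\<And>v i. v \<in> set vs \<Longrightarrow> i < k \<Longrightarrow> 0 \<le> dW v i"
      "\<And>v i. v \<in> set vs \<Longrightarrow> i < k \<Longrightarrow> 0 \<le> dX v i" "\<And>v i. v \<in> set vs \<Longrightarrow> i < k \<Longrightarrow> 0 \<le> dY v i"
    and pos: "\<And>v i. v \<in> set vs \<Longrightarrow> i < k \<Longrightarrow> 0 < dW v i \<Longrightarrow> 0 < dX v i \<and> 0 < dY v i \<and>
      1 / (dX v i)\<^sup>2 + 1 / (dY v i)\<^sup>2 \<le> 1 / (dW v i)\<^sup>2"
    and P: "P = (\<Sum>v\<leftarrow>vs. \<Prod>i<k. dX v i)" "0 < P"
    and Q: "Q = (\<Sum>v\<leftarrow>vs. \<Prod>i<k. dY v i)" "0 < Q"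
    and R: "R = (\<Sum>v\<leftarrow>vs. \<Prod>i<k. dW v i)" "0 < R"
  shows "P powr (- 2 / real k) + Q powr (- 2 / real k) \<le> R powr (- 2 / real k)"
proof -
  define \<alpha> \<beta> where "\<alpha> = P powr (- 2 / real k)" and "\<beta> = Q powr (- 2 / real k)"
  have ab: "0 < \<alpha>" "0 < \<beta>" using P Q by (auto simp: \<alpha>_def \<beta>_def)
  \<comment> \<open>This weight cancels the normalising factors: s/(\<alpha> a^2) = 1/((\<alpha> +
    \<beta>) a^2), and likewise for 1 - s and \<beta>, so the unweighted hypothesis on the
    reciprocals applies.\<close>
  define s where "s = \<alpha> / (\<alpha> + \<beta>)"
  have s: "0 < s" "s < 1" "1 - s = \<beta> / (\<alpha> + \<beta>)" using ab by (auto simp: s_def field_simps)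
  have half: "sqrt x ^ k = x powr (real k / 2)" if "0 < x" for x
  proof -
    have "sqrt x ^ k = sqrt x powr real k" using that by (simp add: powr_realpow)
    also have "\<dots> = x powr (real k / 2)" using that by (simp add: powr_half_sqrt[symmetric] powr_powr)
    finally show ?thesis .
  qed
  have scale: "(\<Prod>i<k. sqrt x * d i) = x powr (real k / 2) * (\<Prod>i<k. d i)" if "0 < x" for x and d :: "nat \<Rightarrow> real"
    using half[OF that] by (simp add: prod.distrib)
  have each: "(\<alpha> + \<beta>) powr (real k / 2) * (\<Prod>i<k. dW v i) \<le>
      s * (\<alpha> powr (real k / 2) * (\<Prod>i<k. dX v i)) + (1 - s) * (\<beta> powr (real k / 2) * (\<Prod>i<k. dY v i))"
    if v: "v \<in> set vs" for v
  \<comment> \<open>A vanishing factor makes the left side 0 while the right side is nonnegative, so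
    the reciprocal bounds are invoked only where all \<open>dW v i\<close> are positive.\<close>
  proof (cases "\<exists>i<k. dW v i = 0")
    case True
    then have z: "(\<Prod>i<k. dW v i) = 0" by (intro prod_zero) auto
    moreover have "0 \<le> (\<Prod>i<k. dX v i)" "0 \<le> (\<Prod>i<k. dY v i)" using nonneg v by (auto intro: prod_nonneg)
    ultimately show ?thesis using s unfolding z by (simp only: mult_zero_right) (intro add_nonneg_nonneg mult_nonneg_nonneg; simp)
  next
    case False
    then have W: "0 < dW v i" if "i < k" for i using nonneg(1)[OF v that] that by force
    have "(\<Prod>i<k. sqrt (\<alpha> + \<beta>) * dW v i) \<le> s * (\<Prod>i<k. sqrt \<alpha> * dX v i) + (1 - s) * (\<Prod>i<k. sqrt \<beta> * dY v i)"
    proof (rule weighted_prod_le)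
      fix i assume i: "i < k"
      note p = pos[OF v i W[OF i]]
      show "0 < sqrt (\<alpha> + \<beta>) * dW v i" "0 < sqrt \<alpha> * dX v i" "0 < sqrt \<beta> * dY v i"
        using ab W[OF i] p by auto
      have "s / (sqrt \<alpha> * dX v i)\<^sup>2 + (1 - s) / (sqrt \<beta> * dY v i)\<^sup>2 =
         (1 / (dX v i)\<^sup>2 + 1 / (dY v i)\<^sup>2) / (\<alpha> + \<beta>)"
      proof -
        have "s / (sqrt \<alpha> * dX v i)\<^sup>2 = 1 / (dX v i)\<^sup>2 / (\<alpha> + \<beta>)"
          using ab p by (simp add: s_def power_mult_distrib)
        moreover have "(1 - s) / (sqrt \<beta> * dY v i)\<^sup>2 = 1 / (dY v i)\<^sup>2 / (\<alpha> + \<beta>)"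
          using ab p by (simp add: s(3) power_mult_distrib)
        ultimately show ?thesis by (simp add: add_divide_distrib)
      qed
      also have "\<dots> \<le> (1 / (dW v i)\<^sup>2) / (\<alpha> + \<beta>)" using p ab by (intro divide_right_mono) auto
      also have "\<dots> = 1 / (sqrt (\<alpha> + \<beta>) * dW v i)\<^sup>2" using ab by (simp add: power_mult_distrib)
      finally show "s / (sqrt \<alpha> * dX v i)\<^sup>2 + (1 - s) / (sqrt \<beta> * dY v i)\<^sup>2 \<le> 1 / (sqrt (\<alpha> + \<beta>) * dW v i)\<^sup>2" .
    qed (use s in auto)
    then show ?thesis using ab by (simp only: scale add_pos_pos)
  qed
  have inv: "(x powr (- 2 / real k)) powr (real k / 2) = 1 / x" if "0 < x" for x
  proof -
    have "- 2 / real k * (real k / 2) = - 1" using k by simp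
    then show ?thesis using that by (simp only: powr_powr powr_neg_one)
  qed
  have "(\<alpha> + \<beta>) powr (real k / 2) * R \<le> s * (\<alpha> powr (real k / 2) * P) + (1 - s) * (\<beta> powr (real k / 2) * Q)"
    unfolding P(1) Q(1) R(1) sum_list_const_mult[symmetric] sum_list_addf[symmetric]
    by (intro sum_list_mono each)
  also have "\<alpha> powr (real k / 2) * P = 1"
    unfolding \<alpha>_def using inv[OF P(2)] P(2) by simp
  also have "\<beta> powr (real k / 2) * Q = 1"
    unfolding \<beta>_def using inv[OF Q(2)] Q(2) by simp
  finally have le: "(\<alpha> + \<beta>) powr (real k / 2) * R \<le> 1" by simp
  have "R \<le> (\<alpha> + \<beta>) powr (- (real k / 2))"
    using le ab by (simp add: powr_minus field_simps)
  then have "((\<alpha> + \<beta>) powr (- (real k / 2))) powr (- 2 / real k) \<le> R powr (- 2 / real k)"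
    using R(2) by (intro powr_mono2') auto
  moreover have "((\<alpha> + \<beta>) powr (- (real k / 2))) powr (- 2 / real k) = \<alpha> + \<beta>"
    using ab k by (simp add: powr_powr)
  ultimately show ?thesis by (simp add: \<alpha>_def \<beta>_def)
qed

section \<open>Volume ratios of ellipsoids relative to zonotopes\<close>

abbreviation ellipsoid :: "real ^ 'n ^ 'n \<Rightarrow> (real ^ 'n) set" where
  "ellipsoid T \<equiv> (*v) T ` cball 0 1"

abbreviation ellipsoid_mixed :: "real ^ 'n ^ 'n \<Rightarrow> (real ^ 'n) set list \<Rightarrow> real" where
  "ellipsoid_mixed T Zs \<equiv> polarized_volume (replicate (CARD('n) - length Zs) (ellipsoid T) @ Zs)"

definition ellipsoid_ratio :: "real ^ 'n ^ 'n \<Rightarrow> (real ^ 'n) set list \<Rightarrow> real" where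
  "ellipsoid_ratio T Zs = (vol (ellipsoid T) / ellipsoid_mixed T Zs) powr (2 / real (length Zs))"

lemma vol_ellipsoid: "vol (ellipsoid T) = \<bar>det T\<bar> * vol (cball (0 :: real ^ 'n) 1)"
  for T :: "real ^ 'n ^ 'n"
  using vol_linear_image[of "(*v) T" "cball 0 1"] by simp

lemma prod_list_map_nth: "(\<Prod>x\<leftarrow>xs. f x) = (\<Prod>i<length xs. f (xs ! i))"
  by (induction xs) (simp_all add: prod.lessThan_Suc_shift del: prod.lessThan_Suc)

lemma residual_norm_nonneg: "0 \<le> residual_norm T vs i"
  by (simp add: residual_norm_def)

text \<open>The constraints of the minimum problem are the same for \<open>S\<close> and
  \<open>W\<close>, so the minimiser for \<open>W\<close> is a competitor for
  \<open>S\<close>.\<close>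

lemma residual_norm_mono:
  fixes S W :: "real ^ 'n ^ 'n"
  assumes "invertible S" "invertible W" "\<And>x. norm (transpose S *v x) \<le> norm (transpose W *v x)"
    and i: "i < length vs"
  shows "residual_norm W vs i \<le> residual_norm S vs i"
proof (cases "residual_norm W vs i = 0")
  case False
  then have pos: "residual_norm W vs i > 0" using residual_norm_nonneg[of W vs i] by simp
  obtain x where x: "x \<bullet> vs ! i = 1" "\<And>j. j < i \<Longrightarrow> x \<bullet> vs ! j = 0"
    "norm (transpose W *v x) = 1 / residual_norm W vs i"
    using residual_norm_attained[OF assms(2) i pos] by blast
  have "1 \<le> norm (transpose S *v x) * residual_norm S vs i"
    using residual_norm_minimal[OF assms(1) i x(1,2)] .
  also have "\<dots> \<le> 1 / residual_norm W vs i * residual_norm S vs i"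
    using assms(3)[of x] x(3) residual_norm_nonneg by (intro mult_right_mono) auto
  finally show ?thesis using pos by (simp add: field_simps)
qed (simp add: residual_norm_nonneg)

text \<open>The minimiser for \<open>W\<close> is a competitor for both \<open>T\<close> and
  \<open>S\<close>; at this point the squared norm splits, and each part is at least the
  corresponding minimum.\<close>

lemma residual_norm_superadditive:
  fixes S T W :: "real ^ 'n ^ 'n"
  assumes inv: "invertible S" "invertible T" "invertible W"
    and sq: "\<And>x. (norm (transpose W *v x))\<^sup>2 = (norm (transpose T *v x))\<^sup>2 + (norm (transpose S *v x))\<^sup>2"
    and i: "i < length vs" and pos: "0 < residual_norm W vs i"
  shows "0 < residual_norm T vs i \<and> 0 < residual_norm S vs i \<and>
    1 / (residual_norm T vs i)\<^sup>2 + 1 / (residual_norm S vs i)\<^sup>2 \<le> 1 / (residual_norm W vs i)\<^sup>2"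
proof -
  obtain x where x: "x \<bullet> vs ! i = 1" "\<And>j. j < i \<Longrightarrow> x \<bullet> vs ! j = 0"
    "norm (transpose W *v x) = 1 / residual_norm W vs i"
    using residual_norm_attained[OF inv(3) i pos] by blast
  have key: "0 < residual_norm T vs i \<and> 1 / (residual_norm T vs i)\<^sup>2 \<le> (norm (transpose T *v x))\<^sup>2"
    if T: "invertible T" for T :: "real ^ 'n ^ 'n"
  proof -
    have le: "1 \<le> norm (transpose T *v x) * residual_norm T vs i"
      using residual_norm_minimal[OF T i x(1,2)] .
    then have "residual_norm T vs i \<noteq> 0" by auto
    then have p: "0 < residual_norm T vs i" using residual_norm_nonneg[of T vs i] by simp
    then have "1 / residual_norm T vs i \<le> norm (transpose T *v x)" using le by (simp add: field_simps)
    then have "(1 / residual_norm T vs i)\<^sup>2 \<le> (norm (transpose T *v x))\<^sup>2"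
      using p by (intro power_mono) auto
    then show ?thesis using p by (simp add: power_divide)
  qed
  show ?thesis
    using key[OF inv(1)] key[OF inv(2)] sq[of x] x(3) by (simp add: power_divide)
qed

lemma det_nz_mono:
  fixes S W :: "real ^ 'n ^ 'n"
  assumes "\<And>x. norm (transpose S *v x) \<le> norm (transpose W *v x)" "det S \<noteq> 0"
  shows "det W \<noteq> 0"
proof -
  have "inj ((*v) (transpose S))"
    using assms(2) det_nz_iff_inj[of "(*v) (transpose S)"] by (simp add: det_transpose)
  then have "x = 0" if "transpose W *v x = 0" for x
    using assms(1)[of x] that by (metis injD matrix_vector_mult_0_right norm_le_zero_iff norm_zero)
  then have "inj ((*v) (transpose W))"
    by (simp add: linear_injective_0)
  then show ?thesis
    using det_nz_iff_inj[of "(*v) (transpose W)"] by (simp add: det_transpose)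
qed

text \<open>One \<open>c\<close> serves all invertible \<open>T\<close>, as it stems from the ball
  alone. This is what allows ratios of different ellipsoids to be compared.\<close>

lemma ellipsoid_mixed_zono:
  fixes Zs :: "(real ^ 'n) set list"
  assumes k: "1 \<le> length Zs" "length gens = length Zs" "length Zs \<le> CARD('n)"
    and Z: "\<And>i. i < length Zs \<Longrightarrow> translate_of_zono (Zs ! i) (gens ! i)"
  obtains c where "0 \<le> c" "\<And>T :: real ^ 'n ^ 'n. det T \<noteq> 0 \<Longrightarrow>
    ellipsoid_mixed T Zs = \<bar>det T\<bar> * (c * (\<Sum>vs\<leftarrow>product_lists gens. \<Prod>i<length Zs. residual_norm T vs i))"
proof -
  obtain c where c: "c \<ge> 0" "\<And>vs :: (real ^ 'n) list. length vs = length Zs \<Longrightarrow> ball_mixed vs = c * (\<Prod>v\<leftarrow>gram_schmidt vs. norm v)"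
    using ball_mixed_eq_prod_norm[OF k(3)] by blast
  show ?thesis
  proof
    show "0 \<le> c" by fact
    fix T :: "real ^ 'n ^ 'n" assume "det T \<noteq> 0"
    then have inv: "invertible T" by (simp add: invertible_det_nz)
    have "(\<Sum>vs\<leftarrow>product_lists gens. ball_mixed (map ((*v) (matrix_inv T)) vs)) =
       (\<Sum>vs\<leftarrow>product_lists gens. c * (\<Prod>i<length Zs. residual_norm T vs i))"
    proof (rule sum_product_lists_cong)
      fix vs :: "(real ^ 'n) list" assume "length vs = length gens"
      then have len: "length vs = length Zs" using k by simp
      have "(\<Prod>v\<leftarrow>gram_schmidt (map ((*v) (matrix_inv T)) vs). norm v) = (\<Prod>i<length Zs. residual_norm T vs i)"
        using len by (simp add: prod_list_map_nth residual_norm_def)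
      then show "ball_mixed (map ((*v) (matrix_inv T)) vs) = c * (\<Prod>i<length Zs. residual_norm T vs i)"
        using c(2)[of "map ((*v) (matrix_inv T)) vs"] len by simp
    qed
    then show "ellipsoid_mixed T Zs = \<bar>det T\<bar> * (c * (\<Sum>vs\<leftarrow>product_lists gens. \<Prod>i<length Zs. residual_norm T vs i))"
      using mixed_ellipsoid_zono[OF refl k(2,3) Z inv] by (simp add: sum_list_const_mult)
  qed
qed

lemma sum_squares_eq_imp_le:
  fixes a b c :: real
  assumes "a\<^sup>2 = b\<^sup>2 + c\<^sup>2" "0 \<le> a"
  shows "b \<le> a" "c \<le> a"
proof -
  have "b\<^sup>2 \<le> a\<^sup>2" "c\<^sup>2 \<le> a\<^sup>2" using assms(1) by simp_all
  then show "b \<le> a" "c \<le> a" using assms(2) power2_le_imp_le by blast+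
qed

text \<open>For invertible matrices the determinant cancels and the ratio is a common constant times
  the power \<open>- 2 / real k\<close> of the residual sum (\<open>k\<close> being the length of
  \<open>Zs\<close>), so \<open>reverse_minkowski\<close> applies. A singular summand contributes
  ratio 0, and what remains is monotonicity in the other summand.\<close>

lemma ellipsoid_ratio_superadditive_zono:
  fixes S T W :: "real ^ 'n ^ 'n"
  assumes k: "1 \<le> length Zs" "length gens = length Zs" "length Zs \<le> CARD('n)"
    and Z: "\<And>i. i < length Zs \<Longrightarrow> translate_of_zono (Zs ! i) (gens ! i)"
    and sq: "\<And>x. (norm (transpose W *v x))\<^sup>2 = (norm (transpose T *v x))\<^sup>2 + (norm (transpose S *v x))\<^sup>2"
    and pos: "0 < ellipsoid_mixed T Zs" "0 < ellipsoid_mixed S Zs" "0 < ellipsoid_mixed W Zs"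
  shows "ellipsoid_ratio T Zs + ellipsoid_ratio S Zs \<le> ellipsoid_ratio W Zs"
proof -
  let ?k = "length Zs"
  obtain c where c: "0 \<le> c" "\<And>T :: real ^ 'n ^ 'n. det T \<noteq> 0 \<Longrightarrow>
    ellipsoid_mixed T Zs = \<bar>det T\<bar> * (c * (\<Sum>vs\<leftarrow>product_lists gens. \<Prod>i<?k. residual_norm T vs i))"
    using ellipsoid_mixed_zono[OF k Z] by blast
  define \<Sigma> where "\<Sigma> T = (\<Sum>vs\<leftarrow>product_lists gens. \<Prod>i<?k. residual_norm T vs i)" for T :: "real ^ 'n ^ 'n"
  define \<omega> where "\<omega> = vol (cball (0 :: real ^ 'n) 1)"
  have ratio: "ellipsoid_ratio T Zs = (\<omega> / c) powr (2 / real ?k) * \<Sigma> T powr (- 2 / real ?k)" and cpos: "0 < c" and Spos: "0 < \<Sigma> T"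
    if "det T \<noteq> 0" "0 < ellipsoid_mixed T Zs" for T :: "real ^ 'n ^ 'n"
  proof -
    have mix: "ellipsoid_mixed T Zs = \<bar>det T\<bar> * (c * \<Sigma> T)" using c(2)[OF that(1)] by (simp add: \<Sigma>_def)
    have "0 \<le> \<Sigma> T" unfolding \<Sigma>_def by (auto intro!: sum_list_nonneg prod_nonneg residual_norm_nonneg)
    then show cs: "0 < c" "0 < \<Sigma> T" using that mix c(1) by (auto simp: zero_less_mult_iff)
    have eq1: "vol (ellipsoid T) / ellipsoid_mixed T Zs = (\<omega> / c) * (1 / \<Sigma> T)"
      unfolding mix vol_ellipsoid \<omega>_def using that by simp
    have eq2: "(1 / \<Sigma> T) powr r = \<Sigma> T powr (- r)" for r
      using cs by (simp add: powr_divide powr_minus_divide)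
    show "ellipsoid_ratio T Zs = (\<omega> / c) powr (2 / real ?k) * \<Sigma> T powr (- 2 / real ?k)"
      unfolding ellipsoid_ratio_def eq1 powr_mult eq2 by simp
  qed
  \<comment> \<open>A flat ellipsoid can have positive mixed volume, so this case is not excluded by
    \<open>pos\<close>; its volume is 0, and so is \<open>0 powr r\<close>.\<close>
  have zero: "ellipsoid_ratio T Zs = 0" if "det T = 0" for T :: "real ^ 'n ^ 'n"
    using that by (simp add: ellipsoid_ratio_def vol_ellipsoid)
  have len: "length vs = ?k" if "vs \<in> set (product_lists gens)" for vs
    using in_set_product_lists_length[OF that] k by simp
  have mono: "ellipsoid_ratio S Zs \<le> ellipsoid_ratio W Zs"
    if S: "det S \<noteq> 0" "0 < ellipsoid_mixed S Zs" and le: "\<And>x. norm (transpose S *v x) \<le> norm (transpose W *v x)"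
    for S :: "real ^ 'n ^ 'n"
  proof -
    have W: "det W \<noteq> 0" using det_nz_mono[OF le S(1)] .
    have "\<Sigma> W \<le> \<Sigma> S"
      unfolding \<Sigma>_def
      using S(1) W le len residual_norm_nonneg
      by (intro sum_list_mono prod_mono conjI residual_norm_mono) (auto simp: invertible_det_nz)
    then have "\<Sigma> S powr (- 2 / real ?k) \<le> \<Sigma> W powr (- 2 / real ?k)"
      using Spos[OF W pos(3)] by (intro powr_mono2') auto
    then show ?thesis unfolding ratio[OF S] ratio[OF W pos(3)] by (intro mult_left_mono) auto
  qed
  have leT: "norm (transpose T *v x) \<le> norm (transpose W *v x)" for x
    using sum_squares_eq_imp_le(1)[OF sq[of x]] by simp
  have leS: "norm (transpose S *v x) \<le> norm (transpose W *v x)" for x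
    using sum_squares_eq_imp_le(2)[OF sq[of x]] by simp
  show ?thesis
  proof (cases "det T = 0 \<or> det S = 0")
    case True
    then show ?thesis
    proof (elim disjE)
      assume "det T = 0"
      then show ?thesis using mono[OF _ pos(2) leS] by (cases "det S = 0") (auto simp: zero, simp add: ellipsoid_ratio_def)
    next
      assume "det S = 0"
      then show ?thesis using mono[OF _ pos(1) leT] by (cases "det T = 0") (auto simp: zero, simp add: ellipsoid_ratio_def)
    qed
  next
    case False
    then have T: "det T \<noteq> 0" and S: "det S \<noteq> 0" by auto
    have W: "det W \<noteq> 0" using det_nz_mono[OF leS S] .
    have "\<Sigma> T powr (- 2 / real ?k) + \<Sigma> S powr (- 2 / real ?k) \<le> \<Sigma> W powr (- 2 / real ?k)"
    proof (rule reverse_minkowski[OF k(1)])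
      fix vs :: "(real ^ 'n) list" and i assume vs: "vs \<in> set (product_lists gens)" "i < ?k" "0 < residual_norm W vs i"
      then show "0 < residual_norm T vs i \<and> 0 < residual_norm S vs i \<and>
          1 / (residual_norm T vs i)\<^sup>2 + 1 / (residual_norm S vs i)\<^sup>2 \<le> 1 / (residual_norm W vs i)\<^sup>2"
        using T S W len by (intro residual_norm_superadditive sq) (auto simp: invertible_det_nz)
    qed (use Spos T S W pos in \<open>auto simp: \<Sigma>_def residual_norm_nonneg\<close>)
    then show ?thesis
      unfolding ratio[OF T pos(1)] ratio[OF S pos(2)] ratio[OF W pos(3)]
      by (simp add: mult_left_mono flip: distrib_left)
  qed
qed

section \<open>Positivity of mixed volumes and passage to zonoids\<close>

text \<open>With the other rows fixed the determinant is a linear functional of the remaining row,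
  hence an inner product with some vector, to which \<open>cmp\<close> applies. Replacing
  \<open>j\<close> slots one after another costs the factor \<open>C ^ j\<close>.\<close>

lemma sum_detl_compare:
  fixes g g' :: "(real ^ 'n) list"
  assumes cmp: "\<And>x. (\<Sum>w\<leftarrow>g. \<bar>w \<bullet> x\<bar>) \<le> C * (\<Sum>w\<leftarrow>g'. \<bar>w \<bullet> x\<bar>)" and "0 \<le> C"
    and "length acc + j + length gens = CARD('n)"
  shows "(\<Sum>us\<leftarrow>product_lists (replicate j g @ gens). \<bar>detl (acc @ us)\<bar>) \<le>
    C ^ j * (\<Sum>us\<leftarrow>product_lists (replicate j g' @ gens). \<bar>detl (acc @ us)\<bar>)"
  using assms(3)
proof (induction j arbitrary: acc)
  case (Suc j)
  let ?L = "product_lists (replicate j g' @ gens)"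
  have "(\<Sum>us\<leftarrow>product_lists (replicate (Suc j) g @ gens). \<bar>detl (acc @ us)\<bar>) =
     (\<Sum>x\<leftarrow>g. \<Sum>us\<leftarrow>product_lists (replicate j g @ gens). \<bar>detl ((acc @ [x]) @ us)\<bar>)"
    by (simp add: sum_product_lists_Cons)
  also have "\<dots> \<le> (\<Sum>x\<leftarrow>g. C ^ j * (\<Sum>us\<leftarrow>?L. \<bar>detl ((acc @ [x]) @ us)\<bar>))"
    using Suc.prems by (intro sum_list_mono Suc.IH) simp
  also have "\<dots> = C ^ j * (\<Sum>us\<leftarrow>?L. \<Sum>x\<leftarrow>g. \<bar>detl (acc @ x # us)\<bar>)"
    by (subst sum_list_swap) (simp add: sum_list_const_mult)
  also have "\<dots> \<le> C ^ j * (\<Sum>us\<leftarrow>?L. C * (\<Sum>x\<leftarrow>g'. \<bar>detl (acc @ x # us)\<bar>))"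
  proof (intro mult_left_mono sum_list_mono)
    fix us
    have lin: "linear (\<lambda>u. detl (acc @ u # us))" using Suc.prems by (intro linear_detl) simp
    define \<nu> where "\<nu> = adjoint (\<lambda>u. detl (acc @ u # us)) 1"
    have "detl (acc @ x # us) = x \<bullet> \<nu>" for x
      unfolding \<nu>_def using adjoint_works[OF lin, of x 1] by (simp only: inner_real_def mult_1_right)
    then show "(\<Sum>x\<leftarrow>g. \<bar>detl (acc @ x # us)\<bar>) \<le> C * (\<Sum>x\<leftarrow>g'. \<bar>detl (acc @ x # us)\<bar>)"
      using cmp by simp
  qed (use \<open>0 \<le> C\<close> in simp)
  also have "\<dots> = C ^ Suc j * (\<Sum>x\<leftarrow>g'. \<Sum>us\<leftarrow>?L. \<bar>detl (acc @ x # us)\<bar>)"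
    by (subst sum_list_swap) (simp add: sum_list_const_mult mult_ac)
  also have "\<dots> = C ^ Suc j * (\<Sum>us\<leftarrow>product_lists (replicate (Suc j) g' @ gens). \<bar>detl (acc @ us)\<bar>)"
    by (simp add: sum_product_lists_Cons)
  finally show ?case .
qed simp

text \<open>For \<open>m \<ge> 1\<close> the relative error of the ball approximation is at most
  1/2, so the approximate norm lies between 1/2 and 3/2 of the norm; the constant 3 is the quotient
  of these bounds.\<close>

lemma ball_gens_compare:
  fixes S W :: "real ^ 'n ^ 'n"
  assumes le: "\<And>x. norm (transpose S *v x) \<le> norm (transpose W *v x)" and m: "1 \<le> m"
  shows "(\<Sum>w\<leftarrow>map ((*v) S) (ball_gens m). \<bar>w \<bullet> x\<bar>) \<le> 3 * (\<Sum>w\<leftarrow>map ((*v) W) (ball_gens m). \<bar>w \<bullet> x\<bar>)"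
proof -
  define h where "h y = (\<Sum>w\<leftarrow>ball_gens m. \<bar>w \<bullet> y\<bar>) / 2" for y :: "real ^ 'n"
  have h: "(\<Sum>w\<leftarrow>map ((*v) T) (ball_gens m). \<bar>w \<bullet> x\<bar>) = 2 * h (transpose T *v x)" for T :: "real ^ 'n ^ 'n"
  proof -
    have "(T *v w) \<bullet> x = w \<bullet> (transpose T *v x)" for w
      using inner_transpose[of T x w] by (simp add: inner_commute)
    then show ?thesis by (simp add: h_def o_def)
  qed
  have close: "\<bar>h y - norm y\<bar> \<le> norm y / 2" for y
  proof -
    have "1 / real (Suc m) \<le> 1 / 2" using m by simp
    then have "1 / real (Suc m) * norm y \<le> 1 / 2 * norm y" by (rule mult_right_mono) simp
    with ball_gens_close[of y m] have "\<bar>h y - norm y\<bar> \<le> 1 / 2 * norm y"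
      unfolding h_def by (rule order_trans)
    then show ?thesis by simp
  qed
  have "h (transpose S *v x) \<le> 3/2 * norm (transpose S *v x)" using close[of "transpose S *v x"] unfolding abs_le_iff by linarith
  also have "\<dots> \<le> 3/2 * norm (transpose W *v x)" using le[of x] by linarith
  also have "\<dots> \<le> 3 * h (transpose W *v x)" using close[of "transpose W *v x"] unfolding abs_le_iff by linarith
  finally show ?thesis unfolding h by linarith
qed

text \<open>A single sequence of zonotope lists works for every \<open>T\<close> at once, so
  inequalities between several ellipsoids can be carried to the same limit.\<close>

lemma zonoidal_approximation:
  fixes Zs :: "(real ^ 'n) set list"
  assumes "\<And>Z. Z \<in> set Zs \<Longrightarrow> zonoidal Z" "length Zs \<le> CARD('n)"
  obtains Ys gens where "\<And>m. length (Ys m) = length Zs" "\<And>m. length (gens m) = length Zs"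
    "\<And>m i. i < length Zs \<Longrightarrow> translate_of_zono (Ys m ! i) (gens m ! i)"
    "\<And>T :: real ^ 'n ^ 'n. (\<lambda>m. ellipsoid_mixed T (Ys m)) \<longlonglongrightarrow> ellipsoid_mixed T Zs"
proof -
  let ?k = "length Zs"
  have "\<forall>i. \<exists>P ws. i < ?k \<longrightarrow> hconv P (Zs ! i) \<and> (\<forall>m. translate_of_zono (P m) (ws m))"
    using assms(1) unfolding zonoidal_def by (meson nth_mem)
  then obtain P ws where P: "\<And>i. i < ?k \<Longrightarrow> hconv (P i) (Zs ! i)"
    and tz: "\<And>i m. i < ?k \<Longrightarrow> translate_of_zono (P i m) (ws i m)" by metis
  define Ys where "Ys m = map (\<lambda>i. P i m) [0..<?k]" for m
  define gens where "gens m = map (\<lambda>i. ws i m) [0..<?k]" for m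
  have Ylen: "length (Ys m) = ?k" for m by (simp add: Ys_def)
  show ?thesis
  proof
    show "length (Ys m) = ?k" "length (gens m) = ?k" for m by (simp_all add: Ys_def gens_def)
    show tY: "translate_of_zono (Ys m ! i) (gens m ! i)" if "i < ?k" for m i
      using tz that by (simp add: Ys_def gens_def)
    fix T :: "real ^ 'n ^ 'n"
    have cbE: "convex_body (ellipsoid T)" using zonoidal_ellipsoid by (auto simp: zonoidal_def)
    show "(\<lambda>m. ellipsoid_mixed T (Ys m)) \<longlonglongrightarrow> ellipsoid_mixed T Zs"
    proof (rule tendsto_polarized_volume)
      fix i assume i: "i < CARD('n)"
      have i': "i - (CARD('n) - ?k) < ?k" if "\<not> i < CARD('n) - ?k" using that i assms(2) by simp
      show "hconv (\<lambda>m. (replicate (CARD('n) - length (Ys m)) (ellipsoid T) @ Ys m) ! i)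
         ((replicate (CARD('n) - ?k) (ellipsoid T) @ Zs) ! i)"
        using P i' by (cases "i < CARD('n) - ?k") (simp_all add: Ylen nth_append hconv_const, simp add: Ys_def)
      show "convex_body ((replicate (CARD('n) - length (Ys m)) (ellipsoid T) @ Ys m) ! i)" for m
        using i' cbE convex_body_translate_of_zono[OF tY]
        by (cases "i < CARD('n) - ?k") (simp_all add: Ylen nth_append)
      show "convex_body ((replicate (CARD('n) - ?k) (ellipsoid T) @ Zs) ! i)"
        using i' cbE assms(1)[OF nth_mem]
        by (cases "i < CARD('n) - ?k") (simp_all add: nth_append zonoidal_def)
    qed
  qed
qed

text \<open>Mixed volumes are monotone without the constant, but only positivity has to be transferred
  from \<open>S\<close> to \<open>W\<close>, and this form survives the approximation of the ball by zonotopes.\<close>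

lemma ellipsoid_mixed_mono_up_to_const:
  fixes S W :: "real ^ 'n ^ 'n"
  assumes le: "\<And>x. norm (transpose S *v x) \<le> norm (transpose W *v x)"
    and Z: "\<And>Z. Z \<in> set Zs \<Longrightarrow> zonoidal Z" "length Zs \<le> CARD('n)"
  shows "ellipsoid_mixed S Zs \<le> 3 ^ (CARD('n) - length Zs) * ellipsoid_mixed W Zs"
proof -
  let ?j = "CARD('n) - length Zs"
  obtain Ys gens where Y: "\<And>m. length (Ys m) = length Zs" "\<And>m. length (gens m) = length Zs"
    "\<And>m i. i < length Zs \<Longrightarrow> translate_of_zono (Ys m ! i) (gens m ! i)"
    "\<And>T :: real ^ 'n ^ 'n. (\<lambda>m. ellipsoid_mixed T (Ys m)) \<longlonglongrightarrow> ellipsoid_mixed T Zs"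
    using zonoidal_approximation[OF Z] by blast
  have "ellipsoid_mixed S (Ys m) \<le> 3 ^ ?j * ellipsoid_mixed W (Ys m)" for m
  \<comment> \<open>Two limits are taken in turn: here the ball approximation is refined with the
    zonotopes \<open>Ys m\<close> held fixed, and \<open>m\<close> grows afterwards.\<close>
  proof (rule tendsto_le[OF sequentially_bot])
    show "(\<lambda>l. zono_mixed (replicate ?j (map ((*v) S) (ball_gens l)) @ gens m)) \<longlonglongrightarrow> ellipsoid_mixed S (Ys m)"
      unfolding Y(1) using Y Z(2) by (intro tendsto_ellipsoid_zono) auto
    show "(\<lambda>l. 3 ^ ?j * zono_mixed (replicate ?j (map ((*v) W) (ball_gens l)) @ gens m)) \<longlonglongrightarrow> 3 ^ ?j * ellipsoid_mixed W (Ys m)"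
      unfolding Y(1) using Y Z(2) by (intro tendsto_mult tendsto_const tendsto_ellipsoid_zono) auto
    show "\<forall>\<^sub>F l in sequentially. zono_mixed (replicate ?j (map ((*v) S) (ball_gens l)) @ gens m) \<le>
        3 ^ ?j * zono_mixed (replicate ?j (map ((*v) W) (ball_gens l)) @ gens m)"
      using eventually_ge_at_top[of 1]
    proof eventually_elim
      case (elim l)
      have "(\<Sum>us\<leftarrow>product_lists (replicate ?j (map ((*v) S) (ball_gens l)) @ gens m). \<bar>detl ([] @ us)\<bar>) \<le>
         3 ^ ?j * (\<Sum>us\<leftarrow>product_lists (replicate ?j (map ((*v) W) (ball_gens l)) @ gens m). \<bar>detl ([] @ us)\<bar>)"
        using ball_gens_compare[OF le elim] Y(2) Z(2) by (intro sum_detl_compare) auto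
      then show ?case by (simp add: zono_mixed_def divide_right_mono)
    qed
  qed
  then show ?thesis
    using Y(4) by (intro LIMSEQ_le[OF Y(4) tendsto_mult[OF tendsto_const Y(4)]]) auto
qed

lemma ellipsoid_mixed_pos_mono:
  fixes S W :: "real ^ 'n ^ 'n"
  assumes "\<And>x. norm (transpose S *v x) \<le> norm (transpose W *v x)"
    and "\<And>Z. Z \<in> set Zs \<Longrightarrow> zonoidal Z" "length Zs \<le> CARD('n)" "0 < ellipsoid_mixed S Zs"
  shows "0 < ellipsoid_mixed W Zs"
proof -
  have "0 < 3 ^ (CARD('n) - length Zs) * ellipsoid_mixed W Zs"
    using ellipsoid_mixed_mono_up_to_const[OF assms(1-3)] assms(4) by linarith
  then show ?thesis by (rule zero_less_mult_pos) simp
qed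

text \<open>A singular \<open>T\<close> makes the base of the power 0, so continuity of
  \<open>powr\<close> is used in the form that asks for an eventually nonnegative base and a
  positive exponent.\<close>

lemma tendsto_ellipsoid_ratio:
  fixes T :: "real ^ 'n ^ 'n"
  assumes "(\<lambda>m. ellipsoid_mixed T (Ys m)) \<longlonglongrightarrow> ellipsoid_mixed T Zs" "0 < ellipsoid_mixed T Zs"
    "\<And>m. length (Ys m) = length Zs" "1 \<le> length Zs"
  shows "(\<lambda>m. ellipsoid_ratio T (Ys m)) \<longlonglongrightarrow> ellipsoid_ratio T Zs"
proof -
  have "(\<lambda>m. vol (ellipsoid T) / ellipsoid_mixed T (Ys m)) \<longlonglongrightarrow> vol (ellipsoid T) / ellipsoid_mixed T Zs"
    using assms by (intro tendsto_divide tendsto_const) auto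
  moreover have "\<forall>\<^sub>F m in sequentially. 0 \<le> vol (ellipsoid T) / ellipsoid_mixed T (Ys m)"
    using order_tendstoD(1)[OF assms(1,2)] by eventually_elim (simp add: divide_nonneg_pos)
  ultimately show ?thesis
    unfolding ellipsoid_ratio_def assms(3) using assms(4) by (intro tendsto_powr' tendsto_const) auto
qed

text \<open>The mixed volume of \<open>W\<close> inherits positivity from that of \<open>T\<close>.
  All three mixed volumes are then eventually positive along the approximation, where the zonotope
  case applies.\<close>

lemma ellipsoid_ratio_superadditive:
  fixes S T W :: "real ^ 'n ^ 'n"
  assumes k: "1 \<le> length Zs" "length Zs \<le> CARD('n)" and Z: "\<And>Z. Z \<in> set Zs \<Longrightarrow> zonoidal Z"
    and sq: "\<And>x. (norm (transpose W *v x))\<^sup>2 = (norm (transpose T *v x))\<^sup>2 + (norm (transpose S *v x))\<^sup>2"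
    and pos: "0 < ellipsoid_mixed T Zs" "0 < ellipsoid_mixed S Zs"
  shows "ellipsoid_ratio T Zs + ellipsoid_ratio S Zs \<le> ellipsoid_ratio W Zs"
proof -
  have "norm (transpose T *v x) \<le> norm (transpose W *v x)" for x
    using sum_squares_eq_imp_le(1)[OF sq[of x]] by simp
  then have posW: "0 < ellipsoid_mixed W Zs"
    using ellipsoid_mixed_pos_mono Z k(2) pos(1) by blast
  obtain Ys gens where Y: "\<And>m. length (Ys m) = length Zs" "\<And>m. length (gens m) = length Zs"
    "\<And>m i. i < length Zs \<Longrightarrow> translate_of_zono (Ys m ! i) (gens m ! i)"
    "\<And>T :: real ^ 'n ^ 'n. (\<lambda>m. ellipsoid_mixed T (Ys m)) \<longlonglongrightarrow> ellipsoid_mixed T Zs"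
    using zonoidal_approximation[OF Z k(2)] by blast
  show ?thesis
  proof (rule tendsto_le[OF sequentially_bot])
    show "(\<lambda>m. ellipsoid_ratio W (Ys m)) \<longlonglongrightarrow> ellipsoid_ratio W Zs"
      using Y posW k by (intro tendsto_ellipsoid_ratio) auto
    show "(\<lambda>m. ellipsoid_ratio T (Ys m) + ellipsoid_ratio S (Ys m)) \<longlonglongrightarrow> ellipsoid_ratio T Zs + ellipsoid_ratio S Zs"
      using Y pos k by (intro tendsto_add tendsto_ellipsoid_ratio) auto
    show "\<forall>\<^sub>F m in sequentially. ellipsoid_ratio T (Ys m) + ellipsoid_ratio S (Ys m) \<le> ellipsoid_ratio W (Ys m)"
      using order_tendstoD(1)[OF Y(4) pos(1)] order_tendstoD(1)[OF Y(4) pos(2)] order_tendstoD(1)[OF Y(4) posW]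
    proof eventually_elim
      case (elim m)
      then show ?case
        using Y(1-3) k by (intro ellipsoid_ratio_superadditive_zono[OF _ _ _ _ sq]) auto
    qed
  qed
qed

section \<open>Ellipsoids and \<open>\<ell>\<^sub>2\<close>-sums\<close>

text \<open>An explicit \<open>U'\<close> with U'^t U' = U^t U + w w^t. If \<open>U\<close> is
  invertible, a suitable rank-one matrix is added; otherwise the range of \<open>U\<close> leaves a
  free orthogonal direction to carry the new term.\<close>

lemma matrix_rank_one_update:
  fixes U :: "real ^ 'n ^ 'n" and w :: "real ^ 'n"
  shows "\<exists>U' :: real ^ 'n ^ 'n. \<forall>x. (norm (U' *v x))\<^sup>2 = (norm (U *v x))\<^sup>2 + (x \<bullet> w)\<^sup>2"
proof (cases "invertible U")
  case True
  define v where "v = transpose (matrix_inv U) *v w"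
  define q where "q = v \<bullet> v"
  \<comment> \<open>Since (U x) . v = x . w, the cross term and the square add (2 \<alpha> +
    \<alpha>^2 q)(x . w)^2, so \<alpha> must solve 2 \<alpha> + \<alpha>^2 q = 1. This form of the
    positive root also covers q = 0.\<close>
  define \<alpha> where "\<alpha> = 1 / (1 + sqrt (1 + q))"
  have q: "0 \<le> q" by (simp add: q_def)
  have \<alpha>: "2 * \<alpha> + \<alpha>\<^sup>2 * q = 1"
  proof -
    define r where "r = sqrt (1 + q)"
    have "0 \<le> r" and r2: "q = r\<^sup>2 - 1" using q by (auto simp: r_def)
    then have "\<alpha> * (1 + r) = 1" unfolding \<alpha>_def r_def[symmetric] by simp
    then have ar: "\<alpha> * r = 1 - \<alpha>" by (simp add: algebra_simps)
    have "\<alpha>\<^sup>2 * q = (\<alpha> * r)\<^sup>2 - \<alpha>\<^sup>2" unfolding r2 by (simp add: power_mult_distrib algebra_simps)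
    then show ?thesis unfolding ar by (simp add: power2_eq_square algebra_simps)
  qed
  define f where "f x = U *v x + (\<alpha> * (x \<bullet> w)) *\<^sub>R v" for x
  have lin: "linear f"
    by (rule linearI) (simp_all add: f_def matrix_vector_right_distrib inner_add_left algebra_simps matrix_vector_mult_scaleR)
  have vU: "(U *v x) \<bullet> v = x \<bullet> w" for x
  proof -
    have "v \<bullet> (U *v x) = w \<bullet> (matrix_inv U *v (U *v x))" unfolding v_def by (rule inner_transpose)
    also have "\<dots> = w \<bullet> x" using True by (simp add: matrix_vector_mul_assoc matrix_inv_left)
    finally show ?thesis by (simp add: inner_commute)
  qed
  have "(norm (f x))\<^sup>2 = (norm (U *v x))\<^sup>2 + (x \<bullet> w)\<^sup>2" for x
  proof -
    have "(norm (f x))\<^sup>2 = (norm (U *v x))\<^sup>2 + 2 * (\<alpha> * (x \<bullet> w)) * ((U *v x) \<bullet> v) + (\<alpha> * (x \<bullet> w))\<^sup>2 * q"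
      unfolding power2_norm_eq_inner f_def q_def
      by (simp add: inner_add_left inner_add_right inner_commute power2_eq_square algebra_simps)
    also have "\<dots> = (norm (U *v x))\<^sup>2 + (2 * \<alpha> + \<alpha>\<^sup>2 * q) * (x \<bullet> w)\<^sup>2"
      unfolding vU by (simp add: power2_eq_square algebra_simps)
    finally show ?thesis unfolding \<alpha> by simp
  qed
  moreover have "matrix f *v x = f x" for x using lin by (metis matrix_vector_mul(2))
  ultimately show ?thesis by (intro exI[of _ "matrix f"]) simp
next
  case False
  then have "det (transpose U) = 0" by (simp add: invertible_det_nz det_transpose)
  then have "\<not> inj ((*v) (transpose U))"
    using det_nz_iff_inj[of "(*v) (transpose U)"] by simp
  then obtain z where z: "z \<noteq> 0" "transpose U *v z = 0"
    using linear_injective_0[of "(*v) (transpose U)"] by auto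
  \<comment> \<open>A unit vector orthogonal to the range of \<open>U\<close>, so that no cross term
    arises.\<close>
  define e where "e = sgn z"
  have e: "norm e = 1" "transpose U *v e = 0"
    using z by (auto simp: e_def norm_sgn sgn_div_norm matrix_vector_mult_scaleR)
  define f where "f x = U *v x + (x \<bullet> w) *\<^sub>R e" for x
  have lin: "linear f"
    by (rule linearI) (simp_all add: f_def matrix_vector_right_distrib inner_add_left algebra_simps matrix_vector_mult_scaleR)
  have "(norm (f x))\<^sup>2 = (norm (U *v x))\<^sup>2 + (x \<bullet> w)\<^sup>2" for x
  proof -
    have "e \<bullet> (U *v x) = 0" using inner_transpose[of U e x] e(2) by simp
    moreover have "e \<bullet> e = 1" using e(1) by (simp add: norm_eq_1)
    ultimately show ?thesis
      unfolding power2_norm_eq_inner f_def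
      by (simp add: inner_add_left inner_add_right inner_commute power2_eq_square)
  qed
  moreover have "matrix f *v x = f x" for x using lin by (metis matrix_vector_mul(2))
  ultimately show ?thesis by (intro exI[of _ "matrix f"]) simp
qed

text \<open>The squared norm of \<open>transpose S *v x\<close> is the sum of the squared inner
  products of \<open>x\<close> with the columns of \<open>S\<close>, so one rank-one update per
  column suffices.\<close>

lemma ex_sum_matrix:
  fixes S T :: "real ^ 'n ^ 'n"
  shows "\<exists>W :: real ^ 'n ^ 'n. \<forall>x. (norm (transpose W *v x))\<^sup>2 = (norm (transpose T *v x))\<^sup>2 + (norm (transpose S *v x))\<^sup>2"
proof -
  have "\<exists>U :: real ^ 'n ^ 'n. \<forall>x. (norm (U *v x))\<^sup>2 = (norm (transpose T *v x))\<^sup>2 + (\<Sum>i\<in>I. (x \<bullet> column i S)\<^sup>2)"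
    if "finite I" for I
    using that
  proof (induction I rule: finite_induct)
    case empty
    show ?case by (intro exI[of _ "transpose T"]) simp
  next
    case (insert i I)
    then obtain U :: "real ^ 'n ^ 'n" where U: "\<And>x. (norm (U *v x))\<^sup>2 = (norm (transpose T *v x))\<^sup>2 + (\<Sum>i\<in>I. (x \<bullet> column i S)\<^sup>2)"
      by blast
    obtain U' :: "real ^ 'n ^ 'n" where "\<And>x. (norm (U' *v x))\<^sup>2 = (norm (U *v x))\<^sup>2 + (x \<bullet> column i S)\<^sup>2"
      using matrix_rank_one_update by blast
    then show ?case using U insert.hyps by (intro exI[of _ U']) simp
  qed
  from this[OF finite[of UNIV]] obtain U :: "real ^ 'n ^ 'n"
    where U: "\<And>x. (norm (U *v x))\<^sup>2 = (norm (transpose T *v x))\<^sup>2 + (\<Sum>i\<in>UNIV. (x \<bullet> column i S)\<^sup>2)"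
    by blast
  have "(norm (transpose S *v x))\<^sup>2 = (\<Sum>i\<in>UNIV. (x \<bullet> column i S)\<^sup>2)" for x
  proof -
    have "(transpose S *v x) $ i = x \<bullet> column i S" for i
      by (simp add: matrix_vector_mul_component row_transpose[symmetric] inner_commute row_def column_def transpose_def del: transpose_matrix_vector)
    then show ?thesis
      unfolding power2_norm_eq_inner inner_vec_def[of "transpose S *v x"] inner_real_def
      by (simp only: power2_eq_square)
  qed
  then show ?thesis using U by (intro exI[of _ "transpose U"]) (simp del: transpose_matrix_vector)
qed

lemma convex_body_ellipsoid: "convex_body (ellipsoid T)"
  using zonoidal_ellipsoid by (auto simp: zonoidal_def)

lemma ellipsoid_l2_sum:
  fixes S T W :: "real ^ 'n ^ 'n"
  assumes "\<And>x. (norm (transpose W *v x))\<^sup>2 = (norm (transpose T *v x))\<^sup>2 + (norm (transpose S *v x))\<^sup>2"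
  shows "ellipsoid T \<oplus>\<^sub>2 ellipsoid S = ellipsoid W"
  by (rule l2_sum_eqI[OF convex_body_ellipsoid])
     (simp add: support_function_ellipsoid assms[symmetric] del: transpose_matrix_vector)

lemma support_function_symmetric_segment:
  "support_function (closed_segment (- w) w) x = \<bar>x \<bullet> w\<bar>"
proof -
  have "closed_segment (- w) w = {- w} + ray_segment (2 *\<^sub>R w)"
    by (simp add: closed_segment_eq_translate scaleR_2)
  moreover have "support_function {- w} x = - (x \<bullet> w)" by (simp add: support_function_def)
  ultimately show ?thesis
    using convex_body_ray_segment[of "2 *\<^sub>R w"]
    by (simp add: support_function_plus support_function_ray_segment convex_body_def)
qed

text \<open>Each segment contributes the square of one linear functional to the squared support
  function, which is a rank-one update; the zero matrix gives the initial
  \<open>{0}\<close>.\<close>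

lemma L2_zonotope_imp_ellipsoid:
  fixes P :: "(real ^ 'n) set"
  assumes "L2_zonotope P"
  shows "\<exists>T. P = ellipsoid T"
proof -
  obtain ws where ws: "P = foldr (\<lambda>w K. closed_segment (- w) w \<oplus>\<^sub>2 K) ws {0}"
    using assms by (auto simp: L2_zonotope_def)
  have "\<exists>T :: real ^ 'n ^ 'n. foldr (\<lambda>w K. closed_segment (- w) w \<oplus>\<^sub>2 K) ws {0} = ellipsoid T"
  proof (induction ws)
    case Nil
    have "ellipsoid (0 :: real ^ 'n ^ 'n) = {0}" by (auto simp: image_constant_conv)
    then show ?case by (intro exI[of _ 0]) (simp only: foldr.simps id_apply)
  next
    case (Cons w ws)
    then obtain T :: "real ^ 'n ^ 'n" where T: "foldr (\<lambda>w K. closed_segment (- w) w \<oplus>\<^sub>2 K) ws {0} = ellipsoid T" by blast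
    obtain U :: "real ^ 'n ^ 'n" where U: "\<And>x. (norm (U *v x))\<^sup>2 = (norm (transpose T *v x))\<^sup>2 + (x \<bullet> w)\<^sup>2"
      using matrix_rank_one_update by blast
    have "closed_segment (- w) w \<oplus>\<^sub>2 ellipsoid T = ellipsoid (transpose U)"
    proof (rule l2_sum_eqI[OF convex_body_ellipsoid])
      fix x
      show "support_function (ellipsoid (transpose U)) x =
         sqrt ((support_function (closed_segment (- w) w) x)\<^sup>2 + (support_function (ellipsoid T) x)\<^sup>2)"
        using U[of x] by (simp add: support_function_ellipsoid support_function_symmetric_segment
            real_sqrt_unique add.commute del: transpose_matrix_vector)
    qed
    then show ?case
      by (intro exI[of _ "transpose U"]) (simp only: foldr.simps o_apply T)
  qed
  then show ?thesis using ws by blast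
qed

lemma tendsto_support_function:
  assumes "hconv P K" "\<And>m. convex_body (P m)" "convex_body K"
  shows "(\<lambda>m. support_function (P m) x) \<longlonglongrightarrow> support_function K x"
proof (rule LIMSEQ_I)
  fix r :: real assume r: "r > 0"
  define e where "e = r / (2 * (norm x + 1))"
  have e: "e > 0" "e * norm x < r"
  proof -
    show "e > 0" unfolding e_def using r by (intro divide_pos_pos) (auto intro: add_nonneg_pos)
    have "e * (2 * (norm x + 1)) = r" unfolding e_def by (simp add: add_nonneg_eq_0_iff)
    moreover have "e * norm x \<le> e * (norm x + 1)" "0 < e * (norm x + 1)"
      using \<open>e > 0\<close> by (auto intro!: mult_pos_pos add_nonneg_pos)
    ultimately show "e * norm x < r" unfolding distrib_left by linarith
  qed
  have h: "support_function A x \<le> support_function B x + e * norm x"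
    if "A \<subseteq> B + cball 0 e" "convex_body A" "convex_body B" for A B
  proof -
    have cb: "convex_body (B + cball 0 e)" using that e by (intro convex_body_plus convex_body_cball) auto
    then have "support_function A x \<le> support_function (B + cball 0 e) x"
      using that by (intro support_function_mono) (auto simp: convex_body_def)
    also have "\<dots> = support_function B x + e * norm x"
      using that e by (subst support_function_plus) (auto simp: convex_body_def support_function_cball)
    finally show ?thesis .
  qed
  obtain N where N: "\<And>m. m \<ge> N \<Longrightarrow> P m \<subseteq> K + cball 0 e \<and> K \<subseteq> P m + cball 0 e"
    using assms(1) e(1) unfolding hconv_def eventually_sequentially by blast
  have "norm (support_function (P m) x - support_function K x) < r" if "m \<ge> N" for m
    using h[of "P m" K] h[of K "P m"] N[OF that] assms(2,3) e(2) by (auto simp: abs_if)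
  then show "\<exists>N. \<forall>m\<ge>N. norm (support_function (P m) x - support_function K x) < r" by blast
qed

text \<open>The matrices \<open>T m\<close> are fixed only up to an orthogonal factor and may fail
  to converge. Pointwise convergence of the support functions bounds their rows, however, so a
  subsequence converges, and its limit has the support function of \<open>K\<close>.\<close>

lemma L2_zonoid_imp_ellipsoid:
  fixes K :: "(real ^ 'n) set"
  assumes "L2_zonoid K"
  shows "\<exists>T. K = ellipsoid T"
proof -
  obtain P where P: "\<And>m. L2_zonotope (P m)" "hausdorff_limit P K"
    using assms by (auto simp: L2_zonoid_def)
  have "\<forall>m. \<exists>T. P m = ellipsoid T" using P(1) L2_zonotope_imp_ellipsoid by blast
  then obtain T where T: "\<And>m. P m = ellipsoid (T m)" by metis
  have cbP: "convex_body (P m)" for m unfolding T by (rule convex_body_ellipsoid)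
  have hc: "hconv P K" using P(2) cbP by (rule hausdorff_limit_imp_hconv)
  have cbK: "convex_body K"
    using P(2) by (intro hconv_convex_body[OF hc cbP]) (auto simp: hausdorff_limit_def)
  have lim: "(\<lambda>m. norm (transpose (T m) *v x)) \<longlonglongrightarrow> support_function K x" for x
    using tendsto_support_function[OF hc cbP cbK, of x] unfolding T support_function_ellipsoid .
  have "bounded (range T)"
  proof -
    have "\<exists>B. \<forall>m. norm (transpose (T m) *v x) \<le> B" for x
      using convergent_imp_Bseq[OF convergentI[OF lim[of x]]] unfolding Bseq_def by auto
    then obtain B where B: "\<And>x m. norm (transpose (T m) *v x) \<le> B x" by metis
    have "norm (T m) \<le> (\<Sum>i\<in>UNIV. B (axis i 1))" for m
    proof -
      have "norm (T m) \<le> (\<Sum>i\<in>UNIV. norm (T m $ i))"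
        unfolding norm_vec_def by (rule L2_set_le_sum) simp
      also have "\<dots> \<le> (\<Sum>i\<in>UNIV. B (axis i 1))"
      proof (rule sum_mono)
        fix i
        have "T m $ i = transpose (T m) *v axis i 1"
          unfolding matrix_vector_mult_basis column_transpose by (simp add: row_def)
        then show "norm (T m $ i) \<le> B (axis i 1)" using B by metis
      qed
      finally show ?thesis .
    qed
    then show ?thesis by (auto simp: bounded_iff)
  qed
  then obtain l r where r: "strict_mono (r :: nat \<Rightarrow> nat)" "(T \<circ> r) \<longlonglongrightarrow> l"
    using bounded_imp_convergent_subsequence[of T] by blast
  have "K = ellipsoid l"
  proof (rule convex_body_eqI[OF cbK convex_body_ellipsoid])
    fix x
    have "(\<lambda>m. norm (transpose (T (r m)) *v x)) \<longlonglongrightarrow> norm (transpose l *v x)"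
    proof (rule tendsto_norm, rule vec_tendstoI)
      fix i
      have "(\<lambda>m. \<Sum>j\<in>UNIV. T (r m) $ j $ i * x $ j) \<longlonglongrightarrow> (\<Sum>j\<in>UNIV. l $ j $ i * x $ j)"
        using r(2) by (intro tendsto_intros) (auto simp: o_def)
      then show "(\<lambda>m. (transpose (T (r m)) *v x) $ i) \<longlonglongrightarrow> (transpose l *v x) $ i"
        by (simp add: matrix_vector_mult_def transpose_def del: transpose_matrix_vector)
    qed
    moreover have "(\<lambda>m. norm (transpose (T (r m)) *v x)) \<longlonglongrightarrow> support_function K x"
      using LIMSEQ_subseq_LIMSEQ[OF lim r(1)] by (simp add: o_def)
    ultimately show "support_function K x = support_function (ellipsoid l) x"
      unfolding support_function_ellipsoid by (rule LIMSEQ_unique[symmetric])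
  qed
  then show ?thesis by blast
qed

section \<open>Homogeneity and concavity\<close>

text \<open>Scaling body \<open>i\<close> by \<open>s i\<close> amounts to substituting
  \<open>l i * s i\<close> in Minkowski's polynomial, so its coefficients are multiplied by the
  corresponding products of the \<open>s i\<close>.\<close>

lemma polarized_volume_scaleR:
  fixes Ks :: "(real ^ 'n) set list"
  assumes "length Ks = CARD('n)" "\<And>K. K \<in> set Ks \<Longrightarrow> zonoidal K" "\<And>i. i < CARD('n) \<Longrightarrow> 0 \<le> s i"
  shows "polarized_volume (map (\<lambda>i. (*\<^sub>R) (s i) ` (Ks ! i)) [0..<CARD('n)]) = (\<Prod>i<CARD('n). s i) * polarized_volume Ks"
proof -
  let ?n = "CARD('n)"
  let ?Ls = "map (\<lambda>i. (*\<^sub>R) (s i) ` (Ks ! i)) [0..<?n]"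
  obtain c where c: "minkowski_coeffs Ks c" using minkowski_coeffs_zonoidal assms by blast
  have ne: "Ks ! i \<noteq> {}" if "i < ?n" for i using assms that by (auto simp: zonoidal_def convex_body_def)
  define c' where "c' is = c is * (\<Prod>i\<leftarrow>is. s i)" for "is"
  have "minkowski_coeffs ?Ls c'"
    unfolding minkowski_coeffs_def
  proof (intro conjI allI impI)
    fix "is" js :: "nat list" assume "mset is = mset js"
    moreover from this have "c is = c js" using c unfolding minkowski_coeffs_def by blast
    moreover have "(\<Prod>i\<leftarrow>xs. s i) = prod_mset (image_mset s (mset xs))" for xs
      by (induction xs) simp_all
    ultimately show "c' is = c' js" by (simp add: c'_def)
  next
    fix l :: "nat \<Rightarrow> real" assume l: "\<forall>i<?n. 0 \<le> l i"
    have "(\<Sum>i<?n. (*\<^sub>R) (l i) ` (?Ls ! i)) = (\<Sum>i<?n. (*\<^sub>R) (l i * s i) ` (Ks ! i))"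
      by (intro sum.cong refl) (simp add: image_image)
    moreover have "\<forall>i<?n. 0 \<le> l i * s i" using l assms(3) by simp
    then have "vol (\<Sum>i<?n. (*\<^sub>R) (l i * s i) ` (Ks ! i)) =
        (\<Sum>is\<in>index_lists {..<?n} ?n. c is * (\<Prod>i\<leftarrow>is. l i * s i))"
      by (rule c[unfolded minkowski_coeffs_def, THEN conjunct2, THEN spec[of _ "\<lambda>i. l i * s i"], THEN mp])
    moreover have "(\<Prod>i\<leftarrow>is. l i * s i) = (\<Prod>i\<leftarrow>is. s i) * (\<Prod>i\<leftarrow>is. l i)" for "is"
      by (induction "is") simp_all
    ultimately show "vol (\<Sum>i<?n. (*\<^sub>R) (l i) ` (?Ls ! i)) =
        (\<Sum>is\<in>index_lists {..<?n} ?n. c' is * (\<Prod>i\<leftarrow>is. l i))"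
      by (simp add: c'_def mult.assoc)
  qed
  then have "polarized_volume ?Ls = c' [0..<?n]"
    using ne by (intro minkowski_coeffs_polarization[symmetric]) auto
  also have "\<dots> = polarized_volume Ks * (\<Prod>i\<leftarrow>[0..<?n]. s i)"
    using minkowski_coeffs_polarization[OF c ne] by (simp add: c'_def)
  also have "(\<Prod>i\<leftarrow>[0..<?n]. s i) = (\<Prod>i<?n. s i)"
    by (subst prod_list_map_nth) (auto intro!: prod.cong)
  finally show ?thesis by simp
qed

lemma ellipsoid_scaleR: "ellipsoid (c *\<^sub>R T) = (*\<^sub>R) c ` ellipsoid T"
  by (simp add: image_image scaleR_matrix_vector_assoc)

lemma ellipsoid_mixed_scaleR:
  fixes T :: "real ^ 'n ^ 'n"
  assumes "0 \<le> c" and Z: "\<And>Z. Z \<in> set Zs \<Longrightarrow> zonoidal Z" "length Zs \<le> CARD('n)"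
  shows "ellipsoid_mixed (c *\<^sub>R T) Zs = c ^ (CARD('n) - length Zs) * ellipsoid_mixed T Zs"
proof -
  let ?n = "CARD('n)"
  let ?j = "CARD('n) - length Zs"
  let ?Ks = "replicate ?j (ellipsoid T) @ Zs"
  define s where "s i = (if i < ?j then c else 1)" for i
  have "map (\<lambda>i. (*\<^sub>R) (s i) ` (?Ks ! i)) [0..<?n] = replicate ?j (ellipsoid (c *\<^sub>R T)) @ Zs"
    using Z(2) by (intro nth_equalityI) (auto simp: s_def nth_append ellipsoid_scaleR)
  moreover have "polarized_volume (map (\<lambda>i. (*\<^sub>R) (s i) ` (?Ks ! i)) [0..<?n]) = (\<Prod>i<?n. s i) * polarized_volume ?Ks"
    using Z assms(1) zonoidal_ellipsoid by (intro polarized_volume_scaleR) (auto simp: s_def)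
  moreover have "(\<Prod>i<?n. s i) = c ^ ?j"
  proof -
    have "(\<Prod>i<?n. s i) = (\<Prod>i<?j. c)"
      unfolding s_def by (intro prod.mono_neutral_cong_right) auto
    then show ?thesis by simp
  qed
  ultimately show ?thesis by simp
qed

text \<open>The volume has degree n and the mixed volume degree n - k in the scale. Their quotient
  to the power 2/k has degree 2, and scaling by \<open>sqrt c\<close> contributes
  \<open>c\<close>.\<close>

lemma ellipsoid_ratio_scaleR:
  fixes T :: "real ^ 'n ^ 'n"
  assumes c: "0 < c" and Z: "\<And>Z. Z \<in> set Zs \<Longrightarrow> zonoidal Z" "length Zs \<le> CARD('n)" "1 \<le> length Zs"
  shows "ellipsoid_ratio (sqrt c *\<^sub>R T) Zs = c * ellipsoid_ratio T Zs"
proof -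
  let ?k = "length Zs"
  have "vol (ellipsoid (sqrt c *\<^sub>R T)) = sqrt c ^ CARD('n) * vol (ellipsoid T)"
    unfolding ellipsoid_scaleR using c by (intro vol_scaleR convex_body_ellipsoid) auto
  moreover have "ellipsoid_mixed (sqrt c *\<^sub>R T) Zs = sqrt c ^ (CARD('n) - ?k) * ellipsoid_mixed T Zs"
    using c Z by (intro ellipsoid_mixed_scaleR) auto
  moreover have "sqrt c ^ CARD('n) = sqrt c ^ (CARD('n) - ?k) * sqrt c ^ ?k"
    using Z(2) by (simp flip: power_add)
  ultimately have "vol (ellipsoid (sqrt c *\<^sub>R T)) / ellipsoid_mixed (sqrt c *\<^sub>R T) Zs =
      sqrt c ^ ?k * (vol (ellipsoid T) / ellipsoid_mixed T Zs)"
    using c by simp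
  moreover have "(sqrt c ^ ?k) powr (2 / real ?k) = c"
  proof -
    have "sqrt c ^ ?k = sqrt c powr real ?k" using c by (simp add: powr_realpow)
    moreover have "real ?k \<noteq> 0" using Z(3) by linarith
    then have "real ?k * (2 / real ?k) = 2" by simp
    ultimately have "(sqrt c ^ ?k) powr (2 / real ?k) = sqrt c powr 2" by (simp only: powr_powr)
    also have "\<dots> = c" using c by simp
    finally show ?thesis .
  qed
  ultimately show ?thesis unfolding ellipsoid_ratio_def by (simp only: powr_mult)
qed

text \<open>The squared support function of \<open>W t\<close> is affine in \<open>t\<close>, so the
  ellipsoid at a convex combination of parameters is the \<open>\<oplus>\<^sub>2\<close>-sum of the
  two ellipsoids scaled by \<open>sqrt (1 - t)\<close> and \<open>sqrt t\<close>. Superadditivity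
  and homogeneity then give concavity.\<close>

lemma concave_ellipsoid_ratio:
  fixes S T :: "real ^ 'n ^ 'n"
  assumes Z: "1 \<le> length Zs" "length Zs \<le> CARD('n)" "\<And>Z. Z \<in> set Zs \<Longrightarrow> zonoidal Z"
    and pos: "0 < ellipsoid_mixed T Zs"
    and W: "\<And>t x. 0 \<le> t \<Longrightarrow> (norm (transpose (W t) *v x))\<^sup>2 = (norm (transpose T *v x))\<^sup>2 + t * (norm (transpose S *v x))\<^sup>2"
  shows "concave_on {0..} (\<lambda>t. ellipsoid_ratio (W t) Zs)"
proof (rule concave_on_linorderI)
  fix t x y :: real assume t: "0 < t" "t < 1" and xy: "x \<in> {0..}" "y \<in> {0..}"
  have posW: "0 < ellipsoid_mixed (W u) Zs" if "0 \<le> u" for u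
  proof (rule ellipsoid_mixed_pos_mono[OF _ Z(3,2) pos])
    fix v
    have "(norm (transpose T *v v))\<^sup>2 \<le> (norm (transpose (W u) *v v))\<^sup>2" using W[OF that, of v] that by simp
    then show "norm (transpose T *v v) \<le> norm (transpose (W u) *v v)" by (rule power2_le_imp_le) simp
  qed
  have posW': "0 < ellipsoid_mixed (sqrt c *\<^sub>R W u) Zs" if "0 < c" "0 \<le> u" for c u
    using posW[OF that(2)] that Z by (subst ellipsoid_mixed_scaleR) auto
  have "ellipsoid_ratio (sqrt (1 - t) *\<^sub>R W x) Zs + ellipsoid_ratio (sqrt t *\<^sub>R W y) Zs \<le> ellipsoid_ratio (W ((1 - t) *\<^sub>R x + t *\<^sub>R y)) Zs"
  proof (rule ellipsoid_ratio_superadditive[OF Z])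
    fix v
    have tr: "(norm (transpose (sqrt c *\<^sub>R W u) *v v))\<^sup>2 = c * (norm (transpose (W u) *v v))\<^sup>2" if "0 < c" for c u
    proof -
      have "transpose (sqrt c *\<^sub>R W u) = sqrt c *\<^sub>R transpose (W u)" by (simp add: transpose_def vec_eq_iff)
      then show ?thesis using that
        by (simp add: scaleR_matrix_vector_assoc[symmetric] power_mult_distrib del: transpose_matrix_vector)
    qed
    have "0 \<le> (1 - t) * x + t * y" using t xy by simp
    then show "(norm (transpose (W ((1 - t) *\<^sub>R x + t *\<^sub>R y)) *v v))\<^sup>2 =
      (norm (transpose (sqrt (1 - t) *\<^sub>R W x) *v v))\<^sup>2 + (norm (transpose (sqrt t *\<^sub>R W y) *v v))\<^sup>2"
      using t xy W[of x v] W[of y v] W[of "(1 - t) * x + t * y" v]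
      by (simp add: tr del: transpose_matrix_vector) (simp add: algebra_simps)
  qed (use posW' t xy in auto)
  then show "(1 - t) * ellipsoid_ratio (W x) Zs + t * ellipsoid_ratio (W y) Zs \<le> ellipsoid_ratio (W ((1 - t) *\<^sub>R x + t *\<^sub>R y)) Zs"
    using t Z by (simp add: ellipsoid_ratio_scaleR)
qed simp

section \<open>Conclusions for zonoids and for the surface area\<close>

lemma mixed_volume_rep_ellipsoid:
  fixes T :: "real ^ 'n ^ 'n"
  assumes "length Zs \<le> CARD('n)" "\<And>Z. Z \<in> set Zs \<Longrightarrow> zonoidal Z"
  shows "mixed_volume_rep (ellipsoid T) (CARD('n) - length Zs) Zs = ellipsoid_mixed T Zs"
  using assms zonoidal_ellipsoid by (intro mixed_volume_zonoidal) auto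

text \<open>Stated for \<open>zonoidal\<close> bodies so that it covers both the given zonoids and
  the unit ball. The positivity conclusion is what the surface area needs in order to rewrite
  squared quotients as powers.\<close>

lemma L2_zonoid_ratio_superadditive_concave:
  fixes A B :: "(real ^ 'n) set"
  assumes len: "1 \<le> length Zs" "length Zs \<le> CARD('n)" and zonoidal: "\<forall>Z\<in>set Zs. zonoidal Z"
    and AB: "L2_zonoid A" "L2_zonoid B"
  defines "V \<equiv> \<lambda>K. mixed_volume_rep K (CARD('n) - length Zs) Zs"
  shows "0 < V A \<Longrightarrow> 0 < V B \<Longrightarrow>
      (vol A / V A) powr (2 / real (length Zs)) + (vol B / V B) powr (2 / real (length Zs))
        \<le> (vol (A \<oplus>\<^sub>2 B) / V (A \<oplus>\<^sub>2 B)) powr (2 / real (length Zs))" (is "_ \<Longrightarrow> _ \<Longrightarrow> ?sup")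
    and "0 < V A \<Longrightarrow> concave_on {0..} (\<lambda>t. (vol (A \<oplus>\<^sub>2 (*\<^sub>R) (sqrt t) ` B) / V (A \<oplus>\<^sub>2 (*\<^sub>R) (sqrt t) ` B)) powr (2 / real (length Zs)))" (is "_ \<Longrightarrow> ?conc")
    and "0 < V A \<Longrightarrow> 0 < V (A \<oplus>\<^sub>2 (*\<^sub>R) (sqrt t) ` B)" (is "_ \<Longrightarrow> ?pos")
proof -
  note Z = len bspec[OF zonoidal]
  obtain T where T: "A = ellipsoid T" using L2_zonoid_imp_ellipsoid AB by blast
  obtain S where S: "B = ellipsoid S" using L2_zonoid_imp_ellipsoid AB by blast
  have V: "V (ellipsoid X) = ellipsoid_mixed X Zs" for X
    unfolding V_def using Z by (intro mixed_volume_rep_ellipsoid) auto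
  have ratio: "(vol (ellipsoid X) / V (ellipsoid X)) powr (2 / real (length Zs)) = ellipsoid_ratio X Zs" for X
    by (simp add: V ellipsoid_ratio_def)
  \<comment> \<open>\<open>W\<close> is chosen for every real \<open>t\<close>, with
    \<open>sqrt t *\<^sub>R S\<close> left unevaluated; this gives the positivity conclusion without
    a sign condition on \<open>t\<close>.\<close>
  have "\<forall>t. \<exists>W :: real ^ 'n ^ 'n. \<forall>x. (norm (transpose W *v x))\<^sup>2 = (norm (transpose T *v x))\<^sup>2 + (norm (transpose (sqrt t *\<^sub>R S) *v x))\<^sup>2"
    using ex_sum_matrix by blast
  from choice[OF this] obtain W :: "real \<Rightarrow> real ^ 'n ^ 'n"
    where W: "\<And>t x. (norm (transpose (W t) *v x))\<^sup>2 = (norm (transpose T *v x))\<^sup>2 + (norm (transpose (sqrt t *\<^sub>R S) *v x))\<^sup>2"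
    by blast
  have sum: "A \<oplus>\<^sub>2 (*\<^sub>R) (sqrt t) ` B = ellipsoid (W t)" for t
    unfolding T S ellipsoid_scaleR[symmetric] by (rule ellipsoid_l2_sum[OF W])
  have W': "(norm (transpose (W t) *v x))\<^sup>2 = (norm (transpose T *v x))\<^sup>2 + t * (norm (transpose S *v x))\<^sup>2" if "0 \<le> t" for t x
  proof -
    have "transpose (sqrt t *\<^sub>R S) = sqrt t *\<^sub>R transpose S" by (simp add: transpose_def vec_eq_iff)
    then show ?thesis using W[of t x] that
      by (simp add: scaleR_matrix_vector_assoc[symmetric] power_mult_distrib del: transpose_matrix_vector)
  qed
  show ?sup if pos: "0 < V A" "0 < V B"
  proof -
    have "ellipsoid_ratio T Zs + ellipsoid_ratio S Zs \<le> ellipsoid_ratio (W 1) Zs"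
      using W'[of 1] pos unfolding T S V by (intro ellipsoid_ratio_superadditive Z) auto
    moreover have "A \<oplus>\<^sub>2 B = ellipsoid (W 1)"
      unfolding T S using W'[of 1] by (intro ellipsoid_l2_sum) simp
    ultimately show ?thesis unfolding T S by (simp only: ratio)
  qed
  show ?conc if "0 < V A"
  proof -
    have "0 < ellipsoid_mixed T Zs" using that unfolding T V .
    from concave_ellipsoid_ratio[OF Z this W'] show ?thesis unfolding sum ratio .
  qed
  show ?pos if "0 < V A"
  proof -
    have pos: "0 < ellipsoid_mixed T Zs" using that unfolding T V .
    have "norm (transpose T *v x) \<le> norm (transpose (W t) *v x)" for x
      using sum_squares_eq_imp_le(1)[OF W[of t x]] by simp
    from ellipsoid_mixed_pos_mono[OF this Z(3,2) pos] show ?thesis unfolding sum V .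
  qed
qed

theorem corollary6p7:
  fixes k :: nat
    and A B :: "(real ^ 'n) set"
    and Zs :: "(real ^ 'n) set list"
  assumes "1 \<le> k" and "k \<le> CARD('n)"
    and "L2_zonoid A" and "L2_zonoid B"
    and "length Zs = k" and "\<forall>Z\<in>set Zs. zonoid Z"
  shows
    "(mixed_volume_rep A (CARD('n) - k) Zs > 0 \<and> mixed_volume_rep B (CARD('n) - k) Zs > 0 \<longrightarrow>
        (vol (A \<oplus>\<^sub>2 B) / mixed_volume_rep (A \<oplus>\<^sub>2 B) (CARD('n) - k) Zs) powr (2 / real k)
          \<ge> (vol A / mixed_volume_rep A (CARD('n) - k) Zs) powr (2 / real k)
            + (vol B / mixed_volume_rep B (CARD('n) - k) Zs) powr (2 / real k)) \<and>
     (mixed_volume_rep A (CARD('n) - k) Zs > 0 \<longrightarrow>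
        concave_on {0..} (\<lambda>t.
          (vol (A \<oplus>\<^sub>2 (*\<^sub>R) (sqrt t) ` B)
            / mixed_volume_rep (A \<oplus>\<^sub>2 (*\<^sub>R) (sqrt t) ` B) (CARD('n) - k) Zs) powr (2 / real k))) \<and>
     (surface_area A > 0 \<and> surface_area B > 0 \<longrightarrow>
        (vol (A \<oplus>\<^sub>2 B))\<^sup>2 / (surface_area (A \<oplus>\<^sub>2 B))\<^sup>2
          \<ge> (vol A)\<^sup>2 / (surface_area A)\<^sup>2 + (vol B)\<^sup>2 / (surface_area B)\<^sup>2) \<and>
     (surface_area A > 0 \<longrightarrow>
        concave_on {0..} (\<lambda>t.
          (vol (A \<oplus>\<^sub>2 (*\<^sub>R) (sqrt t) ` B))\<^sup>2
            / (surface_area (A \<oplus>\<^sub>2 (*\<^sub>R) (sqrt t) ` B))\<^sup>2))"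
proof -
  have k: "k = length Zs" and Z: "1 \<le> length Zs" "length Zs \<le> CARD('n)" "\<forall>Z\<in>set Zs. zonoidal Z"
    using assms by (auto intro: zonoid_imp_zonoidal)
  note main = L2_zonoid_ratio_superadditive_concave[OF Z assms(3,4), folded k]
  define V where "V K = mixed_volume_rep K (CARD('n) - 1) [cball 0 1]" for K :: "(real ^ 'n) set"
  have ball: "1 \<le> length [cball (0 :: real ^ 'n) 1]" "length [cball (0 :: real ^ 'n) 1] \<le> CARD('n)"
    "\<forall>Z\<in>set [cball (0 :: real ^ 'n) 1]. zonoidal Z"
    using assms by (auto simp: zonoidal_cball)
  have len: "length [cball (0 :: real ^ 'n) 1] = 1" by simp
  note surf = L2_zonoid_ratio_superadditive_concave[OF ball assms(3,4), unfolded len, folded V_def]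
  define n where "n = real CARD('n)"
  have n: "0 < n" by (simp add: n_def)
  have area: "surface_area K = n * V K" for K by (simp add: surface_area_def V_def n_def)
  have pos: "0 < V K" if "0 < surface_area K" for K
    using that n by (simp add: area zero_less_mult_iff)
  \<comment> \<open>For a single body the exponent 2/k is 2, and \<open>powr\<close> is the square
    since the quotient is nonnegative. The factor 1/n^2 preserves superadditivity and concavity
    alike.\<close>
  have sq: "(vol K)\<^sup>2 / (surface_area K)\<^sup>2 = 1 / n\<^sup>2 * (vol K / V K) powr (2 / real 1)" if "0 < V K" for K
  proof -
    have "0 \<le> vol K / V K" using that by simp
    then have "(vol K / V K) powr (2 / real 1) = (vol K / V K)\<^sup>2" by simp
    then show ?thesis by (simp add: area power_mult_distrib power_divide)
  qed
  have c: "(vol A)\<^sup>2 / (surface_area A)\<^sup>2 + (vol B)\<^sup>2 / (surface_area B)\<^sup>2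
      \<le> (vol (A \<oplus>\<^sub>2 B))\<^sup>2 / (surface_area (A \<oplus>\<^sub>2 B))\<^sup>2"
    if "0 < surface_area A" "0 < surface_area B"
  proof -
    have "0 < V (A \<oplus>\<^sub>2 B)" using surf(3)[OF pos[OF that(1)], of 1] by simp
    then show ?thesis
      using mult_left_mono[OF surf(1)[OF pos[OF that(1)] pos[OF that(2)]], of "1 / n\<^sup>2"]
      unfolding sq[OF pos[OF that(1)]] sq[OF pos[OF that(2)]] distrib_left by (simp only: sq) simp
  qed
  have d: "concave_on {0..} (\<lambda>t. (vol (A \<oplus>\<^sub>2 (*\<^sub>R) (sqrt t) ` B))\<^sup>2
      / (surface_area (A \<oplus>\<^sub>2 (*\<^sub>R) (sqrt t) ` B))\<^sup>2)" if "0 < surface_area A"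
    \<comment> \<open>Positivity holds for all real \<open>t\<close>, so the rewriting goes through
      under the binder.\<close>
    unfolding sq[OF surf(3)[OF pos[OF that]]]
    by (intro concave_on_cmul surf(2) pos[OF that]) simp
  show ?thesis
    using main(1,2) c d by blast
qed

end
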